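(* Let $p,q$ be distinct primes, let $m,n$ be positive integers, let $N=p^mq^n$, and let $A\subseteq\mathbb{Z}_N$ be a spectral set. Then $A$ tiles $\mathbb{Z}_N$ if one of the following holds: (1) $p<q$, and either $m\leq 9$ or $n\leq 6$; (2) $p^{m-2}<q^4$.
   Context: $\mathbb{Z}_N$ is the cyclic group $\mathbb{Z}/N\mathbb{Z}$ and $\zeta_N=e^{2\pi i/N}$. A nonempty set $A\subseteq\mathbb{Z}_N$ is called spectral if there is $B\subseteq\mathbb{Z}_N$ with $|A|=|B|$ and $\sum_{a\in A}\zeta_N^{a(b-b')}=0$ for all $b,b'\in B$ with $b\neq b'$. A set $A\subseteq\mathbb{Z}_N$ tiles $\mathbb{Z}_N$ (by translations) if there is $T\subseteq\mathbb{Z}_N$ such that every element of $\mathbb{Z}_N$ can be written uniquely as $a+t$ with $a\in A$, $t\in T$. *)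

theory Defs
  imports "HOL-Analysis.Analysis" "HOL-Algebra.Elementary_Groups"
    "HOL-Computational_Algebra.Primes"
begin

text \<open>
  The cyclic group of order \<open>N\<close> is the library's \<^term>\<open>integer_mod_group N\<close>, whose carrier
  consists of the integer representatives \<open>0, ..., N - 1\<close> when \<open>N > 0\<close>.
\<close>

definition zeta :: "nat \<Rightarrow> complex" where
  "zeta N = exp (2 * of_real pi * \<i> / of_nat N)"

text \<open>
  In the exponent \<open>a * (b - b')\<close> the difference and the product are taken in the integers;
  since \<open>zeta N\<close> is an \<open>N\<close>-th root of unity, this gives the same value as computing modulo \<open>N\<close>.
\<close>

definition spectral :: "nat \<Rightarrow> int set \<Rightarrow> bool" where
  "spectral N A \<longleftrightarrow>
     A \<subseteq> carrier (integer_mod_group N) \<and> A \<noteq> {} \<and>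
     (\<exists>B \<subseteq> carrier (integer_mod_group N).
        card A = card B \<and>
        (\<forall>b\<in>B. \<forall>b'\<in>B. b \<noteq> b' \<longrightarrow> (\<Sum>a\<in>A. zeta N powi (a * (b - b'))) = 0))"

definition tiles :: "nat \<Rightarrow> int set \<Rightarrow> bool" where
  "tiles N A \<longleftrightarrow>
     A \<subseteq> carrier (integer_mod_group N) \<and>
     (\<exists>T \<subseteq> carrier (integer_mod_group N).
        \<forall>x \<in> carrier (integer_mod_group N).
          \<exists>!z. z \<in> A \<times> T \<and> x = fst z \<otimes>\<^bsub>integer_mod_group N\<^esub> snd z)"

end

(*
  Write N = p^m q^n and let (A, B) be a spectral pair. By Galois invariance the zeros of the Fourier
  transforms of A and B are conditions on the numbers of points in residue classes, symmetric in A and B.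
  One shows by induction on m + n that A and B tile by complementary sets of p-adic and q-adic digits.
  If some digit never separates two elements of A or of B, that digit is deleted; if A or B is
  invariant under the subgroup of order p or q, one passes to the quotient. In the remaining case, walking
  down the tree of p-adic digits of A while controlling the quotients of B bounds |A| from above in terms
  of the gaps of the walk, and forces a high power of p to divide |A|; likewise for q. Together these give
  p^m > p^2 q^4 and q^n > q^2 p^4, and m >= 10, n >= 7 if p < q, against the hypotheses.
*)
theory Submission
  imports Defs "HOL-Number_Theory.Cong"
begin

section \<open>Vanishing character sums as counting conditions\<close>

text \<open>The claim that only \<open>A\<close> tiles would not carry the induction. When
  \<open>A\<close> is a union of fibres, \<open>B\<close> breaks into several parts, and their
  tilings can be glued only because digit sets are determined by zeros, so that all parts share
  those of the quotient of \<open>A\<close>. The irreducible case ends in one inequality,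
  \<open>p ^ (u + x + g) * q ^ y \<le> p ^ m\<close>. Here \<open>u\<close> counts the uniform
  levels of \<open>A\<close>, and \<open>u - 2\<close> is at least an exponent \<open>a'\<close>
  with \<open>p ^ a' > q\<close>; \<open>x\<close> is extra divisibility of the size of
  \<open>A\<close>, forced by equality in a coset bound; \<open>g\<close> is the number of gaps of
  the walk with \<open>A\<close> and \<open>B\<close> exchanged; \<open>y\<close> is the counterpart
  of \<open>x\<close> for the other prime, with \<open>q ^ y > p\<close>. Since \<open>q\<close> is
  no power of \<open>p\<close>, each of \<open>p ^ a'\<close>, \<open>p ^ x\<close>,
  \<open>p ^ g\<close> exceeds \<open>q\<close> strictly, whence \<open>p^2 q^4\<close>. Comparing
  exponents of \<open>p\<close> alone gives \<open>a' + x + g + 3 < m\<close>: the three exponents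
  are at least 2 if \<open>p < q\<close>, which yields 10, and at least 1 if \<open>q < p\<close>,
  which yields 7.\<close>

text \<open>
  By the Chinese remainder theorem a residue modulo \<open>p ^ m * q ^ n\<close> is a pair \<open>(x, y)\<close>.
  \<open>zr p q S i j\<close> says that the Fourier transform of \<open>S\<close> vanishes at the elements of order
  \<open>p ^ i * q ^ j\<close>, written as a condition on the number \<open>cn p q S i j x y\<close> of points of \<open>S\<close>
  in residue classes. The level \<open>lv p m x x'\<close> is the \<open>p\<close>-adic valuation of \<open>x - x'\<close>, capped at \<open>m\<close>;
  the difference has order \<open>p ^ (m - lv p m x x')\<close>.
\<close>

definition cl :: "nat \<Rightarrow> nat \<Rightarrow> (nat \<times> nat) set \<Rightarrow> nat \<Rightarrow> nat \<Rightarrow> nat \<Rightarrow> nat \<Rightarrow> (nat \<times> nat) set" where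
  "cl p q S i j x y = {z \<in> S. fst z mod p ^ i = x mod p ^ i \<and> snd z mod q ^ j = y mod q ^ j}"

definition cn :: "nat \<Rightarrow> nat \<Rightarrow> (nat \<times> nat) set \<Rightarrow> nat \<Rightarrow> nat \<Rightarrow> nat \<Rightarrow> nat \<Rightarrow> nat" where
  "cn p q S i j x y = card (cl p q S i j x y)"

fun zr :: "nat \<Rightarrow> nat \<Rightarrow> (nat \<times> nat) set \<Rightarrow> nat \<Rightarrow> nat \<Rightarrow> bool" where
  "zr p q S 0 0 = False"
| "zr p q S (Suc i) 0 = (\<forall>x x'. x mod p ^ i = x' mod p ^ i \<longrightarrow>
     cn p q S (Suc i) 0 x 0 = cn p q S (Suc i) 0 x' 0)"
| "zr p q S 0 (Suc j) = (\<forall>y y'. y mod q ^ j = y' mod q ^ j \<longrightarrow>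
     cn p q S 0 (Suc j) 0 y = cn p q S 0 (Suc j) 0 y')"
| "zr p q S (Suc i) (Suc j) = (\<forall>x x' y y'. x mod p ^ i = x' mod p ^ i \<longrightarrow> y mod q ^ j = y' mod q ^ j \<longrightarrow>
     cn p q S (Suc i) (Suc j) x y + cn p q S (Suc i) (Suc j) x' y' =
     cn p q S (Suc i) (Suc j) x y' + cn p q S (Suc i) (Suc j) x' y)"

definition lv :: "nat \<Rightarrow> nat \<Rightarrow> nat \<Rightarrow> nat \<Rightarrow> nat" where
  "lv p m x x' = Max {v. v \<le> m \<and> x mod p ^ v = x' mod p ^ v}"

lemma mod_pow_mono: "(x::nat) mod p ^ v = x' mod p ^ v \<Longrightarrow> u \<le> v \<Longrightarrow> x mod p ^ u = x' mod p ^ u"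
  by (metis le_imp_power_dvd mod_mod_cancel)

lemma lv_le: "lv p m x x' \<le> m"
  unfolding lv_def by (rule Max.boundedI) (auto intro: exI[of _ 0])

lemma lv_mod: "x mod p ^ lv p m x x' = x' mod p ^ lv p m x x'"
proof -
  have "lv p m x x' \<in> {v. v \<le> m \<and> x mod p ^ v = x' mod p ^ v}"
    unfolding lv_def by (rule Max_in) (auto intro: exI[of _ 0])
  then show ?thesis by simp
qed

lemma lv_iff: "v \<le> m \<Longrightarrow> v \<le> lv p m x x' \<longleftrightarrow> x mod p ^ v = x' mod p ^ v"
proof
  assume "v \<le> lv p m x x'"
  then show "x mod p ^ v = x' mod p ^ v" using lv_mod mod_pow_mono by blast
next
  assume "v \<le> m" "x mod p ^ v = x' mod p ^ v"
  then show "v \<le> lv p m x x'" unfolding lv_def by (intro Max_ge) auto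
qed

lemma lv_eq_iff: "x < p ^ m \<Longrightarrow> x' < p ^ m \<Longrightarrow> lv p m x x' = m \<longleftrightarrow> x = x'"
  using lv_iff[of m m p x x'] lv_le[of p m x x'] by auto

lemma lv_eqI: "v < m \<Longrightarrow> x mod p ^ v = x' mod p ^ v \<Longrightarrow> x mod p ^ Suc v \<noteq> x' mod p ^ Suc v \<Longrightarrow> lv p m x x' = v"
  by (metis le_antisym less_or_eq_imp_le lv_iff not_less_eq_eq Suc_leI)

lemma lv_less_neq: "lv p m x x' < m \<Longrightarrow> x mod p ^ Suc (lv p m x x') \<noteq> x' mod p ^ Suc (lv p m x x')"
  using lv_iff[of "Suc (lv p m x x')" m p x x'] by auto

lemma lv_refl[simp]: "lv p m x x = m"
  using lv_iff[of m m p x x] lv_le[of p m x x] by auto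

text \<open>Both orthogonality relations are part of the definition, so the two sets can be
  exchanged at any point; that one relation implies the other for sets of equal size is proved in
  \<open>orthogonal_rows\<close>. Phrasing them through \<open>zr\<close> makes quotients and
  deletion of digits a matter of counting.\<close>

definition spair :: "nat \<Rightarrow> nat \<Rightarrow> nat \<Rightarrow> nat \<Rightarrow> (nat \<times> nat) set \<Rightarrow> (nat \<times> nat) set \<Rightarrow> bool" where
  "spair p q m n A B \<longleftrightarrow> A \<subseteq> {..<p ^ m} \<times> {..<q ^ n} \<and> B \<subseteq> {..<p ^ m} \<times> {..<q ^ n} \<and>
     A \<noteq> {} \<and> card A = card B \<and>
     (\<forall>b\<in>B. \<forall>b'\<in>B. b \<noteq> b' \<longrightarrow> zr p q A (m - lv p m (fst b) (fst b')) (n - lv q n (snd b) (snd b'))) \<and>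
     (\<forall>a\<in>A. \<forall>a'\<in>A. a \<noteq> a' \<longrightarrow> zr p q B (m - lv p m (fst a) (fst a')) (n - lv q n (snd a) (snd a')))"

lemma spair_finite: "spair p q m n A B \<Longrightarrow> finite A" "spair p q m n A B \<Longrightarrow> finite B"
  unfolding spair_def by (auto intro: finite_subset)

lemma spair_pos: assumes "spair p q m n A B" shows "card A > 0" "card B > 0" "B \<noteq> {}"
proof -
  show "card A > 0" using assms spair_finite[OF assms] unfolding spair_def by (auto simp: card_gt_0_iff)
  then show "card B > 0" using assms unfolding spair_def by auto
  then show "B \<noteq> {}" by auto
qed

lemma spair_sym: "spair p q m n A B \<Longrightarrow> spair p q m n B A"
  using spair_pos[of p q m n A B] unfolding spair_def by auto

lemma cl_swap: "cl q p (prod.swap ` S) j i y x = prod.swap ` cl p q S i j x y"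
  unfolding cl_def by (auto simp: image_iff)

lemma cn_swap: "cn q p (prod.swap ` S) j i y x = cn p q S i j x y"
  unfolding cn_def cl_swap by (simp add: card_image)

lemma zr_swap: "zr q p (prod.swap ` S) j i = zr p q S i j"
proof (cases i)
  case 0 then show ?thesis by (cases j) (simp_all add: cn_swap)
next
  case (Suc k) then show ?thesis 
    by (cases j) (simp_all add: cn_swap, metis add.commute)
qed

lemma spair_swap: "spair p q m n A B \<Longrightarrow> spair q p n m (prod.swap ` A) (prod.swap ` B)"
  unfolding spair_def zr_swap
  by (auto simp: card_image zr_swap)

lemma cl_fin: "finite S \<Longrightarrow> finite (cl p q S i j x y)"
  unfolding cl_def by auto

section \<open>From counting conditions to vanishing character sums\<close>

lemma sum_shift_mod:
  fixes f :: "nat \<Rightarrow> complex"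
  assumes "N > 0"
  shows "(\<Sum>x<N. f ((x + c) mod N)) = (\<Sum>x<N. f x)"
proof -
  have inj: "inj_on (\<lambda>x. (x + c) mod N) {..<N}"
  proof (rule inj_onI)
    fix x y assume xy: "x \<in> {..<N}" "y \<in> {..<N}" "(x + c) mod N = (y + c) mod N"
    then show "x = y"
    proof (induction c)
      case (Suc c)
      have "(x + c) mod N = (y + c) mod N"
        using Suc.prems(3) mod_Suc[of "x + c" N] mod_Suc[of "y + c" N] by (auto split: if_splits)
      then show ?case using Suc by simp
    qed simp
  qed
  have "(\<lambda>x. (x + c) mod N) ` {..<N} \<subseteq> {..<N}" using assms by auto
  then have "(\<lambda>x. (x + c) mod N) ` {..<N} = {..<N}"
    using inj by (simp add: endo_inj_surj)
  then have "bij_betw (\<lambda>x. (x + c) mod N) {..<N} {..<N}" using inj by (simp add: bij_betw_def)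
  then show ?thesis by (rule sum.reindex_bij_betw[of _ _ _ f])
qed

text \<open>
  The \<open>p\<close>-component of a character of order \<open>p ^ i * q ^ j\<close>, reduced to the two properties that
  \<open>zr\<close> needs.
\<close>

definition pchar :: "nat \<Rightarrow> nat \<Rightarrow> (nat \<Rightarrow> complex) \<Rightarrow> bool" where
  "pchar p i f \<longleftrightarrow> (\<forall>x x'. x mod p ^ i = x' mod p ^ i \<longrightarrow> f x = f x') \<and>
     (if i = 0 then \<forall>x. f x = 1 else \<exists>w. w \<noteq> 1 \<and> (\<forall>x. f (x + p ^ (i - 1)) = w * f x))"

lemma pchar_per: "pchar p i f \<Longrightarrow> x mod p ^ i = x' mod p ^ i \<Longrightarrow> f x = f x'"
  unfolding pchar_def by blast

lemma pchar_shift: "pchar p (Suc i) f \<Longrightarrow> \<exists>w. w \<noteq> 1 \<and> (\<forall>x. f (x + p ^ i) = w * f x)"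
  unfolding pchar_def by (metis diff_Suc_1 nat.distinct(1))

lemma pchar_0: "pchar p 0 f \<Longrightarrow> f x = 1"
  unfolding pchar_def by simp

text \<open>Translation by \<open>p ^ i\<close> permutes the residues, fixes \<open>h\<close> and
  multiplies \<open>f\<close> by \<open>w \<noteq> 1\<close>, so the sum equals \<open>w\<close>
  times itself.\<close>

lemma pchar_sum_0:
  assumes "pchar p (Suc i) f" "p > 0" and h: "\<And>x x'. x mod p ^ i = x' mod p ^ i \<Longrightarrow> h x = h x'"
  shows "(\<Sum>x<p ^ Suc i. f x * h x) = (0::complex)"
proof -
  obtain w where w: "w \<noteq> 1" "\<And>x. f (x + p ^ i) = w * f x" using pchar_shift[OF assms(1)] by blast
  note per = pchar_per[OF assms(1)]
  let ?S = "\<Sum>x<p ^ Suc i. f x * h x"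
  have "?S = (\<Sum>x<p ^ Suc i. f ((x + p ^ i) mod p ^ Suc i) * h ((x + p ^ i) mod p ^ Suc i))"
    by (rule sum_shift_mod[symmetric, of _ "\<lambda>x. f x * h x"]) (use assms(2) in simp)
  also have "\<dots> = (\<Sum>x<p ^ Suc i. w * (f x * h x))"
  proof (rule sum.cong, simp)
    fix x
    have "f ((x + p ^ i) mod p ^ Suc i) = w * f x" using per[of "(x + p ^ i) mod p ^ Suc i" "x + p ^ i"] w(2) by auto
    moreover have "h ((x + p ^ i) mod p ^ Suc i) = h x"
    proof (rule h)
      have "(x + p ^ i) mod p ^ Suc i mod p ^ i = (x + p ^ i) mod p ^ i"
        by (rule mod_mod_cancel) auto
      then show "(x + p ^ i) mod p ^ Suc i mod p ^ i = x mod p ^ i" by simp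
    qed
    ultimately show "f ((x + p ^ i) mod p ^ Suc i) * h ((x + p ^ i) mod p ^ Suc i) = w * (f x * h x)" by simp
  qed
  also have "\<dots> = w * ?S" by (simp add: sum_distrib_left)
  finally have "(1 - w) * ?S = 0" by (simp add: algebra_simps)
  then show ?thesis using w(1) by simp
qed

lemma sum_by_classes:
  assumes "finite S" "p > 0" "q > 0" 
    and f: "\<And>x x'. x mod p ^ i = x' mod p ^ i \<Longrightarrow> f x = f x'"
    and g: "\<And>y y'. y mod q ^ j = y' mod q ^ j \<Longrightarrow> g y = g y'"
  shows "(\<Sum>z\<in>S. f (fst z) * g (snd z)) = (\<Sum>x<p ^ i. \<Sum>y<q ^ j. f x * g y * (of_nat (cn p q S i j x y)::complex))"
proof -
  let ?h = "\<lambda>z. (fst z mod p ^ i, snd z mod q ^ j)"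
  have "(\<Sum>z\<in>S. f (fst z) * g (snd z)) =
     (\<Sum>w\<in>{..<p ^ i} \<times> {..<q ^ j}. \<Sum>z\<in>{z \<in> S. ?h z = w}. f (fst z) * g (snd z))"
    by (rule sum.group[symmetric]) (use assms in auto)
  also have "\<dots> = (\<Sum>w\<in>{..<p ^ i} \<times> {..<q ^ j}. f (fst w) * g (snd w) * of_nat (cn p q S i j (fst w) (snd w)))"
  proof (rule sum.cong, simp)
    fix w assume w: "w \<in> {..<p ^ i} \<times> {..<q ^ j}"
    have eq: "{z \<in> S. ?h z = w} = cl p q S i j (fst w) (snd w)" using w unfolding cl_def by auto
    have "(\<Sum>z\<in>{z \<in> S. ?h z = w}. f (fst z) * g (snd z)) = (\<Sum>z\<in>{z \<in> S. ?h z = w}. f (fst w) * g (snd w))"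
    proof (rule sum.cong, simp)
      fix z assume "z \<in> {z \<in> S. ?h z = w}"
      then have z: "fst z mod p ^ i = fst w" "snd z mod q ^ j = snd w" by auto
      have "f (fst z) = f (fst w)" by (rule f) (simp add: z(1)[symmetric])
      moreover have "g (snd z) = g (snd w)" by (rule g) (simp add: z(2)[symmetric])
      ultimately show "f (fst z) * g (snd z) = f (fst w) * g (snd w)" by simp
    qed
    then show "(\<Sum>z\<in>{z \<in> S. ?h z = w}. f (fst z) * g (snd z)) = f (fst w) * g (snd w) * of_nat (cn p q S i j (fst w) (snd w))"
      unfolding eq cn_def by simp
  qed
  also have "\<dots> = (\<Sum>x<p ^ i. \<Sum>y<q ^ j. f x * g y * of_nat (cn p q S i j x y))"
    by (simp add: sum.cartesian_product case_prod_beta)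
  finally show ?thesis .
qed

lemma cn_cong: "x mod p ^ i = x' mod p ^ i \<Longrightarrow> y mod q ^ j = y' mod q ^ j \<Longrightarrow> cn p q S i j x y = cn p q S i j x' y'"
  unfolding cn_def cl_def by simp

text \<open>For mixed order the four-term relation writes the count as a summand that sees
  \<open>y\<close> only modulo \<open>q ^ (j - 1)\<close> plus one that sees \<open>x\<close> only
  modulo \<open>p ^ (i - 1)\<close>. Summation against \<open>g\<close> kills the first, against
  \<open>f\<close> the second.\<close>

lemma zr_char:
  assumes "finite S" "p > 0" "q > 0" "zr p q S i j" "pchar p i f" "pchar q j g"
  shows "(\<Sum>z\<in>S. f (fst z) * g (snd z)) = 0"
proof -
  let ?c = "\<lambda>x y. of_nat (cn p q S i j x y) :: complex"
  have eq: "(\<Sum>z\<in>S. f (fst z) * g (snd z)) = (\<Sum>x<p ^ i. \<Sum>y<q ^ j. f x * g y * ?c x y)"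
    by (rule sum_by_classes) (use assms pchar_per in blast)+
  show ?thesis
  proof (cases i)
    case i0: 0
    then obtain j' where j: "j = Suc j'" using assms(4) by (cases j) auto
    have f: "f x = 1" for x using assms(5) i0 pchar_0 by blast
    have "(\<Sum>y<q ^ Suc j'. g y * ?c 0 y) = 0"
    proof (rule pchar_sum_0[OF assms(6)[unfolded j] assms(3)])
      fix y y' :: nat assume "y mod q ^ j' = y' mod q ^ j'"
      then show "?c 0 y = ?c 0 y'" using assms(4) unfolding i0 j zr.simps by metis
    qed
    then show ?thesis unfolding eq using i0 j f by simp
  next
    case i: (Suc i')
    show ?thesis
    proof (cases j)
      case j0: 0
      have g: "g x = 1" for x using assms(6) j0 pchar_0 by blast
      have "(\<Sum>x<p ^ Suc i'. f x * ?c x 0) = 0"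
      proof (rule pchar_sum_0[OF assms(5)[unfolded i] assms(2)])
        fix x x' :: nat assume "x mod p ^ i' = x' mod p ^ i'"
        then show "?c x 0 = ?c x' 0" using assms(4) unfolding j0 i zr.simps by metis
      qed
      then show ?thesis unfolding eq using j0 i g by simp
    next
      case j: (Suc j')
      let ?r = "\<lambda>x. x mod p ^ i'" and ?t = "\<lambda>y. y mod q ^ j'"
      have grid: "?c x y = ?c x (?t y) + (?c (?r x) y - ?c (?r x) (?t y))" for x y
      proof -
        have "cn p q S i j x y + cn p q S i j (?r x) (?t y) = cn p q S i j x (?t y) + cn p q S i j (?r x) y"
          using assms(4) unfolding i j by (simp only: zr.simps) (metis mod_mod_trivial)
        then have "?c x y + ?c (?r x) (?t y) = ?c x (?t y) + ?c (?r x) y" by (metis of_nat_add)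
        then show ?thesis by (simp add: algebra_simps)
      qed
      have 1: "(\<Sum>y<q ^ j. g y * ?c x (?t y)) = 0" for x
        unfolding j using pchar_sum_0[OF assms(6)[unfolded j] assms(3), of "\<lambda>y. of_nat (cn p q S i (Suc j') x (y mod q ^ j'))"] by simp
      have 2: "(\<Sum>x<p ^ i. f x * (?c (?r x) y - ?c (?r x) (?t y))) = 0" for y
        unfolding i using pchar_sum_0[OF assms(5)[unfolded i] assms(2), of "\<lambda>x. of_nat (cn p q S (Suc i') j (x mod p ^ i') y) - of_nat (cn p q S (Suc i') j (x mod p ^ i') (y mod q ^ j'))"] by simp
      have "(\<Sum>x<p ^ i. \<Sum>y<q ^ j. f x * g y * ?c x y) =
         (\<Sum>x<p ^ i. \<Sum>y<q ^ j. f x * (g y * ?c x (?t y)) + g y * (f x * (?c (?r x) y - ?c (?r x) (?t y))))"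
        by (intro sum.cong refl, subst grid) (simp add: algebra_simps)
      also have "\<dots> = (\<Sum>x<p ^ i. f x * (\<Sum>y<q ^ j. g y * ?c x (?t y))) +
          (\<Sum>y<q ^ j. g y * (\<Sum>x<p ^ i. f x * (?c (?r x) y - ?c (?r x) (?t y))))"
        by (simp add: sum.distrib sum_distrib_left) (rule sum.swap)
      also have "\<dots> = 0" using 1 2 by simp
      finally show ?thesis unfolding eq .
    qed
  qed
qed

section \<open>Coset inequalities\<close>

definition E :: "nat \<Rightarrow> int \<Rightarrow> complex" where
  "E N k = cis (2 * pi * of_int k / of_nat N)"

lemma E_add: "E N (k + l) = E N k * E N l"
  unfolding E_def by (simp add: cis_mult add_divide_distrib ring_distribs)

lemma E_0[simp]: "E N 0 = 1"
  unfolding E_def by simp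

lemma E_minus: "E N (- k) = cnj (E N k)"
  unfolding E_def by (simp add: cis_cnj)

lemma E_norm[simp]: "cmod (E N k) = 1"
  unfolding E_def by simp

lemma E_eq_1_iff: assumes "N > 0" shows "E N k = 1 \<longleftrightarrow> int N dvd k"
proof
  assume "int N dvd k"
  then obtain l where "k = int N * l" by (elim dvdE)
  then have "2 * pi * of_int k / of_nat N = 2 * pi * of_int l" using assms by simp
  then show "E N k = 1" unfolding E_def by (metis cis_multiple_2pi Ints_of_int)
next
  assume "E N k = 1"
  then have "cos (2 * pi * of_int k / of_nat N) = 1" unfolding E_def by (metis cis.sel(1) one_complex.sel(1))
  then obtain l :: int where "2 * pi * of_int k / of_nat N = of_int l * 2 * pi" 
    by (auto simp: cos_one_2pi_int)
  then have "2 * pi * of_int k = 2 * pi * (of_int l * of_nat N)" using assms by (simp add: field_simps)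
  then have "(of_int k :: real) = of_int l * of_nat N" by (simp only: mult_cancel_left) simp
  then have "(of_int k :: real) = of_int (l * int N)" by simp
  then have "k = l * int N" by linarith
  then show "int N dvd k" by simp
qed

lemma E_cong: assumes "N > 0" "int N dvd k - l" shows "E N k = E N l"
proof -
  have "E N k = E N (k - l) * E N l" by (metis E_add diff_add_cancel)
  then show ?thesis using E_eq_1_iff[of N "k - l"] assms by simp
qed

lemma E_cancel: assumes "c > 0" shows "E (c * N) (int c * k) = E N k"
proof -
  have "2 * pi * real_of_int (int c * k) / real (c * N) = (real c * (2 * pi * real_of_int k)) / (real c * real N)"
    by simp
  also have "\<dots> = 2 * pi * real_of_int k / real N" by (rule mult_divide_mult_cancel_left) (use assms in simp)
  finally show ?thesis unfolding E_def by simp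
qed

lemma nat_mod_eq_int_dvd: "(x::nat) mod N = y mod N \<longleftrightarrow> int N dvd int x - int y"
  by (metis mod_eq_dvd_iff of_nat_eq_iff zmod_int)

lemma lv_dvd: "int (p ^ lv p m b b') dvd int b - int b'"
  using lv_mod nat_mod_eq_int_dvd by blast

text \<open>With \<open>b - b' = p ^ v * s\<close>, \<open>v\<close> the level, the character has
  denominator \<open>p ^ (m - v)\<close>, and below the cap its numerator \<open>u * s\<close> is
  prime to \<open>p\<close>; so its order is exactly \<open>p ^ (m - v)\<close>. The unit
  \<open>u\<close> covers all Galois conjugates at once.\<close>

lemma E_chf:
  assumes "prime p" "\<not> int p dvd u"
  shows "pchar p (m - lv p m b b') (\<lambda>x. E (p ^ m) (u * (int b - int b') * int x))"
proof (cases "lv p m b b' = m")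
  case True
  have "int (p ^ m) dvd int b - int b'" using lv_dvd[of p m b b'] True by simp
  then have "int (p ^ m) dvd u * (int b - int b') * int x" for x by simp
  then have "E (p ^ m) (u * (int b - int b') * int x) = 1" for x
    using E_eq_1_iff assms(1) prime_gt_0_nat by simp
  then show ?thesis unfolding pchar_def True by simp
next
  case False
  let ?v = "lv p m b b'"
  have v: "?v < m" using False lv_le[of p m b b'] by simp
  have p0: "p > 0" using assms(1) prime_gt_0_nat by blast
  obtain s where s: "int b - int b' = int (p ^ ?v) * s" using lv_dvd[of p m b b'] by (elim dvdE)
  have "\<not> int p dvd s"
  proof
    assume "int p dvd s"
    then have "int (p ^ Suc ?v) dvd int b - int b'" unfolding s by (simp add: mult.commute mult_dvd_mono)
    then show False using lv_less_neq[OF v] nat_mod_eq_int_dvd by blast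
  qed
  then have us: "\<not> int p dvd u * s" using assms by (simp add: prime_dvd_mult_iff)
  define i where "i = m - ?v"
  have i: "i > 0" "p ^ m = p ^ ?v * p ^ i" using v unfolding i_def by (simp_all flip: power_add)
  have eq: "E (p ^ m) (u * (int b - int b') * int x) = E (p ^ i) (u * s * int x)" for x
  proof -
    have "u * (int b - int b') * int x = int (p ^ ?v) * (u * s * int x)" unfolding s by (simp add: algebra_simps)
    then show ?thesis unfolding i(2) by (metis E_cancel p0 zero_less_power)
  qed
  have per: "E (p ^ i) (u * s * int x) = E (p ^ i) (u * s * int x')" if "x mod p ^ i = x' mod p ^ i" for x x'
  proof (rule E_cong)
    have "int (p ^ i) dvd int x - int x'" using that nat_mod_eq_int_dvd by blast
    then show "int (p ^ i) dvd u * s * int x - u * s * int x'" unfolding right_diff_distrib[symmetric] by (rule dvd_mult)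
  qed (use p0 in simp)
  define w where "w = E p (u * s)"
  have w1: "w \<noteq> 1" using E_eq_1_iff[OF p0] us unfolding w_def by blast
  obtain i' where i': "i = Suc i'" using i(1) by (cases i) auto
  have "E (p ^ i) (u * s * int (p ^ i')) = w"
    using E_cancel[of "p ^ i'" p "u * s"] p0 unfolding i' w_def by (simp add: mult.commute)
  then have sh: "E (p ^ i) (u * s * int (x + p ^ (i - 1))) = w * E (p ^ i) (u * s * int x)" for x
    unfolding i' by (simp add: ring_distribs E_add del: of_nat_power)
  have "\<exists>w. w \<noteq> 1 \<and> (\<forall>x. E (p ^ i) (u * s * int (x + p ^ (i - 1))) = w * E (p ^ i) (u * s * int x))"
    using w1 sh by blast
  then show ?thesis unfolding i_def[symmetric] eq pchar_def if_not_P[OF i(1)[unfolded neq0_conv[symmetric]]] using per by blast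
qed

text \<open>The units \<open>u\<close> and \<open>v\<close> twist the two coordinates independently.
  The size bounds take \<open>u = v = 1\<close>; in the equality case \<open>u\<close> runs over all
  units, which recovers a counting condition.\<close>

definition char_sum :: "nat \<Rightarrow> nat \<Rightarrow> nat \<Rightarrow> nat \<Rightarrow> int \<Rightarrow> int \<Rightarrow> (nat \<times> nat) set \<Rightarrow> int \<Rightarrow> int \<Rightarrow> complex" where
  "char_sum p q m n u v S s t = (\<Sum>b\<in>S. E (p ^ m) (u * (s * int (fst b))) * E (q ^ n) (v * (t * int (snd b))))"

text \<open>Expanding the square gives inner products over \<open>A\<close> of the characters
  attached to pairs from \<open>B'\<close>. They vanish off the diagonal because differences in
  \<open>B\<close> are zeros of \<open>A\<close>; the translation by \<open>(s, t)\<close> only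
  inserts phases.\<close>

lemma parseval:
  assumes sp: "spair p q m n A B" and pr: "prime p" "prime q" and u: "\<not> int p dvd u" and v: "\<not> int q dvd v"
    and B': "B' \<subseteq> B"
  shows "(\<Sum>z\<in>A. (cmod (char_sum p q m n u v B' (int (fst z) - s) (int (snd z) - t)))\<^sup>2) = real (card B' * card A)"
proof -
  let ?g = "\<lambda>z. char_sum p q m n u v B' (int (fst z) - s) (int (snd z) - t)"
  have fB': "finite B'" and fA: "finite A" using spair_finite[OF sp] B' finite_subset by blast+
  define F where "F = (\<lambda>(b :: nat \<times> nat) (b' :: nat \<times> nat) x. E (p ^ m) (u * (int (fst b) - int (fst b')) * x))"
  define G where "G = (\<lambda>(b :: nat \<times> nat) (b' :: nat \<times> nat) y. E (q ^ n) (v * (int (snd b) - int (snd b')) * y))"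
  have FF: "F b b' (x + y) = F b b' x * F b b' y" for b b' x y unfolding F_def by (simp add: ring_distribs E_add)
  have GG: "G b b' (x + y) = G b b' x * G b b' y" for b b' x y unfolding G_def by (simp add: ring_distribs E_add)
  have prodE: "E N (c * (r * k)) * cnj (E N (c * (r * k'))) = E N (c * (k - k') * r)" for N c r k k'
    unfolding E_minus[symmetric] E_add[symmetric] by (simp add: algebra_simps)
  have sq: "?g z * cnj (?g z) = (\<Sum>b\<in>B'. \<Sum>b'\<in>B'. (F b b' (-s) * G b b' (-t)) * (F b b' (int (fst z)) * G b b' (int (snd z))))" for z
  proof -
    have "?g z * cnj (?g z) = (\<Sum>b\<in>B'. \<Sum>b'\<in>B'. F b b' (int (fst z) + - s) * G b b' (int (snd z) + - t))"
      unfolding char_sum_def cnj_sum sum_product complex_cnj_mult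
    proof (intro sum.cong refl)
      fix b b'
      show "E (p ^ m) (u * ((int (fst z) - s) * int (fst b))) * E (q ^ n) (v * ((int (snd z) - t) * int (snd b))) *
           (cnj (E (p ^ m) (u * ((int (fst z) - s) * int (fst b')))) * cnj (E (q ^ n) (v * ((int (snd z) - t) * int (snd b'))))) =
           F b b' (int (fst z) + - s) * G b b' (int (snd z) + - t)"
        unfolding F_def G_def add_uminus_conv_diff prodE[symmetric] by (simp add: algebra_simps)
    qed
    also have "\<dots> = (\<Sum>b\<in>B'. \<Sum>b'\<in>B'. (F b b' (-s) * G b b' (-t)) * (F b b' (int (fst z)) * G b b' (int (snd z))))"
      unfolding FF GG by (simp add: algebra_simps)
    finally show ?thesis .
  qed
  have orth: "(\<Sum>z\<in>A. F b b' (int (fst z)) * G b b' (int (snd z))) = (if b = b' then of_nat (card A) else 0)"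
    if b: "b \<in> B'" "b' \<in> B'" for b b'
  proof (cases "b = b'")
    case True then show ?thesis unfolding F_def G_def by simp
  next
    case False
    have z: "zr p q A (m - lv p m (fst b) (fst b')) (n - lv q n (snd b) (snd b'))"
      using sp False b B' unfolding spair_def by blast
    have "(\<Sum>z\<in>A. F b b' (int (fst z)) * G b b' (int (snd z))) = 0"
      unfolding F_def G_def
      by (rule zr_char[OF fA _ _ z E_chf E_chf]) (use pr u v prime_gt_0_nat in auto)
    then show ?thesis using False by simp
  qed
  have "of_real (\<Sum>z\<in>A. (cmod (?g z))\<^sup>2) = (\<Sum>z\<in>A. ?g z * cnj (?g z))"
    unfolding of_real_sum complex_norm_square ..
  also have "\<dots> = (\<Sum>b\<in>B'. \<Sum>b'\<in>B'. (F b b' (-s) * G b b' (-t)) * (\<Sum>z\<in>A. F b b' (int (fst z)) * G b b' (int (snd z))))"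
    unfolding sq sum_distrib_left by (subst sum.swap, rule sum.cong[OF refl], subst sum.swap, rule refl)
  also have "\<dots> = (\<Sum>b\<in>B'. \<Sum>b'\<in>B'. if b = b' then of_nat (card A) else 0)"
  proof (intro sum.cong refl)
    fix b b' assume "b \<in> B'" "b' \<in> B'"
    then show "F b b' (- s) * G b b' (- t) * (\<Sum>z\<in>A. F b b' (int (fst z)) * G b b' (int (snd z))) = (if b = b' then of_nat (card A) else 0)"
      by (subst orth) (auto simp: F_def G_def)
  qed
  also have "\<dots> = of_nat (card B' * card A)" using fB' by simp
  finally have "complex_of_real (\<Sum>z\<in>A. (cmod (?g z))\<^sup>2) = complex_of_real (real (card B' * card A))" by simp
  then show ?thesis using of_real_eq_iff by blast
qed

text \<open>
  If the characters in \<open>B'\<close> agree on a translate of \<open>A'\<close> up to a factor, the exponential sum over \<open>B'\<close>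
  has maximal modulus on \<open>A'\<close>; comparing with Parseval's identity bounds \<open>card A' * card B'\<close>, and in the
  case of equality the sum vanishes on the rest of \<open>A\<close>.
\<close>

lemma coset_product_bound:
  assumes sp: "spair p q m n A B" and pr: "prime p" "prime q" and u: "\<not> int p dvd u" and v: "\<not> int q dvd v"
    and B': "B' \<subseteq> B" and A': "A' \<subseteq> A" 
    and px: "\<And>z b b'. z \<in> A' \<Longrightarrow> b \<in> B' \<Longrightarrow> b' \<in> B' \<Longrightarrow> int (p ^ m) dvd (int (fst z) - s) * (int (fst b) - int (fst b'))"
    and qx: "\<And>z b b'. z \<in> A' \<Longrightarrow> b \<in> B' \<Longrightarrow> b' \<in> B' \<Longrightarrow> int (q ^ n) dvd (int (snd z) - t) * (int (snd b) - int (snd b'))"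
  shows "card A' * card B' \<le> card A"
    and "card A' * card B' = card A \<Longrightarrow> z \<in> A - A' \<Longrightarrow> char_sum p q m n u v B' (int (fst z) - s) (int (snd z) - t) = 0"
proof -
  let ?g = "\<lambda>z. char_sum p q m n u v B' (int (fst z) - s) (int (snd z) - t)"
  have fB': "finite B'" and fA: "finite A" using spair_finite[OF sp] B' finite_subset by blast+
  have fA': "finite A'" using fA A' finite_subset by blast
  have pq0: "p ^ m > 0" "q ^ n > 0" using pr prime_gt_0_nat by auto
  have g: "cmod (?g z) = real (card B')" if z: "z \<in> A'" for z
  proof (cases "B' = {}")
    case True then show ?thesis by (simp add: char_sum_def)
  next
    case False
    then obtain b0 where b0: "b0 \<in> B'" by blast
    let ?c = "E (p ^ m) (u * ((int (fst z) - s) * int (fst b0))) * E (q ^ n) (v * ((int (snd z) - t) * int (snd b0)))"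
    have "?g z = (\<Sum>b\<in>B'. ?c)"
      unfolding char_sum_def
    proof (rule sum.cong[OF refl])
      fix b assume b: "b \<in> B'"
      have "E (p ^ m) (u * ((int (fst z) - s) * int (fst b))) = E (p ^ m) (u * ((int (fst z) - s) * int (fst b0)))"
        by (rule E_cong[OF pq0(1)]) (unfold right_diff_distrib[symmetric], rule dvd_mult, rule px[OF z b b0])
      moreover have "E (q ^ n) (v * ((int (snd z) - t) * int (snd b))) = E (q ^ n) (v * ((int (snd z) - t) * int (snd b0)))"
        by (rule E_cong[OF pq0(2)]) (unfold right_diff_distrib[symmetric], rule dvd_mult, rule qx[OF z b b0])
      ultimately show "E (p ^ m) (u * ((int (fst z) - s) * int (fst b))) * E (q ^ n) (v * ((int (snd z) - t) * int (snd b))) = ?c" by simp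
    qed
    then have "?g z = of_nat (card B') * ?c" by simp
    then show ?thesis by (simp add: norm_mult)
  qed
  have tot: "(\<Sum>z\<in>A'. (cmod (?g z))\<^sup>2) + (\<Sum>z\<in>A - A'. (cmod (?g z))\<^sup>2) = real (card B' * card A)"
    using parseval[OF sp pr u v B', of s t] sum.subset_diff[OF A' fA, of "\<lambda>z. (cmod (?g z))\<^sup>2"] by linarith
  have 1: "(\<Sum>z\<in>A'. (cmod (?g z))\<^sup>2) = real (card A' * card B' * card B')"
    using g by (simp add: power2_eq_square)
  have 2: "(\<Sum>z\<in>A - A'. (cmod (?g z))\<^sup>2) \<ge> 0" by (rule sum_nonneg) simp
  have le: "real (card A' * card B' * card B') \<le> real (card B' * card A)" using tot 1 2 by simp
  show "card A' * card B' \<le> card A"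
  proof (cases "card B' = 0")
    case False
    have "card A' * card B' * card B' \<le> card B' * card A" using le of_nat_le_iff by blast
    then show ?thesis using False by simp
  qed simp
  assume eq: "card A' * card B' = card A" and z: "z \<in> A - A'"
  have "(\<Sum>z\<in>A - A'. (cmod (?g z))\<^sup>2) = 0" using tot 1 eq by (simp add: mult.commute)
  then have "(cmod (?g z))\<^sup>2 = 0" using z fA by (subst (asm) sum_nonneg_eq_0_iff) auto
  then show "?g z = 0" by simp
qed

lemma dvd_mult_pow: 
  assumes "k \<le> m" "int (p ^ (m - k)) dvd a" "int (p ^ k) dvd b" shows "int (p ^ m) dvd a * b"
proof -
  have "int (p ^ (m - k)) * int (p ^ k) dvd a * b" using assms mult_dvd_mono by blast
  moreover have "int (p ^ (m - k)) * int (p ^ k) = int (p ^ m)" using assms(1) by (simp flip: of_nat_mult power_add)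
  ultimately show ?thesis by simp
qed

lemma prime_not_dvd_1: "prime (p::nat) \<Longrightarrow> \<not> int p dvd 1"
  by (auto dest: prime_gt_1_nat)

text \<open>The two classes are cosets of mutually annihilating subgroups: after translation by
  \<open>(x, y)\<close> all characters from the class of \<open>B\<close> agree on the class of
  \<open>A\<close>.\<close>

lemma coset_class_bound:
  assumes sp: "spair p q m n A B" and pr: "prime p" "prime q" and k: "k \<le> m" "j \<le> n"
    and u: "\<not> int p dvd u" and v: "\<not> int q dvd v"
  shows "cn p q A (m - k) (n - j) x y * cn p q B k j c d \<le> card A"
    and "cn p q A (m - k) (n - j) x y * cn p q B k j c d = card A \<Longrightarrow> z \<in> A \<Longrightarrow> z \<notin> cl p q A (m - k) (n - j) x y \<Longrightarrow>
      char_sum p q m n u v (cl p q B k j c d) (int (fst z) - int x) (int (snd z) - int y) = 0"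
proof -
  have sub: "cl p q B k j c d \<subseteq> B" "cl p q A (m - k) (n - j) x y \<subseteq> A" unfolding cl_def by auto
  have px: "int (p ^ m) dvd (int (fst z) - int x) * (int (fst b) - int (fst b'))"
    if "z \<in> cl p q A (m - k) (n - j) x y" "b \<in> cl p q B k j c d" "b' \<in> cl p q B k j c d" for z b b'
  proof (rule dvd_mult_pow[OF k(1)])
    show "int (p ^ (m - k)) dvd int (fst z) - int x" using that nat_mod_eq_int_dvd unfolding cl_def by blast
    have "fst b mod p ^ k = fst b' mod p ^ k" using that unfolding cl_def by simp
    then show "int (p ^ k) dvd int (fst b) - int (fst b')" using nat_mod_eq_int_dvd by blast
  qed
  have qx: "int (q ^ n) dvd (int (snd z) - int y) * (int (snd b) - int (snd b'))"
    if "z \<in> cl p q A (m - k) (n - j) x y" "b \<in> cl p q B k j c d" "b' \<in> cl p q B k j c d" for z b b'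
  proof (rule dvd_mult_pow[OF k(2)])
    show "int (q ^ (n - j)) dvd int (snd z) - int y" using that nat_mod_eq_int_dvd unfolding cl_def by blast
    have "snd b mod q ^ j = snd b' mod q ^ j" using that unfolding cl_def by simp
    then show "int (q ^ j) dvd int (snd b) - int (snd b')" using nat_mod_eq_int_dvd by blast
  qed
  note C = coset_product_bound[OF sp pr u v sub px qx]
  show "cn p q A (m - k) (n - j) x y * cn p q B k j c d \<le> card A" using C(1) unfolding cn_def .
  assume "cn p q A (m - k) (n - j) x y * cn p q B k j c d = card A" "z \<in> A" "z \<notin> cl p q A (m - k) (n - j) x y"
  then show "char_sum p q m n u v (cl p q B k j c d) (int (fst z) - int x) (int (snd z) - int y) = 0"
    using C(2) unfolding cn_def by blast
qed

lemma coset_card_bound: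
  assumes "spair p q m n A B" "prime p" "prime q" "k \<le> m" "j \<le> n"
  shows "cn p q A (m - k) (n - j) x y * cn p q B k j c d \<le> card A"
  using coset_class_bound(1)[OF assms prime_not_dvd_1 prime_not_dvd_1] assms by blast

lemma coset_card_bound':
  assumes "spair p q m n A B" "prime p" "prime q" "k \<le> m" "j \<le> n"
  shows "cn p q B (m - k) (n - j) x y * cn p q A k j c d \<le> card A"
  using coset_card_bound[OF spair_sym[OF assms(1)] assms(2-)] assms(1) unfolding spair_def by auto

section \<open>Fourier inversion and equality in the coset bound\<close>

lemma sum_E: assumes "N > 0"
  shows "(\<Sum>k<N. E N (int k * r)) = (if int N dvd r then of_nat N else 0)"
proof (cases "int N dvd r")
  case True
  then have "E N (int k * r) = 1" for k using E_eq_1_iff[OF assms] by simp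
  then show ?thesis using True by simp
next
  case False
  have "E N (int ((k + 1) mod N) * r) = E N r * E N (int k * r)" for k
  proof -
    have "int N dvd int ((k + 1) mod N) - int (k + 1)" 
      by (subst nat_mod_eq_int_dvd[symmetric]) simp
    then have "E N (int ((k + 1) mod N) * r) = E N (int (k + 1) * r)"
      by (intro E_cong assms) (simp flip: left_diff_distrib)
    then show ?thesis by (simp add: ring_distribs E_add)
  qed
  then have "(\<Sum>k<N. E N (int k * r)) = E N r * (\<Sum>k<N. E N (int k * r))"
    using sum_shift_mod[OF assms, of "\<lambda>k. E N (int k * r)" 1] by (simp add: sum_distrib_left)
  moreover have "E N r \<noteq> 1" using False E_eq_1_iff[OF assms] by blast
  ultimately show ?thesis using False by simp
qed

lemma fourier_count:
  assumes "N > 0" "finite S"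
  shows "of_nat N * of_nat (card {b \<in> S. int N dvd f b - x}) = (\<Sum>k<N. (\<Sum>b\<in>S. E N (int k * f b)) * E N (- (int k * x)))"
proof -
  have "(\<Sum>k<N. (\<Sum>b\<in>S. E N (int k * f b)) * E N (- (int k * x))) = (\<Sum>k<N. \<Sum>b\<in>S. E N (int k * (f b - x)))"
    by (intro sum.cong refl) (simp add: sum_distrib_right right_diff_distrib flip: E_add)
  also have "\<dots> = (\<Sum>b\<in>S. \<Sum>k<N. E N (int k * (f b - x)))" by (rule sum.swap)
  also have "\<dots> = (\<Sum>b\<in>S. if int N dvd f b - x then of_nat N else 0)"
    by (simp add: sum_E[OF assms(1)])
  also have "\<dots> = of_nat (card {b \<in> S. int N dvd f b - x}) * of_nat N"
    using assms(2) by (simp add: sum.If_cases Int_def)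
  finally show ?thesis by simp
qed

text \<open>By Fourier inversion only frequencies divisible by \<open>p\<close> contribute to the
  counts, and these do not distinguish \<open>x\<close> from \<open>x'\<close>.\<close>

lemma fourier_uniform:
  assumes p: "prime p" and "finite S" and z: "\<And>k. \<not> int p dvd k \<Longrightarrow> (\<Sum>b\<in>S. E (p ^ Suc i) (k * f b)) = 0"
    and x: "int (p ^ i) dvd x - x'"
  shows "card {b \<in> S. int (p ^ Suc i) dvd f b - x} = card {b \<in> S. int (p ^ Suc i) dvd f b - x'}"
proof -
  let ?N = "p ^ Suc i"
  have N0: "?N > 0" using p prime_gt_0_nat by simp
  have "(\<Sum>b\<in>S. E ?N (int k * f b)) * E ?N (- (int k * x)) = (\<Sum>b\<in>S. E ?N (int k * f b)) * E ?N (- (int k * x'))" for k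
  proof (cases "int p dvd int k")
    case True
    then have "int p * int (p ^ i) dvd int k * (x - x')" using x by (rule mult_dvd_mono)
    then have "int ?N dvd - (int k * (x - x'))" by simp
    then have "E ?N (- (int k * x)) = E ?N (- (int k * x'))"
      by (intro E_cong[OF N0]) (simp add: algebra_simps)
    then show ?thesis by simp
  next
    case False then show ?thesis using z by simp
  qed
  then have "of_nat ?N * (of_nat (card {b \<in> S. int ?N dvd f b - x}) :: complex) = of_nat ?N * of_nat (card {b \<in> S. int ?N dvd f b - x'})"
    unfolding fourier_count[OF N0 assms(2)] by (intro sum.cong refl)
  then show ?thesis using N0 by (simp only: mult_cancel_left of_nat_eq_iff of_nat_eq_0_iff) simp
qed

lemma zr_from_char_p:
  assumes p: "prime p" and "finite S" and z: "\<And>k. \<not> int p dvd k \<Longrightarrow> (\<Sum>b\<in>S. E (p ^ Suc i) (k * int (fst b))) = 0"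
  shows "zr p q S (Suc i) 0"
proof -
  have "cn p q S (Suc i) 0 x 0 = cn p q S (Suc i) 0 x' 0" if "x mod p ^ i = x' mod p ^ i" for x x'
  proof -
    have "int (p ^ i) dvd int x - int x'" using that nat_mod_eq_int_dvd by blast
    from fourier_uniform[OF assms this] show ?thesis
      unfolding cn_def cl_def by (simp only: nat_mod_eq_int_dvd) simp
  qed
  then show ?thesis unfolding zr.simps by blast
qed

text \<open>Since \<open>k < i\<close>, the point \<open>z\<close> lies outside the class of
  \<open>A\<close>, so equality makes the exponential sum over the class of \<open>B\<close> vanish
  at \<open>z\<close>. Elements of that class agree modulo \<open>q\<close> while
  \<open>snd z - y\<close> is divisible by \<open>q ^ (n - 1)\<close>: the \<open>q\<close>-factor
  is a constant phase, and the \<open>p\<close>-part vanishes by itself, at a frequency of order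
  \<open>p ^ i\<close>.\<close>

lemma tight_uniform:
  assumes sp: "spair p q m n A B" and pr: "prime p" "prime q" and k: "k \<le> m" "1 \<le> n"
    and tight: "cn p q A (m - k) (n - 1) x y * cn p q B k 1 c d = card A"
    and z: "z \<in> A" "snd z mod q ^ (n - 1) = y mod q ^ (n - 1)"
    and i: "m - lv p m (fst z) x = i" "k < i"
  shows "zr p q (cl p q B k 1 c d) i 0"
proof -
  let ?S = "cl p q B k 1 c d"
  have fS: "finite ?S" using spair_finite[OF sp] cl_fin by blast
  let ?v = "lv p m (fst z) x"
  have v: "?v < m" "m = ?v + i" using i by auto
  obtain i' where i': "i = Suc i'" using i(2) by (cases i) auto
  have "z \<notin> cl p q A (m - k) (n - 1) x y"
  proof
    assume "z \<in> cl p q A (m - k) (n - 1) x y"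
    then have "fst z mod p ^ (m - k) = x mod p ^ (m - k)" unfolding cl_def by auto
    then have "m - k \<le> ?v" by (subst lv_iff) auto
    then show False using i by simp
  qed
  note g0 = coset_class_bound(2)[OF sp pr k _ _ tight z(1) this]
  have p0: "p > 0" using pr prime_gt_0_nat by auto
  have q0: "q ^ n > 0" using pr prime_gt_0_nat by auto
  have dq: "int (q ^ (n - 1)) dvd int (snd z) - int y" using z(2) nat_mod_eq_int_dvd by blast
  obtain s where s: "int (fst z) - int x = int (p ^ ?v) * s" using lv_dvd[of p m "fst z" x] by (elim dvdE)
  have ps: "\<not> int p dvd s"
  proof
    assume "int p dvd s"
    then have "int (p ^ Suc ?v) dvd int (fst z) - int x" unfolding s by (simp add: mult.commute mult_dvd_mono)
    then show False using lv_less_neq[OF v(1)] nat_mod_eq_int_dvd by blast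
  qed
  have E2: "E (q ^ n) (1 * ((int (snd z) - int y) * int (snd b))) = E (q ^ n) ((int (snd z) - int y) * int d)" if "b \<in> ?S" for b
  proof (rule E_cong[OF q0])
    have "int (q ^ 1) dvd int (snd b) - int d" using that nat_mod_eq_int_dvd unfolding cl_def by blast
    from dvd_mult_pow[OF k(2) dq this]
    show "int (q ^ n) dvd 1 * ((int (snd z) - int y) * int (snd b)) - (int (snd z) - int y) * int d"
      by (simp only: mult_1 right_diff_distrib)
  qed
  have E1: "E (p ^ m) (u * ((int (fst z) - int x) * w)) = E (p ^ i) (u * s * w)" for u w
  proof -
    have "u * ((int (fst z) - int x) * w) = int (p ^ ?v) * (u * s * w)" unfolding s by (simp add: algebra_simps)
    moreover have "p ^ m = p ^ ?v * p ^ i" using v(2) by (metis power_add)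
    ultimately show ?thesis by (metis E_cancel p0 zero_less_power)
  qed
  have zero: "(\<Sum>b\<in>?S. E (p ^ i) (u * s * int (fst b))) = 0" if "\<not> int p dvd u" for u
  proof -
    have "0 = char_sum p q m n u 1 ?S (int (fst z) - int x) (int (snd z) - int y)"
      using g0[OF that prime_not_dvd_1[OF pr(2)]] by simp
    also have "\<dots> = (\<Sum>b\<in>?S. E (p ^ i) (u * s * int (fst b)) * E (q ^ n) ((int (snd z) - int y) * int d))"
      unfolding char_sum_def by (rule sum.cong[OF refl]) (simp only: E1 E2)
    also have "\<dots> = (\<Sum>b\<in>?S. E (p ^ i) (u * s * int (fst b))) * E (q ^ n) ((int (snd z) - int y) * int d)"
      by (simp add: sum_distrib_right)
    finally have "(\<Sum>b\<in>?S. E (p ^ i) (u * s * int (fst b))) * E (q ^ n) ((int (snd z) - int y) * int d) = 0" by (rule sym)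
    moreover have "E (q ^ n) ((int (snd z) - int y) * int d) \<noteq> 0" by (metis E_norm norm_zero zero_neq_one)
    ultimately show ?thesis by (metis mult_eq_0_iff)
  qed
  show ?thesis unfolding i'
  proof (rule zr_from_char_p[OF pr(1) fS])
    fix w assume w: "\<not> int p dvd w"
    \<comment> \<open>The frequency carries the fixed unit \<open>s\<close>. With \<open>r\<close>
      its inverse modulo \<open>p ^ i\<close>, the choice \<open>u = w * r\<close> produces the
      arbitrary unit \<open>w\<close>.\<close>
    have "coprime s (int p)" using ps pr(1) by (metis prime_imp_coprime coprime_commute prime_nat_int_transfer)
    then have "coprime s (int (p ^ i))" by simp
    then obtain r where r: "[s * r = 1] (mod int (p ^ i))" using cong_solve_coprime_int by blast
    have dv: "int (p ^ i) dvd s * r - 1" using r by (simp add: cong_iff_dvd_diff)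
    have "\<not> int p dvd w * r"
    proof
      assume "int p dvd w * r"
      then have "int p dvd r" using w pr(1) prime_dvd_mult_iff[of "int p"] by simp
      moreover have "int p dvd s * r - 1" using dv i' by (metis dvd_trans power_Suc of_nat_mult dvd_triv_left)
      ultimately have "int p dvd 1" using dvd_diff[of "int p" "s * r" "s * r - 1"] by (simp only: dvd_mult diff_diff_eq2 add_diff_cancel_left') 
      then show False using prime_not_dvd_1[OF pr(1)] by blast
    qed
    from zero[OF this] have z0: "(\<Sum>b\<in>?S. E (p ^ i) (w * r * s * int (fst b))) = 0" .
    have "E (p ^ i) (w * r * s * int (fst b)) = E (p ^ i) (w * int (fst b))" for b :: "nat \<times> nat"
    proof (rule E_cong)
      have "w * r * s * int (fst b) - w * int (fst b) = (s * r - 1) * (w * int (fst b))" by (simp add: algebra_simps)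
      then show "int (p ^ i) dvd w * r * s * int (fst b) - w * int (fst b)" using dv by (metis dvd_mult2)
    qed (use p0 in simp)
    then show "(\<Sum>b\<in>?S. E (p ^ Suc i') (w * int (fst b))) = 0" using z0 i' by simp
  qed
qed

section \<open>Levels and the size of a set\<close>

lemma mod_Suc_pow: "(x::nat) mod p ^ Suc i = x mod p ^ i + p ^ i * (x div p ^ i mod p)"
  by (metis mod_mult2_eq mult.commute power_Suc add.commute)

lemma cn_split_p:
  assumes "finite S" "p > 0"
  shows "cn p q S i j x y = (\<Sum>t<p. cn p q S (Suc i) j (x mod p ^ i + p ^ i * t) y)"
proof -
  have "cl p q S i j x y = (\<Union>t<p. cl p q S (Suc i) j (x mod p ^ i + p ^ i * t) y)" (is "?L = ?R")
  proof (intro equalityI subsetI)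
    fix z assume z: "z \<in> ?L"
    let ?t = "fst z div p ^ i mod p"
    have "fst z mod p ^ Suc i = (x mod p ^ i + p ^ i * ?t) mod p ^ Suc i"
      using z mod_Suc_pow[of "fst z" p i] unfolding cl_def by (metis (mono_tags, lifting) mem_Collect_eq mod_mod_trivial)
    then show "z \<in> ?R" using z assms(2) unfolding cl_def by (auto intro!: bexI[of _ ?t])
  next
    fix z assume "z \<in> ?R"
    then obtain t where "z \<in> S" "fst z mod p ^ Suc i = (x mod p ^ i + p ^ i * t) mod p ^ Suc i" "snd z mod q ^ j = y mod q ^ j"
      unfolding cl_def by auto
    moreover from this(2) have "fst z mod p ^ i = (x mod p ^ i + p ^ i * t) mod p ^ i" by (rule mod_pow_mono) simp
    ultimately show "z \<in> ?L" unfolding cl_def by simp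
  qed
  moreover have "card ?R = (\<Sum>t<p. card (cl p q S (Suc i) j (x mod p ^ i + p ^ i * t) y))"
  proof (rule card_UN_disjoint)
    show "\<forall>t\<in>{..<p}. \<forall>t'\<in>{..<p}. t \<noteq> t' \<longrightarrow> cl p q S (Suc i) j (x mod p ^ i + p ^ i * t) y \<inter> cl p q S (Suc i) j (x mod p ^ i + p ^ i * t') y = {}"
    proof (intro ballI impI)
      fix t t' assume t: "t \<in> {..<p}" "t' \<in> {..<p}" "t \<noteq> t'"
      have lt: "x mod p ^ i + p ^ i * s < p ^ Suc i" if "s < p" for s
      proof -
        have "x mod p ^ i + p ^ i * s < p ^ i + p ^ i * s" using assms(2) by simp
        also have "\<dots> = p ^ i * Suc s" by simp
        also have "\<dots> \<le> p ^ i * p" using that by (intro mult_le_mono2) simp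
        finally show ?thesis by (simp add: mult.commute)
      qed
      have "(x mod p ^ i + p ^ i * t) mod p ^ Suc i \<noteq> (x mod p ^ i + p ^ i * t') mod p ^ Suc i"
        using lt[of t] lt[of t'] t assms(2) by (simp del: power_Suc)
      then show "cl p q S (Suc i) j (x mod p ^ i + p ^ i * t) y \<inter> cl p q S (Suc i) j (x mod p ^ i + p ^ i * t') y = {}"
        unfolding cl_def by auto
    qed
  qed (use assms cl_fin in auto)
  ultimately show ?thesis unfolding cn_def by simp
qed

lemma cn_split_q:
  assumes "finite S" "q > 0"
  shows "cn p q S i j x y = (\<Sum>t<q. cn p q S i (Suc j) x (y mod q ^ j + q ^ j * t))"
  using cn_split_p[of "prod.swap ` S" q p j i y x] assms by (simp add: cn_swap)

text \<open>Going up the digit tree from depth \<open>m\<close>, a uniform level gives the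
  \<open>p\<close> children of a node equal size and contributes a factor \<open>p\<close>; at any
  other level a common divisor of the children is inherited.\<close>

lemma pow_dvd_card:
  assumes "finite S" "p > 0" "L \<subseteq> {..<m}" "\<And>i. i \<in> L \<Longrightarrow> zr p q S (Suc i) 0"
  shows "p ^ card L dvd card S"
proof -
  have "k \<le> m \<Longrightarrow> p ^ card (L \<inter> {k..<m}) dvd cn p q S k 0 x 0" for k x
  proof (induction "m - k" arbitrary: k x)
    case 0
    then have "L \<inter> {k..<m} = {}" by auto
    then show ?case by simp
  next
    case (Suc r)
    then have k: "k < m" "r = m - Suc k" "Suc k \<le> m" by auto
    have IH: "p ^ card (L \<inter> {Suc k..<m}) dvd cn p q S (Suc k) 0 x' 0" for x' using Suc.hyps(1)[OF k(2,3)] .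
    have fin: "finite (L \<inter> {Suc k..<m})" by simp
    show ?case
    proof (cases "k \<in> L")
      case True
      have "L \<inter> {k..<m} = insert k (L \<inter> {Suc k..<m})" using True k by auto
      then have c: "card (L \<inter> {k..<m}) = Suc (card (L \<inter> {Suc k..<m}))" by simp
      have "cn p q S (Suc k) 0 (x mod p ^ k + p ^ k * t) 0 = cn p q S (Suc k) 0 x 0" for t
      proof -
        have "(x mod p ^ k + p ^ k * t) mod p ^ k = x mod p ^ k" by simp
        then show ?thesis using assms(4)[OF True] unfolding zr.simps by blast
      qed
      then have "cn p q S k 0 x 0 = p * cn p q S (Suc k) 0 x 0"
        unfolding cn_split_p[OF assms(1,2), of q k 0 x 0] by simp
      then show ?thesis unfolding c using IH by simp
    next
      case False
      then have "L \<inter> {k..<m} = L \<inter> {Suc k..<m}" using Suc_le_eq le_eq_less_or_eq by auto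
      then show ?thesis unfolding cn_split_p[OF assms(1,2), of q k 0 x 0] using IH by (simp add: dvd_sum)
    qed
  qed
  from this[of 0 0] have "p ^ card (L \<inter> {0..<m}) dvd cn p q S 0 0 0 0" by simp
  moreover have "L \<inter> {0..<m} = L" using assms(3) by auto
  moreover have "cn p q S 0 0 0 0 = card S" unfolding cn_def cl_def by simp
  ultimately show ?thesis by simp
qed

text \<open>Distinct elements first differ at a level in \<open>L\<close>, so they are told apart by
  their digits at the levels in \<open>L\<close>.\<close>

lemma card_le_pow_levels:
  assumes p: "p > 0" and L: "finite L" and S: "\<And>x x'. x \<in> S \<Longrightarrow> x' \<in> S \<Longrightarrow> x \<noteq> x' \<Longrightarrow> lv p m x x' < m \<and> lv p m x x' \<in> L"
  shows "card S \<le> p ^ card L"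
proof -
  let ?d = "\<lambda>x. restrict (\<lambda>v. x div p ^ v mod p) L"
  have "inj_on ?d S"
  proof (rule inj_onI, rule ccontr)
    fix x x' assume x: "x \<in> S" "x' \<in> S" "?d x = ?d x'" "x \<noteq> x'"
    let ?v = "lv p m x x'"
    have v: "?v < m" "?v \<in> L" using S x by auto
    have "x div p ^ ?v mod p = x' div p ^ ?v mod p" using fun_cong[OF x(3), of ?v] v by simp
    then have "x mod p ^ Suc ?v = x' mod p ^ Suc ?v" unfolding mod_Suc_pow using lv_mod[of x p m x'] by simp
    then show False using lv_less_neq[OF v(1)] by blast
  qed
  then have "card S = card (?d ` S)" by (simp add: card_image)
  moreover have "?d ` S \<subseteq> PiE L (\<lambda>_. {..<p})" using p by auto
  moreover have "card (PiE L (\<lambda>_. {..<p})) = p ^ card L" using L by (simp add: card_PiE)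
  moreover have "finite (PiE L (\<lambda>_. {..<p}))" using L by (simp add: finite_PiE)
  ultimately show ?thesis by (metis (no_types, lifting) card_mono)
qed

section \<open>Sets that tile by prescribing digits\<close>

definition dg :: "nat \<Rightarrow> nat \<Rightarrow> nat \<Rightarrow> nat" where "dg p v x = x div p ^ v mod p"

lemma mod_eq_dg: "x mod p ^ i = x' mod p ^ i \<longleftrightarrow> (\<forall>v<i. dg p v x = dg p v x')"
proof (induction i)
  case (Suc i)
  show ?case
  proof
    assume e: "x mod p ^ Suc i = x' mod p ^ Suc i"
    then have e': "x mod p ^ i = x' mod p ^ i" by (rule mod_pow_mono) simp
    have "p ^ i * dg p i x = p ^ i * dg p i x'" using e e' unfolding mod_Suc_pow dg_def by simp
    then have "dg p i x = dg p i x'" by (cases "p = 0"; cases i) (auto simp: dg_def)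
    then show "\<forall>v<Suc i. dg p v x = dg p v x'" using Suc e' by (auto simp: less_Suc_eq)
  next
    assume "\<forall>v<Suc i. dg p v x = dg p v x'"
    then show "x mod p ^ Suc i = x' mod p ^ Suc i" using Suc unfolding mod_Suc_pow dg_def by simp
  qed
qed simp

lemma dg_lt: "p > 0 \<Longrightarrow> dg p v x < p" unfolding dg_def by simp

lemma dg_add: 
  assumes "p > 0" 
  shows "dg p 0 (r + p * t) = r mod p" "r < p \<Longrightarrow> dg p (Suc v) (r + p * t) = dg p v t"
  using assms unfolding dg_def by (simp_all add: div_mult2_eq)

lemma lv_ge_iff: "v \<le> m \<Longrightarrow> v \<le> lv p m x x' \<longleftrightarrow> (\<forall>u<v. dg p u x = dg p u x')"
  using lv_iff mod_eq_dg by metis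

lemma lv_step:
  assumes "p > 0" "r < p" "r' < p"
  shows "lv p (Suc m) (r + p * t) (r' + p * t') = (if r = r' then Suc (lv p m t t') else 0)"
proof (cases "r = r'")
  case True
  have "v \<le> lv p (Suc m) (r + p * t) (r' + p * t') \<longleftrightarrow> v \<le> Suc (lv p m t t')" if "v \<le> Suc m" for v
  proof (cases v)
    case (Suc w)
    have "v \<le> lv p (Suc m) (r + p * t) (r' + p * t') \<longleftrightarrow> (\<forall>u<Suc w. dg p u (r + p * t) = dg p u (r' + p * t'))"
      using lv_ge_iff[OF that] Suc by simp
    also have "\<dots> \<longleftrightarrow> (\<forall>u<w. dg p u t = dg p u t')"
      using True assms dg_add by (auto simp: All_less_Suc2)
    also have "\<dots> \<longleftrightarrow> w \<le> lv p m t t'" using lv_ge_iff[of w m] Suc that by simp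
    finally show ?thesis using Suc by simp
  qed simp
  then show ?thesis using True lv_le[of p "Suc m" "r + p * t" "r' + p * t'"] lv_le[of p m t t']
    by (metis Suc_le_mono le_antisym order_refl)
next
  case False
  have "\<not> 1 \<le> lv p (Suc m) (r + p * t) (r' + p * t')"
    using lv_ge_iff[of 1 "Suc m" p "r + p * t" "r' + p * t'"] False assms dg_add(1)[OF assms(1)] by simp
  then show ?thesis using False by simp
qed

text \<open>A geometric sum whose ratio has order \<open>p ^ (v + 2)\<close>; the
  \<open>p\<close>-th power of the ratio is not 1.\<close>

lemma geometric_char_sum:
  assumes p: "prime p" and k: "\<not> int p dvd k"
  shows "(\<Sum>r<p. E (p ^ Suc (Suc v)) (k * int r)) \<noteq> 0"
proof
  assume z: "(\<Sum>r<p. E (p ^ Suc (Suc v)) (k * int r)) = 0"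
  have p0: "p > 0" using p prime_gt_0_nat by auto
  define w where "w = E (p ^ Suc (Suc v)) k"
  have pw: "E (p ^ Suc (Suc v)) (k * int r) = w ^ r" for r
    by (induction r) (simp_all add: w_def ring_distribs E_add)
  have "(1 - w) * (\<Sum>r<p. w ^ r) = 1 - w ^ p" by (simp add: one_diff_power_eq)
  then have "w ^ p = 1" using z unfolding pw by simp
  then have "E (p ^ Suc (Suc v)) (k * int p) = 1" using pw by simp
  then have "int (p ^ Suc (Suc v)) dvd k * int p" by (subst (asm) E_eq_1_iff) (use p0 in auto)
  then have "int p * int (p ^ Suc v) dvd int p * k" by (simp add: mult.commute)
  then have "int (p ^ Suc v) dvd k" using p0 by (simp only: dvd_mult_cancel_left) simp
  then have "int p dvd k" by (metis dvd_mult_left of_nat_mult power_Suc)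
  then show False using k by blast
qed

text \<open>The witness consists of the numbers whose digits at the levels in \<open>K\<close> are
  zero, built from the lowest digit upwards. The nonvanishing of its character sums allows to divide
  by them when the zeros of a complementary set are computed in \<open>ext_zr\<close>.\<close>

lemma tiling_complement:
  assumes p: "prime p"
  shows "K \<subseteq> {..<m} \<Longrightarrow> \<exists>T. T \<subseteq> {..<p ^ m} \<and> card T = p ^ (m - card K) \<and> (\<forall>t\<in>T. \<forall>t'\<in>T. lv p m t t' \<notin> K) \<and>
     (\<forall>v\<in>K. \<forall>k. \<not> int p dvd k \<longrightarrow> (\<Sum>t\<in>T. E (p ^ Suc v) (k * int t)) \<noteq> 0)"
proof (induction m arbitrary: K)
  case 0
  then show ?case by (intro exI[of _ "{0}"]) auto
next
  case (Suc m)
  have p0: "p > 0" using p prime_gt_0_nat by auto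
  define K' where "K' = {v. Suc v \<in> K}"
  have K': "K' \<subseteq> {..<m}" using Suc.prems unfolding K'_def by auto
  have fK: "finite K" "finite K'" using Suc.prems K' finite_subset by blast+
  obtain T where T: "T \<subseteq> {..<p ^ m}" "card T = p ^ (m - card K')" "\<And>t t'. t \<in> T \<Longrightarrow> t' \<in> T \<Longrightarrow> lv p m t t' \<notin> K'"
     "\<And>v k. v \<in> K' \<Longrightarrow> \<not> int p dvd k \<Longrightarrow> (\<Sum>t\<in>T. E (p ^ Suc v) (k * int t)) \<noteq> 0"
    using Suc.IH[OF K'] by blast
  have fT: "finite T" using T(1) finite_subset by blast
  define R where "R = (if 0 \<in> K then {0} else {..<p})"
  have R: "R \<subseteq> {..<p}" "finite R" unfolding R_def using p0 by auto
  define f where "f = (\<lambda>(r, t). r + p * t)"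
  have inj: "inj_on f (R \<times> T)"
  proof (rule inj_onI)
    fix a b assume ab: "a \<in> R \<times> T" "b \<in> R \<times> T" "f a = f b"
    then have lt: "fst a < p" "fst b < p" using R by auto
    have e: "fst a + p * snd a = fst b + p * snd b" using ab(3) by (simp add: f_def case_prod_beta)
    have "(fst a + p * snd a) mod p = (fst b + p * snd b) mod p" using e by simp
    then have "fst a = fst b" using lt by simp
    then show "a = b" using e p0 by (simp add: prod_eq_iff)
  qed
  define T' where "T' = f ` (R \<times> T)"
  have K_eq: "K = (if 0 \<in> K then {0} else {}) \<union> Suc ` K'"
    unfolding K'_def by (auto simp: image_iff) (metis not0_implies_Suc)+
  have cK: "card K = (if 0 \<in> K then 1 else 0) + card K'"
  proof -
    have "card (Suc ` K') = card K'" by (simp add: card_image)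
    moreover have "card ((if 0 \<in> K then {0} else {}) \<union> Suc ` K') = card (if 0 \<in> K then {0::nat} else {}) + card (Suc ` K')"
      by (rule card_Un_disjoint) (use fK in auto)
    ultimately show ?thesis using K_eq by (auto split: if_splits)
  qed
  have cK': "card K' \<le> m" using card_mono[OF _ K'] by simp
  show ?case
  proof (intro exI[of _ T'] conjI ballI allI impI)
    show "T' \<subseteq> {..<p ^ Suc m}"
    proof
      fix x assume "x \<in> T'"
      then obtain r t where rt: "r < p" "t \<in> T" "x = r + p * t" unfolding T'_def f_def using R by auto
      have "r + p * t < p * Suc t" using rt(1) by simp
      also have "\<dots> \<le> p * p ^ m" using rt(2) T(1) by (intro mult_le_mono2) auto
      finally show "x \<in> {..<p ^ Suc m}" using rt(3) by simp
    qed
    have "card T' = card R * card T" unfolding T'_def using inj by (simp add: card_image card_cartesian_product)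
    also have "\<dots> = p ^ (Suc m - card K)" unfolding T(2) R_def cK using cK' by (auto simp: Suc_diff_le)
    finally show "card T' = p ^ (Suc m - card K)" .
  next
    fix x x' assume "x \<in> T'" "x' \<in> T'"
    then obtain r t r' t' where rt: "r \<in> R" "r' \<in> R" "t \<in> T" "t' \<in> T" "x = r + p * t" "x' = r' + p * t'" 
      unfolding T'_def f_def by auto
    have "r < p" "r' < p" using rt R by auto
    then have l: "lv p (Suc m) x x' = (if r = r' then Suc (lv p m t t') else 0)" using lv_step p0 rt by simp
    show "lv p (Suc m) x x' \<notin> K"
    proof (cases "r = r'")
      case True then show ?thesis using l T(3)[OF rt(3,4)] unfolding K'_def by simp
    next
      case False
      then have "0 \<notin> K" using rt(1,2) unfolding R_def by (auto split: if_splits)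
      then show ?thesis using l False by simp
    qed
  next
    fix v k assume v: "v \<in> K" and k: "\<not> int p dvd k"
    have s: "(\<Sum>x\<in>T'. E (p ^ Suc v) (k * int x)) = (\<Sum>r\<in>R. E (p ^ Suc v) (k * int r)) * (\<Sum>t\<in>T. E (p ^ Suc v) (k * int (p * t)))"
    proof -
      have "(\<Sum>x\<in>T'. E (p ^ Suc v) (k * int x)) = (\<Sum>w\<in>R \<times> T. E (p ^ Suc v) (k * int (f w)))"
        unfolding T'_def by (simp add: sum.reindex[OF inj])
      also have "\<dots> = (\<Sum>(r, t)\<in>R \<times> T. E (p ^ Suc v) (k * int r) * E (p ^ Suc v) (k * int (p * t)))"
        by (intro sum.cong refl) (simp only: f_def case_prod_beta of_nat_add ring_distribs E_add)
      finally show ?thesis by (simp only: sum_product sum.cartesian_product)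
    qed
    \<comment> \<open>For \<open>v = 0\<close> the character sees only the lowest digit, and
      \<open>R\<close> is a single point. For larger \<open>v\<close> the higher digits give the sum
      of the induction hypothesis, and the lowest digit gives 1 or a geometric sum with ratio of
      order at least \<open>p^2\<close>.\<close>
    show "(\<Sum>x\<in>T'. E (p ^ Suc v) (k * int x)) \<noteq> 0"
    proof (cases v)
      case 0
      have "E (p ^ Suc v) (k * int (p * t)) = 1" for t using 0 E_eq_1_iff[OF p0] by simp
      moreover have "R = {0}" using v 0 unfolding R_def by simp
      ultimately have "(\<Sum>x\<in>T'. E (p ^ Suc v) (k * int x)) = of_nat (card T)" unfolding s by simp
      then show ?thesis using T(2) p0 by simp
    next
      case (Suc v')
      have "E (p ^ Suc v) (k * int (p * t)) = E (p ^ Suc v') (k * int t)" for t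
        using E_cancel[OF p0, of "p ^ Suc v'" "k * int t"] Suc by (simp add: mult_ac)
      then have 1: "(\<Sum>t\<in>T. E (p ^ Suc v) (k * int (p * t))) \<noteq> 0"
        using T(4)[of v' k] v k Suc unfolding K'_def by simp
      have 2: "(\<Sum>r\<in>R. E (p ^ Suc v) (k * int r)) \<noteq> 0"
        using geometric_char_sum[OF p k, of v'] Suc unfolding R_def by (cases "0 \<in> K") simp_all
      show ?thesis unfolding s using 1 2 by simp
    qed
  qed
qed

text \<open>
  Such a set has the largest size that its differences allow, so it tiles with the set of all
  \<open>(t, u)\<close> whose digits at the levels in \<open>K\<close> and \<open>L\<close> are zero.
\<close>

definition ext :: "nat \<Rightarrow> nat \<Rightarrow> nat \<Rightarrow> nat \<Rightarrow> (nat \<times> nat) set \<Rightarrow> nat set \<Rightarrow> nat set \<Rightarrow> bool" where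
  "ext p q m n S K L \<longleftrightarrow> K \<subseteq> {..<m} \<and> L \<subseteq> {..<n} \<and> S \<subseteq> {..<p ^ m} \<times> {..<q ^ n} \<and> card S = p ^ card K * q ^ card L \<and>
     (\<forall>z\<in>S. \<forall>z'\<in>S. z \<noteq> z' \<longrightarrow> lv p m (fst z) (fst z') \<in> K \<or> lv q n (snd z) (snd z') \<in> L)"

text \<open>Levels depend only on differences, and equality of the two sums makes
  \<open>x - x'\<close> the negative of \<open>s - s'\<close>.\<close>

lemma lv_add_eq:
  assumes "p > 0" "(x + s) mod p ^ m = (x' + s') mod p ^ m"
  shows "lv p m x x' = lv p m s s'"
proof -
  have "int (p ^ m) dvd int (x + s) - int (x' + s')" using assms(2) nat_mod_eq_int_dvd by blast
  have "v \<le> lv p m x x' \<longleftrightarrow> v \<le> lv p m s s'" if "v \<le> m" for v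
  proof -
    have "(x + s) mod p ^ v = (x' + s') mod p ^ v" using assms(2) that by (rule mod_pow_mono)
    then have d: "int (p ^ v) dvd (int x - int x') + (int s - int s')" unfolding nat_mod_eq_int_dvd
      by (simp add: algebra_simps)
    have "int (p ^ v) dvd int x - int x' \<longleftrightarrow> int (p ^ v) dvd int s - int s'"
      using d dvd_add_right_iff dvd_add_left_iff by blast
    then show ?thesis using lv_iff[OF that] nat_mod_eq_int_dvd by metis
  qed
  then show ?thesis using lv_le[of p m] by (metis le_antisym order_refl)
qed

text \<open>If two sums coincide, the differences in \<open>S\<close> and in
  \<open>T \<times> U\<close> have the same pair of levels. Distinct elements of \<open>S\<close>
  have a level in \<open>K\<close> or \<open>L\<close>, which \<open>T\<close> and \<open>U\<close>
  avoid; surjectivity is then a matter of counting.\<close>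

lemma ext_tile:
  assumes e: "ext p q m n S K L" and pq: "p > 0" "q > 0"
    and T: "T \<subseteq> {..<p ^ m}" "card T = p ^ (m - card K)" "\<And>t t'. t \<in> T \<Longrightarrow> t' \<in> T \<Longrightarrow> lv p m t t' \<notin> K"
    and U: "U \<subseteq> {..<q ^ n}" "card U = q ^ (n - card L)" "\<And>t t'. t \<in> U \<Longrightarrow> t' \<in> U \<Longrightarrow> lv q n t t' \<notin> L"
  shows "bij_betw (\<lambda>(z, t). ((fst z + fst t) mod p ^ m, (snd z + snd t) mod q ^ n)) (S \<times> (T \<times> U)) ({..<p ^ m} \<times> {..<q ^ n})"
    (is "bij_betw ?f ?D ?G")
proof -
  have S: "S \<subseteq> ?G" "card S = p ^ card K * q ^ card L" "K \<subseteq> {..<m}" "L \<subseteq> {..<n}" using e unfolding ext_def by auto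
  have inj: "inj_on ?f ?D"
  proof (rule inj_onI)
    fix a b assume ab: "a \<in> ?D" "b \<in> ?D" "?f a = ?f b"
    obtain z t z' t' where zt: "a = (z, t)" "b = (z', t')" by (metis surj_pair)
    have eqs: "(fst z + fst t) mod p ^ m = (fst z' + fst t') mod p ^ m" "(snd z + snd t) mod q ^ n = (snd z' + snd t') mod q ^ n"
      using ab(3) zt by auto
    note l = lv_add_eq[OF pq(1) eqs(1)] lv_add_eq[OF pq(2) eqs(2)]
    have mem: "z \<in> S" "z' \<in> S" "fst t \<in> T" "fst t' \<in> T" "snd t \<in> U" "snd t' \<in> U" using ab zt by auto
    have "z = z'"
    proof (rule ccontr)
      assume "z \<noteq> z'"
      then have "lv p m (fst z) (fst z') \<in> K \<or> lv q n (snd z) (snd z') \<in> L" using e mem unfolding ext_def by blast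
      then show False using l T(3) U(3) mem by metis
    qed
    moreover from this have "lv p m (fst t) (fst t') = m" "lv q n (snd t) (snd t') = n" using l by simp_all
    then have "t = t'" using lv_eq_iff T(1) U(1) mem by (metis lessThan_iff prod_eq_iff subset_iff)
    ultimately show "a = b" using zt by simp
  qed
  have cK: "card K \<le> m" "card L \<le> n" using card_mono[OF _ S(3)] card_mono[OF _ S(4)] by auto
  have "card (?f ` ?D) = card ?D" by (rule card_image[OF inj])
  also have "\<dots> = (p ^ card K * q ^ card L) * (p ^ (m - card K) * q ^ (n - card L))"
    using S(2) T(2) U(2) by (simp add: card_cartesian_product)
  also have "\<dots> = p ^ (card K + (m - card K)) * q ^ (card L + (n - card L))"
    unfolding power_add by (simp add: mult_ac)
  also have "\<dots> = card ?G" using cK by (simp add: card_cartesian_product)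
  finally have "card (?f ` ?D) = card ?G" .
  moreover have "?f ` ?D \<subseteq> ?G" using pq by auto
  ultimately have "?f ` ?D = ?G" by (intro card_subset_eq) auto
  then show ?thesis using inj by (simp add: bij_betw_def)
qed

text \<open>The box is the direct sum of \<open>S\<close> and \<open>T \<times> U\<close>, and a
  character of order \<open>p ^ (v + 1)\<close> sums to zero over the box. The sum factors, and the
  factor of \<open>T\<close> is nonzero by construction.\<close>

lemma ext_zr:
  assumes e: "ext p q m n S K L" and pr: "prime p" "prime q" and v: "v \<in> K"
  shows "zr p q S (Suc v) 0"
proof -
  have pq: "p > 0" "q > 0" using pr prime_gt_0_nat by auto
  have S: "S \<subseteq> {..<p ^ m} \<times> {..<q ^ n}" "K \<subseteq> {..<m}" "L \<subseteq> {..<n}" using e unfolding ext_def by auto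
  have fS: "finite S" using S(1) finite_subset by blast
  obtain T where T: "T \<subseteq> {..<p ^ m}" "card T = p ^ (m - card K)" "\<And>t t'. t \<in> T \<Longrightarrow> t' \<in> T \<Longrightarrow> lv p m t t' \<notin> K"
     "\<And>v k. v \<in> K \<Longrightarrow> \<not> int p dvd k \<Longrightarrow> (\<Sum>t\<in>T. E (p ^ Suc v) (k * int t)) \<noteq> 0"
    using tiling_complement[OF pr(1) S(2)] by blast
  obtain U where U: "U \<subseteq> {..<q ^ n}" "card U = q ^ (n - card L)" "\<And>t t'. t \<in> U \<Longrightarrow> t' \<in> U \<Longrightarrow> lv q n t t' \<notin> L"
    using tiling_complement[OF pr(2) S(3)] by blast
  note bij = ext_tile[OF e pq T(1-3) U]
  have vm: "Suc v \<le> m" using v S(2) by auto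
  show ?thesis
  proof (rule zr_from_char_p[OF pr(1) fS])
    fix k assume k: "\<not> int p dvd k"
    let ?h = "\<lambda>x. E (p ^ Suc v) (k * int x)"
    have pv: "p ^ Suc v > 0" using pq by simp
    have hmod: "?h (x mod p ^ m) = ?h x" for x
    proof (rule E_cong[OF pv])
      have "x mod p ^ m mod p ^ Suc v = x mod p ^ Suc v" using vm by (metis le_imp_power_dvd mod_mod_cancel)
      then have "int (p ^ Suc v) dvd int (x mod p ^ m) - int x" using nat_mod_eq_int_dvd by blast
      then show "int (p ^ Suc v) dvd k * int (x mod p ^ m) - k * int x" 
        unfolding right_diff_distrib[symmetric] by (rule dvd_mult)
    qed
    have z1: "(\<Sum>x<p ^ m. ?h x) = 0"
    proof -
      have "(\<Sum>x<p ^ m. ?h x) = (\<Sum>x<p ^ m. ?h ((x + 1) mod p ^ m))" using sum_shift_mod[of "p ^ m" ?h 1] pq by simp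
      also have "\<dots> = E (p ^ Suc v) k * (\<Sum>x<p ^ m. ?h x)" unfolding hmod by (simp add: ring_distribs E_add sum_distrib_left mult.commute)
      finally have "(1 - E (p ^ Suc v) k) * (\<Sum>x<p ^ m. ?h x) = 0" by (simp add: algebra_simps)
      moreover have "E (p ^ Suc v) k \<noteq> 1"
      proof
        assume "E (p ^ Suc v) k = 1"
        then have "int (p ^ Suc v) dvd k" using E_eq_1_iff[OF pv] by blast
        then show False using k by (metis dvd_mult_left of_nat_mult power_Suc)
      qed
      ultimately show ?thesis by simp
    qed
    have "0 = (\<Sum>z\<in>{..<p ^ m} \<times> {..<q ^ n}. ?h (fst z))"
      using z1 unfolding sum.cartesian_product' by (simp add: sum_distrib_left[symmetric])
    also have "\<dots> = (\<Sum>w\<in>S \<times> (T \<times> U). ?h (fst ((\<lambda>(z, t). ((fst z + fst t) mod p ^ m, (snd z + snd t) mod q ^ n)) w)))"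
      by (rule sum.reindex_bij_betw[OF bij, symmetric])
    also have "\<dots> = (\<Sum>w\<in>S \<times> (T \<times> U). ?h (fst (fst w)) * ?h (fst (snd w)))"
      by (rule sum.cong[OF refl]) (simp only: case_prod_beta fst_conv hmod of_nat_add ring_distribs E_add)
    also have "\<dots> = (\<Sum>z\<in>S. ?h (fst z)) * (\<Sum>t\<in>T \<times> U. ?h (fst t))"
      by (simp add: sum_product sum.cartesian_product case_prod_beta)
    also have "(\<Sum>t\<in>T \<times> U. ?h (fst t)) = of_nat (card U) * (\<Sum>t\<in>T. ?h t)"
      by (simp add: sum.cartesian_product' sum_distrib_left)
    finally have "(\<Sum>z\<in>S. ?h (fst z)) * (of_nat (card U) * (\<Sum>t\<in>T. ?h t)) = 0" by simp
    moreover have "(\<Sum>t\<in>T. ?h t) \<noteq> 0" using T(4)[OF v k] .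
    moreover have "card U \<noteq> 0" using U(2) pq by simp
    ultimately show "(\<Sum>b\<in>S. E (p ^ Suc v) (k * int (fst b))) = 0" by simp
  qed
qed

text \<open>A zero at a level outside \<open>K\<close> would put one more factor \<open>p\<close>
  into the size of \<open>S\<close>. Consequently the digit sets can be read off the zeros of
  \<open>S\<close>.\<close>

lemma ext_zr_iff:
  assumes e: "ext p q m n S K L" and pr: "prime p" "prime q" "p \<noteq> q" and v: "v < m"
  shows "zr p q S (Suc v) 0 \<longleftrightarrow> v \<in> K"
proof
  assume z: "zr p q S (Suc v) 0"
  show "v \<in> K"
  proof (rule ccontr)
    assume nv: "v \<notin> K"
    have K: "K \<subseteq> {..<m}" and fS: "finite S" using e finite_subset unfolding ext_def by blast+
    have fK: "finite K" using K finite_subset by blast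
    have "p ^ card (insert v K) dvd card S"
    proof (rule pow_dvd_card[OF fS])
      show "p > 0" using pr prime_gt_0_nat by blast
      show "insert v K \<subseteq> {..<m}" using K v by simp
      show "zr p q S (Suc i) 0" if "i \<in> insert v K" for i
        using that z ext_zr[OF e pr(1,2)] by blast
    qed
    then have "p ^ card K * p dvd p ^ card K * q ^ card L" using nv fK e unfolding ext_def by simp
    then have "p dvd q ^ card L" using pr(1) prime_gt_0_nat by simp
    then have "p dvd q" using pr(1) prime_dvd_power by blast
    then show False using pr primes_dvd_imp_eq by blast
  qed
next
  assume "v \<in> K" then show "zr p q S (Suc v) 0" using ext_zr e pr by blast
qed

lemma ext_swap: "ext p q m n S K L \<Longrightarrow> ext q p n m (prod.swap ` S) L K"
  unfolding ext_def by (auto simp: card_image)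

lemma ext_zr_iff_q:
  assumes e: "ext p q m n S K L" and pr: "prime p" "prime q" "p \<noteq> q" and v: "v < n"
  shows "zr p q S 0 (Suc v) \<longleftrightarrow> v \<in> L"
  using ext_zr_iff[OF ext_swap[OF e] pr(2,1) pr(3)[symmetric] v] zr_swap[of q p S "Suc v" 0] by simp

section \<open>Removing a digit\<close>

definition del :: "nat \<Rightarrow> nat \<Rightarrow> nat \<Rightarrow> nat" where
  "del p k x = x mod p ^ k + p ^ k * (x div p ^ Suc k)"

definition ins :: "nat \<Rightarrow> nat \<Rightarrow> nat \<Rightarrow> nat \<Rightarrow> nat" where
  "ins p k t x = x mod p ^ k + p ^ k * (t + p * (x div p ^ k))"

lemma dg_low: "p > 0 \<Longrightarrow> v < k \<Longrightarrow> dg p v (x mod p ^ k + p ^ k * w) = dg p v x"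
  using mod_eq_dg[of "x mod p ^ k + p ^ k * w" p k x] by simp

lemma dg_high: assumes "p > 0" shows "dg p (k + v) (x mod p ^ k + p ^ k * w) = dg p v w"
proof -
  have "(x mod p ^ k + p ^ k * w) div p ^ k = w" using assms by simp
  then show ?thesis unfolding dg_def power_add by (simp only: div_mult2_eq)
qed

lemma dg_del: "p > 0 \<Longrightarrow> dg p v (del p k x) = (if v < k then dg p v x else dg p (Suc v) x)"
proof (cases "v < k")
  case False
  assume p: "p > 0"
  obtain w where w: "v = k + w" using False le_Suc_ex by (metis not_less)
  have "dg p w (x div p ^ Suc k) = dg p (Suc v) x" unfolding dg_def w div_mult2_eq[symmetric] power_add[symmetric] by simp
  then show ?thesis using False dg_high[OF p, of k w] unfolding del_def w by simp
qed (simp add: del_def dg_low)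

lemma dg_ins: 
  assumes "p > 0" "t < p"
  shows "dg p v (ins p k t x) = (if v < k then dg p v x else if v = k then t else dg p (v - 1) x)"
proof (cases "v < k")
  case False
  then obtain w where w: "v = k + w" using le_Suc_ex by (metis not_less)
  show ?thesis
  proof (cases w)
    case 0 then show ?thesis using dg_high[OF assms(1), of k 0] dg_add(1)[OF assms(1), of t] assms(2) unfolding ins_def w by simp
  next
    case (Suc u)
    have "dg p u (x div p ^ k) = dg p (k + u) x" unfolding dg_def div_mult2_eq[symmetric] power_add[symmetric] by simp
    then show ?thesis using dg_high[OF assms(1), of k w] dg_add(2)[OF assms, of u] Suc unfolding ins_def w by simp
  qed
qed (simp add: ins_def dg_low assms)

lemma lv_dgI: "v < m \<Longrightarrow> (\<And>u. u < v \<Longrightarrow> dg p u x = dg p u x') \<Longrightarrow> dg p v x \<noteq> dg p v x' \<Longrightarrow> lv p m x x' = v"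
  by (rule lv_eqI) (auto simp: mod_eq_dg simp del: power_Suc)

lemma lv_dg_eq: "u < lv p m x x' \<Longrightarrow> dg p u x = dg p u x'"
  using lv_mod mod_eq_dg by blast

lemma lv_dg_neq: "lv p m x x' < m \<Longrightarrow> dg p (lv p m x x') x \<noteq> dg p (lv p m x x') x'"
  using lv_less_neq[of p m x x'] lv_dg_eq[of _ p m x x'] unfolding mod_eq_dg by (auto simp: less_Suc_eq)

lemma lv_del:
  assumes "p > 0" "k \<le> m"
  shows "lv p (Suc m) x x' < k \<Longrightarrow> lv p m (del p k x) (del p k x') = lv p (Suc m) x x'"
    and "lv p (Suc m) x x' > k \<Longrightarrow> lv p m (del p k x) (del p k x') = lv p (Suc m) x x' - 1"
    and "lv p (Suc m) x x' = k \<Longrightarrow> k \<le> lv p m (del p k x) (del p k x')"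
proof -
  let ?v = "lv p (Suc m) x x'"
  show "?v < k \<Longrightarrow> lv p m (del p k x) (del p k x') = ?v"
    using assms lv_dg_neq[of p "Suc m" x x'] lv_dg_eq[of _ p "Suc m" x x'] by (intro lv_dgI) (auto simp: dg_del)
  show "?v = k \<Longrightarrow> k \<le> lv p m (del p k x) (del p k x')"
    unfolding lv_ge_iff[OF assms(2)] using assms lv_dg_eq[of _ p "Suc m" x x'] by (auto simp: dg_del)
  assume v: "?v > k"
  have eq: "dg p u (del p k x) = dg p u (del p k x')" if "u < ?v - 1" for u
    using that assms lv_dg_eq[of _ p "Suc m" x x'] by (auto simp: dg_del)
  show "lv p m (del p k x) (del p k x') = ?v - 1"
  proof (cases "?v = Suc m")
    case True
    then have "m \<le> lv p m (del p k x) (del p k x')" unfolding lv_ge_iff[OF order_refl] using eq by auto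
    then show ?thesis using lv_le[of p m] True by (metis diff_Suc_1 le_antisym)
  next
    case False
    then have l: "?v < Suc m" using lv_le[of p "Suc m" x x'] by simp
    then have "dg p ?v x \<noteq> dg p ?v x'" by (rule lv_dg_neq)
    then show ?thesis using v l eq assms by (intro lv_dgI) (auto simp: dg_del)
  qed
qed

lemma del_lt: assumes "p > 0" "k \<le> m" "x < p ^ Suc m" shows "del p k x < p ^ m"
proof -
  have "x div p ^ Suc k < p ^ (m - k)"
  proof (rule less_mult_imp_div_less)
    have "p ^ (m - k) * p ^ Suc k = p ^ Suc m" using assms(2) unfolding power_add[symmetric] by simp
    then show "x < p ^ (m - k) * p ^ Suc k" using assms(3) by (simp only:)
  qed
  then have "Suc (x div p ^ Suc k) \<le> p ^ (m - k)" by simp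
  then have "p ^ k * Suc (x div p ^ Suc k) \<le> p ^ k * p ^ (m - k)" by (rule mult_le_mono2)
  also have "\<dots> = p ^ m" using assms(2) by (simp flip: power_add)
  finally have "p ^ k + p ^ k * (x div p ^ Suc k) \<le> p ^ m" by simp
  moreover have "x mod p ^ k < p ^ k" using assms(1) by simp
  ultimately show ?thesis unfolding del_def by linarith
qed

definition del_fst :: "nat \<Rightarrow> nat \<Rightarrow> nat \<times> nat \<Rightarrow> nat \<times> nat" where
  "del_fst p k z = (del p k (fst z), snd z)"

lemma del_fst_simps[simp]: "fst (del_fst p k z) = del p k (fst z)" "snd (del_fst p k z) = snd z"
  unfolding del_fst_def by simp_all

lemma cn_dl_le:
  assumes "p > 0" "inj_on (del_fst p k) S" "i \<le> k"
  shows "cn p q (del_fst p k ` S) i j x y = cn p q S i j x y"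
proof -
  have "del p k z mod p ^ i = z mod p ^ i" for z
    using assms unfolding mod_eq_dg by (auto simp: dg_del)
  then have "cl p q (del_fst p k ` S) i j x y = del_fst p k ` cl p q S i j x y" unfolding cl_def by auto
  moreover have "inj_on (del_fst p k) (cl p q S i j x y)" by (rule inj_on_subset[OF assms(2)]) (auto simp: cl_def)
  ultimately show ?thesis unfolding cn_def by (simp add: card_image)
qed

text \<open>A class after deletion is the disjoint union of the \<open>p\<close> classes obtained by
  choosing the lost digit.\<close>

lemma cn_dl_gt:
  assumes p: "p > 0" and inj: "inj_on (del_fst p k) S" and ik: "k \<le> i" and fS: "finite S"
  shows "cn p q (del_fst p k ` S) i j x y = (\<Sum>t<p. cn p q S (Suc i) j (ins p k t x) y)"
proof -
  have key: "del p k z mod p ^ i = x mod p ^ i \<longleftrightarrow> (\<exists>t<p. z mod p ^ Suc i = ins p k t x mod p ^ Suc i)" for z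
  proof
    assume a: "del p k z mod p ^ i = x mod p ^ i"
    have "dg p v z = dg p v (ins p k (dg p k z) x)" if "v < Suc i" for v
    proof (cases "v \<le> k")
      case True
      show ?thesis
      proof (cases "v = k")
        case False
        then have v: "v < k" "v < i" using True ik by auto
        then have "dg p v (del p k z) = dg p v x" using a unfolding mod_eq_dg by blast
        then show ?thesis using v p by (simp add: dg_ins dg_lt dg_del)
      qed (simp add: dg_ins dg_lt p)
    next
      case False
      then have "dg p (v - 1) (del p k z) = dg p (v - 1) x" using a that unfolding mod_eq_dg by simp
      then show ?thesis using False p by (simp add: dg_ins dg_lt dg_del split: if_splits)
    qed
    then show "\<exists>t<p. z mod p ^ Suc i = ins p k t x mod p ^ Suc i"
      unfolding mod_eq_dg using dg_lt[OF p] by blast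
  next
    assume "\<exists>t<p. z mod p ^ Suc i = ins p k t x mod p ^ Suc i"
    then obtain t where t: "t < p" "\<And>v. v < Suc i \<Longrightarrow> dg p v z = dg p v (ins p k t x)" unfolding mod_eq_dg by blast
    show "del p k z mod p ^ i = x mod p ^ i" unfolding mod_eq_dg using t p by (auto simp: dg_del dg_ins)
  qed
  let ?C = "\<lambda>t. cl p q S (Suc i) j (ins p k t x) y"
  have "cl p q (del_fst p k ` S) i j x y = del_fst p k ` {z \<in> S. del p k (fst z) mod p ^ i = x mod p ^ i \<and> snd z mod q ^ j = y mod q ^ j}"
    unfolding cl_def by auto
  also have "\<dots> = del_fst p k ` (\<Union>t<p. ?C t)"
    unfolding key cl_def by (rule arg_cong[where f = "image (del_fst p k)"]) blast
  finally have "cl p q (del_fst p k ` S) i j x y = del_fst p k ` (\<Union>t<p. ?C t)" .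
  moreover have "inj_on (del_fst p k) (\<Union>t<p. ?C t)" by (rule inj_on_subset[OF inj]) (auto simp: cl_def)
  ultimately have "cn p q (del_fst p k ` S) i j x y = card (\<Union>t<p. ?C t)" unfolding cn_def by (simp add: card_image)
  also have "\<dots> = (\<Sum>t<p. card (?C t))"
  proof (rule card_UN_disjoint)
    show "\<forall>t\<in>{..<p}. \<forall>t'\<in>{..<p}. t \<noteq> t' \<longrightarrow> ?C t \<inter> ?C t' = {}"
    proof (intro ballI impI)
      fix t t' assume t: "t \<in> {..<p}" "t' \<in> {..<p}" "t \<noteq> t'"
      have "ins p k t x mod p ^ Suc i \<noteq> ins p k t' x mod p ^ Suc i"
      proof
        assume "ins p k t x mod p ^ Suc i = ins p k t' x mod p ^ Suc i"
        then have "dg p k (ins p k t x) = dg p k (ins p k t' x)" unfolding mod_eq_dg using ik by auto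
        then show False using t p by (simp add: dg_ins)
      qed
      then show "?C t \<inter> ?C t' = {}" unfolding cl_def by auto
    qed
  qed (use fS cl_fin in auto)
  finally show ?thesis unfolding cn_def .
qed

lemma zr_dl_le:
  assumes "p > 0" "inj_on (del_fst p k) S" "i \<le> k" "zr p q S i j"
  shows "zr p q (del_fst p k ` S) i j"
proof -
  have c: "cn p q (del_fst p k ` S) i j' x y = cn p q S i j' x y" for j' x y by (rule cn_dl_le[OF assms(1-3)])
  consider "i = 0" "j = 0" | j' where "i = 0" "j = Suc j'" | i' where "i = Suc i'" "j = 0" | i' j' where "i = Suc i'" "j = Suc j'"
    by (cases i; cases j) auto
  then show ?thesis
  proof cases
    case 1 then show ?thesis using assms(4) by simp
  next
    case (2 j') show ?thesis using assms(4) unfolding 2 zr.simps c[unfolded 2] .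
  next
    case (3 i') show ?thesis using assms(4) unfolding 3 zr.simps c[unfolded 3] .
  next
    case (4 i' j') show ?thesis using assms(4) unfolding 4 zr.simps c[unfolded 4] .
  qed
qed

lemma zr_dl_gt:
  assumes p: "p > 0" and inj: "inj_on (del_fst p k) S" and ik: "k \<le> i" and fS: "finite S" and z: "zr p q S (Suc (Suc i)) j"
  shows "zr p q (del_fst p k ` S) (Suc i) j"
proof -
  have c: "cn p q (del_fst p k ` S) (Suc i) j' x y = (\<Sum>t<p. cn p q S (Suc (Suc i)) j' (ins p k t x) y)" for j' x y
    by (rule cn_dl_gt[OF p inj _ fS]) (use ik in simp)
  have m: "ins p k t x mod p ^ Suc i = ins p k t x' mod p ^ Suc i" if "x mod p ^ i = x' mod p ^ i" "t < p" for t x x'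
    using that ik p unfolding mod_eq_dg by (auto simp: dg_ins)
  show ?thesis
  proof (cases j)
    case 0
    show ?thesis unfolding 0 zr.simps c
    proof (intro allI impI sum.cong refl)
      fix x x' t assume h: "x mod p ^ i = x' mod p ^ i" "t \<in> {..<p}"
      show "cn p q S (Suc (Suc i)) 0 (ins p k t x) 0 = cn p q S (Suc (Suc i)) 0 (ins p k t x') 0"
        using z[unfolded 0 zr.simps] m[OF h(1)] h(2) by (meson lessThan_iff)
    qed
  next
    case (Suc j')
    show ?thesis unfolding Suc zr.simps c sum.distrib[symmetric]
    proof (intro allI impI sum.cong refl)
      fix x x' y y' t assume h: "x mod p ^ i = x' mod p ^ i" "y mod q ^ j' = y' mod q ^ j'" "t \<in> {..<p}"
      show "cn p q S (Suc (Suc i)) (Suc j') (ins p k t x) y + cn p q S (Suc (Suc i)) (Suc j') (ins p k t x') y' =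
        cn p q S (Suc (Suc i)) (Suc j') (ins p k t x) y' + cn p q S (Suc (Suc i)) (Suc j') (ins p k t x') y"
        using z[unfolded Suc zr.simps] m[OF h(1)] h by (meson lessThan_iff)
    qed
  qed
qed

text \<open>Without branching at level \<open>a\<close>, each class modulo \<open>p ^ a\<close> has
  a subclass modulo \<open>p ^ (a + 1)\<close> free of \<open>S\<close>. Against that subclass the
  four-term relation becomes constancy in \<open>y\<close>; for \<open>j = 0\<close> the comparison
  would empty every subclass. Coarser classes are sums of finer ones.\<close>

lemma nonbranch:
  assumes pq: "prime p" "q > 0" and fS: "finite S" "S \<noteq> {}" and a: "a < m" and nb: "\<And>b b'. b \<in> S \<Longrightarrow> b' \<in> S \<Longrightarrow> lv p m (fst b) (fst b') \<noteq> a"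
    and z: "zr p q S (Suc a) j"
  shows "j > 0" and "i \<le> Suc a \<Longrightarrow> y mod q ^ (j - 1) = y' mod q ^ (j - 1) \<Longrightarrow> cn p q S i j x y = cn p q S i j x y'"
proof -
  have p0: "p > 0" "p \<ge> 2" using pq(1) prime_gt_0_nat prime_ge_2_nat by blast+
  have same: "fst b mod p ^ Suc a = fst b' mod p ^ Suc a" if "b \<in> S" "b' \<in> S" "fst b mod p ^ a = fst b' mod p ^ a" for b b'
  proof -
    have "a \<le> lv p m (fst b) (fst b')" using lv_iff[of a m] a that(3) by simp
    then have "Suc a \<le> lv p m (fst b) (fst b')" using nb[OF that(1,2)] by simp
    then show ?thesis using lv_iff[of "Suc a" m] a by simp
  qed
  have other: "\<exists>x'. x mod p ^ a = x' mod p ^ a \<and> (\<forall>j y. cn p q S (Suc a) j x' y = 0)" for x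
  proof (rule ccontr)
    assume H: "\<nexists>x'. x mod p ^ a = x' mod p ^ a \<and> (\<forall>j y. cn p q S (Suc a) j x' y = 0)"
    have "\<exists>b\<in>S. fst b mod p ^ Suc a = (x mod p ^ a + p ^ a * t) mod p ^ Suc a" for t
    proof -
      have "x mod p ^ a = (x mod p ^ a + p ^ a * t) mod p ^ a" by simp
      then obtain j y where "cn p q S (Suc a) j (x mod p ^ a + p ^ a * t) y \<noteq> 0" using H by blast
      then have "cl p q S (Suc a) j (x mod p ^ a + p ^ a * t) y \<noteq> {}" unfolding cn_def by auto
      then show ?thesis unfolding cl_def by blast
    qed
    from this[of 0] this[of 1] obtain b b' where b: "b \<in> S" "fst b mod p ^ Suc a = (x mod p ^ a + p ^ a * 0) mod p ^ Suc a"
      "b' \<in> S" "fst b' mod p ^ Suc a = (x mod p ^ a + p ^ a * 1) mod p ^ Suc a" by blast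
    have "fst b mod p ^ a = (x mod p ^ a + p ^ a * 0) mod p ^ a" using b(2) by (rule mod_pow_mono) simp
    moreover have "fst b' mod p ^ a = (x mod p ^ a + p ^ a * 1) mod p ^ a" using b(4) by (rule mod_pow_mono) simp
    ultimately have "fst b mod p ^ a = fst b' mod p ^ a" by simp
    from same[OF b(1,3) this] have "(x mod p ^ a + p ^ a * 0) mod p ^ Suc a = (x mod p ^ a + p ^ a * 1) mod p ^ Suc a" using b by simp
    then have "dg p a (x mod p ^ a + p ^ a * 0) = dg p a (x mod p ^ a + p ^ a * 1)" unfolding mod_eq_dg by blast
    then show False using dg_high[OF p0(1), of a 0 x] p0(2) by (simp add: dg_def)
  qed
  show j0: "j > 0"
  proof (rule ccontr)
    assume "\<not> j > 0"
    then have j: "j = 0" by simp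
    obtain b where b: "b \<in> S" using fS by blast
    obtain x' where x': "fst b mod p ^ a = x' mod p ^ a" "cn p q S (Suc a) 0 x' 0 = 0" using other by blast
    have "cn p q S (Suc a) 0 (fst b) 0 = 0" using z[unfolded j zr.simps] x' by metis
    moreover have "b \<in> cl p q S (Suc a) 0 (fst b) 0" using b unfolding cl_def by simp
    ultimately show False using cl_fin[OF fS(1)] unfolding cn_def by (metis card_0_eq empty_iff)
  qed
  assume i: "i \<le> Suc a" and y: "y mod q ^ (j - 1) = y' mod q ^ (j - 1)"
  obtain j' where j': "j = Suc j'" using j0 by (cases j) auto
  show "cn p q S i j x y = cn p q S i j x y'"
    using i
  proof (induction "Suc a - i" arbitrary: i x)
    case 0
    then have ia: "i = Suc a" by simp
    obtain x' where x': "x mod p ^ a = x' mod p ^ a" "\<And>y. cn p q S (Suc a) j x' y = 0" using other by blast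
    have "cn p q S (Suc a) (Suc j') x y + cn p q S (Suc a) (Suc j') x' y' = cn p q S (Suc a) (Suc j') x y' + cn p q S (Suc a) (Suc j') x' y"
      using z[unfolded j' zr.simps] x'(1) y j' by simp
    then show ?case using x'(2) unfolding ia j' by simp
  next
    case (Suc r)
    then have "r = Suc a - Suc i" "Suc i \<le> Suc a" by auto
    then have "cn p q S (Suc i) j w y = cn p q S (Suc i) j w y'" for w using Suc.hyps(1) by blast
    then show ?case unfolding cn_split_p[OF fS(1) p0(1), of q i j x] by simp
  qed
qed

lemma zr_of_uniform_q:
  assumes "\<And>x y y'. y mod q ^ j = y' mod q ^ j \<Longrightarrow> cn p q S i (Suc j) x y = cn p q S i (Suc j) x y'"
  shows "zr p q S i (Suc j)"
proof (cases i)
  case 0 show ?thesis unfolding 0 zr.simps using assms[unfolded 0] by blast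
next
  case (Suc i')
  show ?thesis unfolding Suc zr.simps
  proof (intro allI impI)
    fix x x' y y' assume y: "y mod q ^ j = y' mod q ^ j"
    show "cn p q S (Suc i') (Suc j) x y + cn p q S (Suc i') (Suc j) x' y' = cn p q S (Suc i') (Suc j) x y' + cn p q S (Suc i') (Suc j) x' y"
      using assms[unfolded Suc, OF y, of x] assms[unfolded Suc, OF y, of x'] by linarith
  qed
qed

text \<open>A difference of level \<open>v\<close> has order \<open>p ^ (m - v)\<close>, and a zero
  of order \<open>p ^ (w + 1)\<close> belongs to digit \<open>w\<close>; hence digit
  \<open>v\<close> of one set is dual to digit \<open>m - 1 - v\<close> of the other.\<close>

definition flip :: "nat \<Rightarrow> nat set \<Rightarrow> nat set" where "flip m K = {v. v < m \<and> m - 1 - v \<in> K}"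

lemma flip_rf: "K \<subseteq> {..<m} \<Longrightarrow> flip m (flip m K) = K"
  unfolding flip_def by auto

text \<open>
  The statement proved by induction on \<open>m + n\<close>: the two sets of a spectral pair tile by means of
  complementary sets of digits.
\<close>

definition good :: "nat \<Rightarrow> nat \<Rightarrow> nat \<Rightarrow> nat \<Rightarrow> (nat \<times> nat) set \<Rightarrow> (nat \<times> nat) set \<Rightarrow> bool" where
  "good p q m n A B \<longleftrightarrow> (\<exists>K L. ext p q m n B K L \<and> ext p q m n A (flip m K) (flip n L))"

lemma flip_sub: "flip m K \<subseteq> {..<m}" unfolding flip_def by auto

lemma card_rf: assumes "K \<subseteq> {..<m}" shows "card (flip m K) = card K"
proof -
  have "bij_betw (\<lambda>v. m - 1 - v) K (flip m K)"
    by (rule bij_betw_byWitness[of _ "\<lambda>v. m - 1 - v"]) (use assms in \<open>auto simp: flip_def subset_iff\<close>)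
  then show ?thesis by (metis bij_betw_same_card)
qed

lemma good_sym: "good p q m n A B \<Longrightarrow> good p q m n B A"
  unfolding good_def by (metis ext_def flip_rf)

lemma good_swap: "good p q m n A B \<Longrightarrow> good q p n m (prod.swap ` A) (prod.swap ` B)"
  unfolding good_def using ext_swap by blast

lemma del_fst_inj_cases:
  assumes "p > 0" "k \<le> m" "fst z < p ^ Suc m" "fst z' < p ^ Suc m" "del_fst p k z = del_fst p k z'" "z \<noteq> z'"
  shows "snd z = snd z' \<and> lv p (Suc m) (fst z) (fst z') = k"
proof -
  have s: "snd z = snd z'" "del p k (fst z) = del p k (fst z')" using assms(5) unfolding del_fst_def by auto
  then have ne: "fst z \<noteq> fst z'" using assms(6) by (auto simp: prod_eq_iff)
  let ?v = "lv p (Suc m) (fst z) (fst z')"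
  have v: "?v < Suc m" using ne lv_eq_iff[OF assms(3,4)] lv_le[of p "Suc m" "fst z" "fst z'"] by linarith
  have l: "lv p m (del p k (fst z)) (del p k (fst z')) = m" using s by simp
  have "\<not> ?v < k" using lv_del(1)[OF assms(1,2), of "fst z" "fst z'"] l assms(2) by linarith
  moreover have "\<not> ?v > k" using lv_del(2)[OF assms(1,2), of "fst z" "fst z'"] l v by linarith
  ultimately show ?thesis using s by simp
qed

lemma spairD:
  assumes "spair p q m n A B"
  shows "A \<subseteq> {..<p ^ m} \<times> {..<q ^ n}" "B \<subseteq> {..<p ^ m} \<times> {..<q ^ n}" "A \<noteq> {}" "card A = card B"
    "\<And>b b'. b \<in> B \<Longrightarrow> b' \<in> B \<Longrightarrow> b \<noteq> b' \<Longrightarrow> zr p q A (m - lv p m (fst b) (fst b')) (n - lv q n (snd b) (snd b'))"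
    "\<And>b b'. b \<in> A \<Longrightarrow> b' \<in> A \<Longrightarrow> b \<noteq> b' \<Longrightarrow> zr p q B (m - lv p m (fst b) (fst b')) (n - lv q n (snd b) (snd b'))"
  using assms unfolding spair_def by simp_all

lemma extD:
  "ext p q m n S K L \<Longrightarrow> z \<in> S \<Longrightarrow> z' \<in> S \<Longrightarrow> z \<noteq> z' \<Longrightarrow> lv p m (fst z) (fst z') \<in> K \<or> lv q n (snd z) (snd z') \<in> L"
  unfolding ext_def by blast

text \<open>
  If no two elements of \<open>B\<close> first differ at digit \<open>a\<close>, that digit of \<open>B\<close> and the dual digit \<open>m - a\<close>
  of \<open>A\<close> can be deleted.
\<close>

lemma good_of_absent_level:
  assumes sp: "spair p q (Suc m) n A B" and pr: "prime p" "prime q" "p \<noteq> q" and am: "a \<le> m"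
    and nb: "\<And>b b'. b \<in> B \<Longrightarrow> b' \<in> B \<Longrightarrow> lv p (Suc m) (fst b) (fst b') \<noteq> a"
    and IH: "\<And>A' B'. spair p q m n A' B' \<Longrightarrow> good p q m n A' B'"
  shows "good p q (Suc m) n A B"
proof -
  note D = spairD[OF sp]
  note fin = spair_finite[OF sp]
  have p0: "p > 0" "q > 0" using pr prime_gt_0_nat by auto
  \<comment> \<open>Level \<open>r\<close> in \<open>A\<close> means \<open>p\<close>-order exactly
    \<open>p ^ (a + 1)\<close>, the order at which \<open>nonbranch\<close> applies to
    \<open>B\<close>.\<close>
  define r where "r = m - a"
  have r: "r \<le> m" "m - r = a" "Suc m - r = Suc a" using am unfolding r_def by auto
  have Bne: "B \<noteq> {}" using spair_pos[OF sp] by blast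
  have am': "a < Suc m" using am by simp
  have NB1: "j > 0" if "zr p q B (Suc a) j" for j
    by (rule nonbranch(1)[OF pr(1) p0(2) fin(2) Bne am' _ that]) (rule nb)
  have NB2: "cn p q B i j x y = cn p q B i j x y'"
    if "zr p q B (Suc a) j" "i \<le> Suc a" "y mod q ^ (j - 1) = y' mod q ^ (j - 1)" for i j x y y'
    by (rule nonbranch(2)[OF pr(1) p0(2) fin(2) Bne am' _ that]) (rule nb)
  have injB: "inj_on (del_fst p a) B"
  proof (rule inj_onI, rule ccontr)
    fix z z' assume z: "z \<in> B" "z' \<in> B" "del_fst p a z = del_fst p a z'" "z \<noteq> z'"
    have "fst z < p ^ Suc m" "fst z' < p ^ Suc m" using z D(2) by auto
    from del_fst_inj_cases[OF p0(1) am this z(3,4)] show False using nb z by blast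
  qed
  have injA: "inj_on (del_fst p r) A"
  proof (rule inj_onI, rule ccontr)
    fix z z' assume z: "z \<in> A" "z' \<in> A" "del_fst p r z = del_fst p r z'" "z \<noteq> z'"
    have "fst z < p ^ Suc m" "fst z' < p ^ Suc m" using z D(1) by auto
    from del_fst_inj_cases[OF p0(1) r(1) this z(3,4)] have l: "snd z = snd z'" "lv p (Suc m) (fst z) (fst z') = r" by auto
    have "zr p q B (Suc a) 0" using D(6)[OF z(1,2,4)] unfolding l r(3) lv_refl diff_self_eq_0 .
    then show False using NB1 by blast
  qed
  let ?A = "del_fst p r ` A" and ?B = "del_fst p a ` B"
  have unif: "cn p q B i (n - lv q n (snd z) (snd z')) x y = cn p q B i (n - lv q n (snd z) (snd z')) x y'"
     "n - lv q n (snd z) (snd z') > 0"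
    if z: "z \<in> A" "z' \<in> A" "z \<noteq> z'" "lv p (Suc m) (fst z) (fst z') = r" and i: "i \<le> Suc a" 
      "y mod q ^ (n - lv q n (snd z) (snd z') - 1) = y' mod q ^ (n - lv q n (snd z) (snd z') - 1)" for z z' i x y y'
  proof -
    have zz: "zr p q B (Suc a) (n - lv q n (snd z) (snd z'))" using D(6)[OF z(1-3)] unfolding z(4) r(3) .
    show "cn p q B i (n - lv q n (snd z) (snd z')) x y = cn p q B i (n - lv q n (snd z) (snd z')) x y'"
      by (rule NB2[OF zz i])
    show "n - lv q n (snd z) (snd z') > 0" by (rule NB1[OF zz])
  qed
  \<comment> \<open>When digit \<open>r\<close> is deleted, a difference of level \<open>r\<close>
    may acquire any higher level, so zeros of \<open>B\<close> are required at all smaller powers of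
    \<open>p\<close>. Uniformity in the \<open>q\<close>-direction supplies them
    simultaneously.\<close>
  have unif_zr: "zr p q ?B i (n - lv q n (snd z) (snd z'))"
    if z: "z \<in> A" "z' \<in> A" "z \<noteq> z'" "lv p (Suc m) (fst z) (fst z') = r" and i: "i \<le> a" for z z' i
  proof -
    obtain j where j: "n - lv q n (snd z) (snd z') = Suc j" using unif(2)[OF z, of 0 0 0] by (cases "n - lv q n (snd z) (snd z')") auto
    show ?thesis unfolding j
    proof (rule zr_of_uniform_q)
      fix x y y' assume y: "y mod q ^ j = y' mod q ^ j"
      have "cn p q B i (Suc j) x y = cn p q B i (Suc j) x y'"
        using unif(1)[OF z, of i y y' x] i y unfolding j by simp
      then show "cn p q ?B i (Suc j) x y = cn p q ?B i (Suc j) x y'"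
        unfolding cn_dl_le[OF p0(1) injB i] .
    qed
  qed
  have sp': "spair p q m n ?A ?B"
    unfolding spair_def
  proof (intro conjI ballI impI)
    show "?A \<subseteq> {..<p ^ m} \<times> {..<q ^ n}" using D(1) del_lt[OF p0(1) r(1)] by (fastforce simp: del_fst_def)
    show "?B \<subseteq> {..<p ^ m} \<times> {..<q ^ n}" using D(2) del_lt[OF p0(1) am] by (fastforce simp: del_fst_def)
    show "?A \<noteq> {}" using D(3) by simp
    show "card ?A = card ?B" using D(4) injA injB by (simp add: card_image)
  next
    fix c c' assume "c \<in> ?B" "c' \<in> ?B" "c \<noteq> c'"
    then obtain b b' where b: "b \<in> B" "b' \<in> B" "b \<noteq> b'" "c = del_fst p a b" "c' = del_fst p a b'" by blast
    let ?v = "lv p (Suc m) (fst b) (fst b')"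
    have vm: "?v \<le> Suc m" by (rule lv_le)
    have z: "zr p q A (Suc m - ?v) (n - lv q n (snd b) (snd b'))" using D(5)[OF b(1-3)] .
    have "?v \<noteq> a" using nb b by blast
    then consider "?v < a" | "?v > a" by linarith
    then show "zr p q ?A (m - lv p m (fst c) (fst c')) (n - lv q n (snd c) (snd c'))"
    proof cases
      case 1
      have e: "m - ?v = Suc (m - ?v - 1)" "Suc m - ?v = Suc (Suc (m - ?v - 1))" "r \<le> m - ?v - 1" using 1 am unfolding r_def by auto
      have "zr p q ?A (Suc (m - ?v - 1)) (n - lv q n (snd b) (snd b'))"
        by (rule zr_dl_gt[OF p0(1) injA e(3) fin(1)]) (use z e(2) in simp)
      then show ?thesis unfolding b(4,5) del_fst_simps lv_del(1)[OF p0(1) am 1] e(1)[symmetric] .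
    next
      case 2
      have e: "m - (?v - 1) = Suc m - ?v" "Suc m - ?v \<le> r" using 2 am vm unfolding r_def by auto
      have "zr p q ?A (Suc m - ?v) (n - lv q n (snd b) (snd b'))"
        by (rule zr_dl_le[OF p0(1) injA e(2) z])
      then show ?thesis unfolding b(4,5) del_fst_simps lv_del(2)[OF p0(1) am 2] e(1) .
    qed
  next
    fix c c' assume "c \<in> ?A" "c' \<in> ?A" "c \<noteq> c'"
    then obtain b b' where b: "b \<in> A" "b' \<in> A" "b \<noteq> b'" "c = del_fst p r b" "c' = del_fst p r b'" by blast
    let ?v = "lv p (Suc m) (fst b) (fst b')"
    have vm: "?v \<le> Suc m" by (rule lv_le)
    have z: "zr p q B (Suc m - ?v) (n - lv q n (snd b) (snd b'))" using D(6)[OF b(1-3)] .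
    consider "?v < r" | "?v > r" | "?v = r" by linarith
    then show "zr p q ?B (m - lv p m (fst c) (fst c')) (n - lv q n (snd c) (snd c'))"
    proof cases
      case 1
      have e: "m - ?v = Suc (m - ?v - 1)" "Suc m - ?v = Suc (Suc (m - ?v - 1))" "a \<le> m - ?v - 1" using 1 am unfolding r_def by auto
      have "zr p q ?B (Suc (m - ?v - 1)) (n - lv q n (snd b) (snd b'))"
        by (rule zr_dl_gt[OF p0(1) injB e(3) fin(2)]) (use z e(2) in simp)
      then show ?thesis unfolding b(4,5) del_fst_simps lv_del(1)[OF p0(1) r(1) 1] e(1)[symmetric] .
    next
      case 2
      have e: "m - (?v - 1) = Suc m - ?v" "Suc m - ?v \<le> a" using 2 am vm unfolding r_def by auto
      have "zr p q ?B (Suc m - ?v) (n - lv q n (snd b) (snd b'))"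
        by (rule zr_dl_le[OF p0(1) injB e(2) z])
      then show ?thesis unfolding b(4,5) del_fst_simps lv_del(2)[OF p0(1) r(1) 2] e(1) .
    next
      case 3
      have "m - lv p m (fst c) (fst c') \<le> a"
        using lv_del(3)[OF p0(1) r(1) 3] am unfolding b(4,5) del_fst_simps r_def by linarith
      from unif_zr[OF b(1-3) 3 this] show ?thesis unfolding b(4,5) del_fst_simps .
    qed
  qed
  from IH[OF sp'] obtain K L where KL: "ext p q m n ?B K L" "ext p q m n ?A (flip m K) (flip n L)" unfolding good_def by blast
  have KLs: "K \<subseteq> {..<m}" "L \<subseteq> {..<n}" using KL unfolding ext_def by auto
  define K' where "K' = {v \<in> K. v < a} \<union> Suc ` {v \<in> K. a \<le> v}"
  have K's: "K' \<subseteq> {..<Suc m}" using KLs unfolding K'_def by auto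
  have fK: "finite K" using KLs finite_subset by blast
  have cK: "card K' = card K"
  proof -
    have "card K' = card {v \<in> K. v < a} + card (Suc ` {v \<in> K. a \<le> v})"
      unfolding K'_def by (rule card_Un_disjoint) (use fK in auto)
    also have "\<dots> = card {v \<in> K. v < a} + card {v \<in> K. a \<le> v}" by (simp add: card_image)
    also have "\<dots> = card ({v \<in> K. v < a} \<union> {v \<in> K. a \<le> v})" by (rule card_Un_disjoint[symmetric]) (use fK in auto)
    also have "{v \<in> K. v < a} \<union> {v \<in> K. a \<le> v} = K" by auto
    finally show ?thesis .
  qed
  have eB: "ext p q (Suc m) n B K' L"
    unfolding ext_def
  proof (intro conjI ballI impI K's KLs(2) D(2))
    show "card B = p ^ card K' * q ^ card L" using KL(1) injB unfolding ext_def cK by (simp add: card_image)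
    fix b b' assume b: "b \<in> B" "b' \<in> B" "b \<noteq> b'"
    let ?v = "lv p (Suc m) (fst b) (fst b')"
    have "del_fst p a b \<noteq> del_fst p a b'" using injB b by (meson inj_on_def)
    then have k: "lv p m (del p a (fst b)) (del p a (fst b')) \<in> K \<or> lv q n (snd b) (snd b') \<in> L"
      using extD[OF KL(1) imageI[OF b(1)] imageI[OF b(2)]] unfolding del_fst_simps by blast
    have "?v \<noteq> a" using nb b by blast
    then consider "?v < a" | "?v > a" by linarith
    then show "?v \<in> K' \<or> lv q n (snd b) (snd b') \<in> L"
    proof cases
      case 1 then show ?thesis using k lv_del(1)[OF p0(1) am 1] unfolding K'_def by auto
    next
      case 2 then show ?thesis using k lv_del(2)[OF p0(1) am 2] unfolding K'_def 
        by (auto simp: image_iff intro!: bexI[of _ "?v - 1"])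
    qed
  qed
  have eA: "ext p q (Suc m) n A (flip (Suc m) K') (flip n L)"
    unfolding ext_def
  proof (intro conjI ballI impI flip_sub D(1))
    show "card A = p ^ card (flip (Suc m) K') * q ^ card (flip n L)"
      using eB D(4) unfolding ext_def card_rf[OF K's] card_rf[OF KLs(2)] by simp
    fix b b' assume b: "b \<in> A" "b' \<in> A" "b \<noteq> b'"
    let ?v = "lv p (Suc m) (fst b) (fst b')"
    have vm: "?v \<le> Suc m" by (rule lv_le)
    have "del_fst p r b \<noteq> del_fst p r b'" using injA b by (meson inj_on_def)
    then have k: "lv p m (del p r (fst b)) (del p r (fst b')) \<in> flip m K \<or> lv q n (snd b) (snd b') \<in> flip n L"
      using extD[OF KL(2) imageI[OF b(1)] imageI[OF b(2)]] unfolding del_fst_simps by blast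
    consider "?v < r" | "?v > r" | "?v = r" by linarith
    then show "?v \<in> flip (Suc m) K' \<or> lv q n (snd b) (snd b') \<in> flip n L"
    proof cases
      case 1
      have e: "m - ?v = Suc (m - 1 - ?v)" "a \<le> m - 1 - ?v" using 1 am unfolding r_def by auto
      show ?thesis using k e vm unfolding lv_del(1)[OF p0(1) r(1) 1] by (auto simp: K'_def flip_def)
    next
      case 2
      have e: "m - ?v < a" if "?v < Suc m" using 2 am that unfolding r_def by auto
      have "m - 1 - (?v - 1) = m - ?v" using 2 by auto
      then show ?thesis using k e vm 2 unfolding lv_del(2)[OF p0(1) r(1) 2] by (auto simp: K'_def flip_def)
    next
      case 3
      \<comment> \<open>Level \<open>r\<close> is not in the new digit set, so the
        \<open>q\<close>-level has to cover this difference: it yields a pure \<open>q\<close>-zero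
        of the shortened \<open>B\<close>, and these determine \<open>L\<close>.\<close>
      have z: "zr p q ?B 0 (n - lv q n (snd b) (snd b'))" by (rule unif_zr[OF b 3]) simp
      have w: "lv q n (snd b) (snd b') < n" using unif(2)[OF b 3, of 0 0 0] by simp
      then have e: "n - lv q n (snd b) (snd b') = Suc (n - 1 - lv q n (snd b) (snd b'))" "n - 1 - lv q n (snd b) (snd b') < n" by auto
      have "n - 1 - lv q n (snd b) (snd b') \<in> L" using ext_zr_iff_q[OF KL(1) pr e(2)] z unfolding e(1) by simp
      then show ?thesis using w unfolding flip_def by simp
    qed
  qed
  show ?thesis unfolding good_def using eA eB by blast
qed

text \<open>
  If \<open>A\<close> is invariant under the subgroup of order \<open>p\<close>, its quotient is paired with each part of \<open>B\<close>
  having a fixed lowest digit. The digit sets of the parts agree because they are read off the quotient.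
\<close>

lemma good_of_invariant:
  assumes sp: "spair p q (Suc m) n A B" and pr: "prime p" "prime q" "p \<noteq> q"
    and inv: "\<And>x x' y. (x, y) \<in> A \<Longrightarrow> x' < p ^ Suc m \<Longrightarrow> x' mod p ^ m = x mod p ^ m \<Longrightarrow> (x', y) \<in> A"
    and IH: "\<And>A' B'. spair p q m n A' B' \<Longrightarrow> good p q m n A' B'"
  shows "good p q (Suc m) n A B"
proof -
  note D = spairD[OF sp]
  note fin = spair_finite[OF sp]
  have p0: "p > 0" "q > 0" "p \<ge> 2" using pr prime_gt_0_nat prime_ge_2_nat by auto
  define A' where "A' = (\<lambda>z. (fst z mod p ^ m, snd z)) ` A"
  define B' where "B' = (\<lambda>r. (\<lambda>z. (fst z div p, snd z)) ` {b \<in> B. fst b mod p = r})"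
  have memA: "(c + p ^ m * t, y) \<in> A" if cy: "(c, y) \<in> A'" "t < p" for c y t
  proof -
    obtain z where z: "z \<in> A" "c = fst z mod p ^ m" "y = snd z" using cy(1) unfolding A'_def by blast
    define x where "x = fst z"
    have x: "(x, y) \<in> A" "c = x mod p ^ m" using z unfolding x_def by simp_all
    have "c + p ^ m * t < p ^ m + p ^ m * t" using x(2) p0 by simp
    also have "\<dots> = p ^ m * Suc t" by simp
    also have "\<dots> \<le> p ^ m * p" using that(2) by (intro mult_le_mono2) simp
    finally have "c + p ^ m * t < p ^ Suc m" by (simp add: mult.commute)
    then show ?thesis using inv[OF x(1)] x(2) by simp
  qed
  have A's: "A' \<subseteq> {..<p ^ m} \<times> {..<q ^ n}" using D(1) p0 unfolding A'_def by auto
  have cnA: "cn p q A i j x y = p * cn p q A' i j x y" if i: "i \<le> m" for i j x y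
  proof -
    have e: "cl p q A i j x y = (\<lambda>((c, y), t). (c + p ^ m * t, y)) ` (cl p q A' i j x y \<times> {..<p})" (is "?L = ?f ` ?R")
    proof (intro equalityI subsetI)
      fix z assume z: "z \<in> ?L"
      have "fst z < p ^ Suc m" using z D(1) unfolding cl_def by auto
      then have "fst z div p ^ m < p" by (simp add: less_mult_imp_div_less mult.commute)
      moreover have "(fst z mod p ^ m, snd z) \<in> cl p q A' i j x y"
        using z i unfolding cl_def A'_def by (auto simp: mod_mod_cancel le_imp_power_dvd)
      moreover have "z = ?f ((fst z mod p ^ m, snd z), fst z div p ^ m)" by simp
      ultimately show "z \<in> ?f ` ?R" by (intro image_eqI[of _ _ "((fst z mod p ^ m, snd z), fst z div p ^ m)"]) auto
    next
      fix z assume "z \<in> ?f ` ?R"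
      then obtain c y' t where z: "z = (c + p ^ m * t, y')" "(c, y') \<in> cl p q A' i j x y" "t < p" by auto
      have "(c + p ^ m * t) mod p ^ i = c mod p ^ i"
        using mod_pow_mono[of "c + p ^ m * t" p m c i] i by simp
      then show "z \<in> ?L" using z memA[of c y' t] unfolding cl_def by auto
    qed
    have "inj_on ?f ?R"
    proof (rule inj_onI)
      fix a b assume ab: "a \<in> ?R" "b \<in> ?R" "?f a = ?f b"
      obtain c y1 t d y2 s where eq: "a = ((c, y1), t)" "b = ((d, y2), s)" by (metis surj_pair)
      have lt: "c < p ^ m" "d < p ^ m" using ab A's eq unfolding cl_def by auto
      have e2: "c + p ^ m * t = d + p ^ m * s" "y1 = y2" using ab(3) eq by auto
      have "(c + p ^ m * t) mod p ^ m = (d + p ^ m * s) mod p ^ m" using e2 by simp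
      then have "c = d" using lt by simp
      then show "a = b" using e2 eq p0 by simp
    qed
    then have "card ?L = card ?R" unfolding e by (rule card_image)
    then show ?thesis unfolding cn_def by (simp add: card_cartesian_product)
  qed
  have cA: "card A = p * card A'" using cnA[of 0 0 0 0] unfolding cn_def cl_def by simp
  have finA': "finite A'" using fin unfolding A'_def by simp
  have B_rep: "fst b = r + p * (fst b div p)" if "fst b mod p = r" for b :: "nat \<times> nat" and r using that by (metis add.commute mult_div_mod_eq)
  have cnB: "cn p q (B' r) i j x y = cn p q B (Suc i) j (r + p * x) y" if "r < p" for r i j x y
  proof -
    have key: "fst b mod p = r \<and> fst b div p mod p ^ i = x mod p ^ i \<longleftrightarrow> fst b mod p ^ Suc i = (r + p * x) mod p ^ Suc i" for b :: "nat \<times> nat"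
    proof
      assume a: "fst b mod p = r \<and> fst b div p mod p ^ i = x mod p ^ i"
      show "fst b mod p ^ Suc i = (r + p * x) mod p ^ Suc i"
        unfolding power_Suc mod_mult2_eq using a that p0 by simp
    next
      assume a: "fst b mod p ^ Suc i = (r + p * x) mod p ^ Suc i"
      have d: "dg p v (fst b) = dg p v (r + p * x)" if "v < Suc i" for v using a that unfolding mod_eq_dg by blast
      have 1: "fst b mod p = r" using d[of 0] dg_add(1)[OF p0(1), of r x] that by (simp add: dg_def)
      have "dg p v (fst b div p) = dg p v x" if "v < i" for v
      proof -
        have "dg p v (fst b div p) = dg p (Suc v) (fst b)" unfolding dg_def by (simp add: div_mult2_eq)
        then show ?thesis using d[of "Suc v"] dg_add(2)[OF p0(1) \<open>r < p\<close>, of v x] that by simp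
      qed
      then show "fst b mod p = r \<and> fst b div p mod p ^ i = x mod p ^ i" using 1 unfolding mod_eq_dg[of _ p i] by blast
    qed
    have "cl p q (B' r) i j x y = (\<lambda>z. (fst z div p, snd z)) ` cl p q B (Suc i) j (r + p * x) y"
      unfolding cl_def B'_def key[symmetric] by auto
    moreover have "inj_on (\<lambda>z. (fst z div p, snd z)) (cl p q B (Suc i) j (r + p * x) y)"
    proof (rule inj_onI)
      fix a b assume ab: "a \<in> cl p q B (Suc i) j (r + p * x) y" "b \<in> cl p q B (Suc i) j (r + p * x) y" "(fst a div p, snd a) = (fst b div p, snd b)"
      have "fst a mod p = r" "fst b mod p = r" using ab key unfolding cl_def by blast+
      then have "fst a = fst b" using B_rep[of a r] B_rep[of b r] ab(3) by simp
      then show "a = b" using ab(3) by (simp add: prod_eq_iff)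
    qed
    ultimately show ?thesis unfolding cn_def by (simp add: card_image)
  qed
  obtain xy where xy: "xy \<in> A'" using D(3) unfolding A'_def by blast
  have lvA: "lv p (Suc m) (c + p ^ m * t) (d + p ^ m * s) = lv p m c d" if "lv p m c d < m" for c d t s
  proof (rule lv_dgI)
    show "lv p m c d < Suc m" using that by simp
    have e: "dg p u (e + p ^ m * t') = dg p u e" if "u < m" for u e t' using mod_eq_dg[of "e + p ^ m * t'" p m e] that by simp
    show "dg p u (c + p ^ m * t) = dg p u (d + p ^ m * s)" if "u < lv p m c d" for u
      using that e[of u] lv_dg_eq[OF that] \<open>lv p m c d < m\<close> by simp
    show "dg p (lv p m c d) (c + p ^ m * t) \<noteq> dg p (lv p m c d) (d + p ^ m * s)"
      using e[of "lv p m c d"] lv_dg_neq[OF that] that by simp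
  qed
  have lvtop: "lv p (Suc m) (c + p ^ m * 0) (c + p ^ m * 1) = m" if "c < p ^ m" for c
  proof (rule lv_eqI)
    have "c + p ^ m * 1 < p ^ Suc m" 
    proof -
      have "c + p ^ m * 1 < p ^ m * 2" using that by simp
      also have "\<dots> \<le> p ^ m * p" using p0 by (intro mult_le_mono2) simp
      finally show ?thesis by (simp add: mult.commute)
    qed
    moreover have "c + p ^ m * 0 < p ^ Suc m" using calculation by simp
    ultimately show "(c + p ^ m * 0) mod p ^ Suc m \<noteq> (c + p ^ m * 1) mod p ^ Suc m" using p0 by (simp del: power_Suc)
  qed simp_all
  \<comment> \<open>Two points of one fibre of the quotient differ in the top digit only, by an
    element of order \<open>p\<close>. The resulting zero makes the parts of \<open>B\<close> equal
    in size.\<close>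
  have zB1: "zr p q B 1 0"
  proof -
    obtain c y where c: "(c, y) \<in> A'" using xy by (metis surj_pair)
    have cl: "c < p ^ m" using c A's by auto
    have "zr p q B (Suc m - lv p (Suc m) (c + p ^ m * 0) (c + p ^ m * 1)) (n - lv q n y y)"
      using D(6)[OF memA[OF c, of 0] memA[OF c, of 1]] p0 by simp
    then show ?thesis unfolding lvtop[OF cl] by simp
  qed
  have cB': "card (B' r) = card A'" if r: "r < p" for r
  proof -
    have e: "cn p q B 1 0 t 0 = cn p q B 1 0 r 0" for t using zB1 by simp
    have "card B = cn p q B 0 0 0 0" unfolding cn_def cl_def by simp
    also have "\<dots> = (\<Sum>t<p. cn p q B 1 0 r 0)"
      unfolding cn_split_p[OF fin(2) p0(1), of q 0 0 0 0] One_nat_def by (rule sum.cong[OF refl]) (rule e[unfolded One_nat_def])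
    finally have "card B = p * cn p q B 1 0 r 0" by simp
    then have "p * cn p q B 1 0 r 0 = p * card A'" using D(4) cA by linarith
    then have "cn p q B 1 0 r 0 = card A'" using p0 by simp
    moreover have "card (B' r) = cn p q (B' r) 0 0 0 0" unfolding cn_def cl_def by simp
    ultimately show ?thesis using cnB[OF r, of 0 0 0 0] by simp
  qed
  have sp': "spair p q m n A' (B' r)" if r: "r < p" for r
    unfolding spair_def
  proof (intro conjI ballI impI A's)
    show "B' r \<subseteq> {..<p ^ m} \<times> {..<q ^ n}"
      using D(2) unfolding B'_def by (auto simp: less_mult_imp_div_less mult.commute)
    show "A' \<noteq> {}" using xy by blast
    show "card A' = card (B' r)" using cB'[OF r] by simp
  next
    fix c c' assume "c \<in> B' r" "c' \<in> B' r" "c \<noteq> c'"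
    then obtain b b' where b: "b \<in> B" "b' \<in> B" "fst b mod p = r" "fst b' mod p = r" "c = (fst b div p, snd b)" "c' = (fst b' div p, snd b')"
      unfolding B'_def by blast
    have "b \<noteq> b'" using b \<open>c \<noteq> c'\<close> by auto
    have l: "lv p (Suc m) (fst b) (fst b') = Suc (lv p m (fst c) (fst c'))"
      using lv_step[OF p0(1) r r, of m "fst b div p" "fst b' div p"] B_rep[OF b(3)] B_rep[OF b(4)] b(5,6) by simp
    have z: "zr p q A (m - lv p m (fst c) (fst c')) (n - lv q n (snd c) (snd c'))"
      using D(5)[OF b(1,2) \<open>b \<noteq> b'\<close>] l b(5,6) by simp
    have c: "cn p q A i' j' x y = p * cn p q A' i' j' x y" if "i' \<le> m - lv p m (fst c) (fst c')" for i' j' x y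
      by (rule cnA) (use that in simp)
    let ?i = "m - lv p m (fst c) (fst c')" and ?j = "n - lv q n (snd c) (snd c')"
    show "zr p q A' ?i ?j"
    proof (cases ?i)
      case i0: 0
      then obtain j' where j': "?j = Suc j'" using z by (cases ?j) auto
      have c0: "cn p q A 0 j x y = p * cn p q A' 0 j x y" for j x y by (rule cnA) simp
      show ?thesis unfolding i0 j' zr.simps
      proof (intro allI impI)
        fix y y' assume "y mod q ^ j' = y' mod q ^ j'"
        then have "p * cn p q A' 0 (Suc j') 0 y = p * cn p q A' 0 (Suc j') 0 y'"
          using z unfolding i0 j' zr.simps c0 by blast
        then show "cn p q A' 0 (Suc j') 0 y = cn p q A' 0 (Suc j') 0 y'" using p0 by simp
      qed
    next
      case i: (Suc i')
      have ci: "cn p q A (Suc i') j x y = p * cn p q A' (Suc i') j x y" for j x y using c[unfolded i] by blast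
      show ?thesis
      proof (cases ?j)
        case 0
        show ?thesis unfolding i 0 zr.simps
        proof (intro allI impI)
          fix x x' assume "x mod p ^ i' = x' mod p ^ i'"
          then have "p * cn p q A' (Suc i') 0 x 0 = p * cn p q A' (Suc i') 0 x' 0"
            using z unfolding i 0 zr.simps ci by blast
          then show "cn p q A' (Suc i') 0 x 0 = cn p q A' (Suc i') 0 x' 0" using p0 by simp
        qed
      next
        case (Suc j')
        let ?c = "cn p q A' (Suc i') (Suc j')"
        show ?thesis unfolding i Suc zr.simps
        proof (intro allI impI)
          fix x x' y y' assume "x mod p ^ i' = x' mod p ^ i'" "y mod q ^ j' = y' mod q ^ j'"
          then have "p * (?c x y + ?c x' y') = p * (?c x y' + ?c x' y)"
            using z unfolding i Suc zr.simps ci distrib_left[symmetric] by blast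
          then show "?c x y + ?c x' y' = ?c x y' + ?c x' y" using p0 by simp
        qed
      qed
    qed
  next
    fix c c' assume c: "c \<in> A'" "c' \<in> A'" "c \<noteq> c'"
    let ?v = "lv p m (fst c) (fst c')" and ?j = "n - lv q n (snd c) (snd c')"
    have mem: "(fst c + p ^ m * t, snd c) \<in> A" "(fst c' + p ^ m * t, snd c') \<in> A" if "t < p" for t using c memA that by simp_all
    have vm: "?v \<le> m" by (rule lv_le)
    show "zr p q (B' r) (m - ?v) ?j"
    proof (cases "?v < m")
      case True
      then have l: "lv p (Suc m) (fst c + p ^ m * 0) (fst c' + p ^ m * 0) = ?v" by (rule lvA)
      have "zr p q B (Suc m - lv p (Suc m) (fst c + p ^ m * 0) (fst c' + p ^ m * 0)) ?j"
        using D(6)[OF mem(1)[of 0] mem(2)[of 0]] c(3) p0 by (auto simp: prod_eq_iff)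
      then have z: "zr p q B (Suc (m - ?v)) ?j" unfolding l using vm by (simp add: Suc_diff_le)
      obtain i where i: "m - ?v = Suc i" using True by (metis Suc_diff_Suc)
      have par: "(r + p * x) mod p ^ Suc i = (r + p * x') mod p ^ Suc i" if "x mod p ^ i = x' mod p ^ i" for x x'
      proof -
        have "int (p ^ i) dvd int x - int x'" using that nat_mod_eq_int_dvd by blast
        then have "int p * int (p ^ i) dvd int p * (int x - int x')" by (intro mult_dvd_mono) auto
        then have "int (p ^ Suc i) dvd int (r + p * x) - int (r + p * x')" by (simp add: right_diff_distrib)
        then show ?thesis using nat_mod_eq_int_dvd by blast
      qed
      show ?thesis
      proof (cases ?j)
        case 0 
        show ?thesis unfolding i 0 zr.simps cnB[OF r] using z[unfolded i 0 zr.simps] par by blast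
      next
        case (Suc j')
        show ?thesis unfolding i Suc zr.simps cnB[OF r] using z[unfolded i Suc zr.simps] par by blast
      qed
    next
      case False
      then have v: "?v = m" using vm by simp
      have "fst c < p ^ m" "fst c' < p ^ m" using c(1,2) A's by auto
      then have fe: "fst c = fst c'" using v lv_eq_iff[of "fst c" p m "fst c'"] by simp
      then have sne: "snd c \<noteq> snd c'" using c(3) by (auto simp: prod_eq_iff)
      have cl: "fst c < p ^ m" using c A's by auto
      have "zr p q B (Suc m - lv p (Suc m) (fst c + p ^ m * 0) (fst c' + p ^ m * 0)) ?j"
        using D(6)[OF mem(1)[of 0] mem(2)[of 0]] sne c(3) p0 by simp
      then have z0: "zr p q B 0 ?j" using fe by simp
      have "zr p q B (Suc m - lv p (Suc m) (fst c + p ^ m * 0) (fst c' + p ^ m * 1)) ?j"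
        using D(6)[OF mem(1)[of 0] mem(2)[of 1]] sne p0 by (auto simp: prod_eq_iff)
      then have z1: "zr p q B (Suc 0) ?j" using fe lvtop[OF cl] by simp
      obtain j where j: "?j = Suc j" using z0 by (cases ?j) auto
      \<comment> \<open>The mixed zero \<open>z1\<close> says that passing from \<open>y\<close> to
        \<open>y'\<close> changes the count by the same amount for every lowest digit; the pure zero
        \<open>z0\<close> says that these changes add up to zero.\<close>
      have "cn p q B (Suc 0) (Suc j) r y = cn p q B (Suc 0) (Suc j) r y'" if y: "y mod q ^ j = y' mod q ^ j" for y y'
      proof -
        have d: "cn p q B (Suc 0) (Suc j) r y + cn p q B (Suc 0) (Suc j) t y' = cn p q B (Suc 0) (Suc j) r y' + cn p q B (Suc 0) (Suc j) t y" for t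
          using z1[unfolded j zr.simps] y by simp
        have s: "cn p q B 0 (Suc j) 0 y = (\<Sum>t<p. cn p q B (Suc 0) (Suc j) t y)" for y
          using cn_split_p[OF fin(2) p0(1), of q 0 "Suc j" 0 y] by simp
        have "(\<Sum>t<p. cn p q B (Suc 0) (Suc j) r y + cn p q B (Suc 0) (Suc j) t y') =
              (\<Sum>t<p. cn p q B (Suc 0) (Suc j) r y' + cn p q B (Suc 0) (Suc j) t y)"
          by (rule sum.cong[OF refl]) (rule d)
        then have "p * cn p q B (Suc 0) (Suc j) r y + (\<Sum>t<p. cn p q B (Suc 0) (Suc j) t y') =
              p * cn p q B (Suc 0) (Suc j) r y' + (\<Sum>t<p. cn p q B (Suc 0) (Suc j) t y)"
          by (simp add: sum.distrib)
        moreover have "cn p q B 0 (Suc j) 0 y = cn p q B 0 (Suc j) 0 y'" using z0[unfolded j zr.simps] y by blast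
        ultimately have "p * cn p q B (Suc 0) (Suc j) r y = p * cn p q B (Suc 0) (Suc j) r y'" unfolding s by linarith
        then show ?thesis using p0 by simp
      qed
      then show ?thesis unfolding v j diff_self_eq_0 zr.simps cnB[OF r] mult_0_right add_0_right by blast
    qed
  qed
  have "\<forall>r<p. \<exists>K L. ext p q m n (B' r) K L \<and> ext p q m n A' (flip m K) (flip n L)"
    using IH[OF sp'] unfolding good_def by blast
  then obtain Kf Lf where KL: "\<And>r. r < p \<Longrightarrow> ext p q m n (B' r) (Kf r) (Lf r)" "\<And>r. r < p \<Longrightarrow> ext p q m n A' (flip m (Kf r)) (flip n (Lf r))"
    by metis
  define K L where "K = Kf 0" and "L = Lf 0"
  have sub: "Kf r \<subseteq> {..<m}" "Lf r \<subseteq> {..<n}" if "r < p" for r using KL(1)[OF that] unfolding ext_def by auto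
  have eqK: "Kf r = K" if r: "r < p" for r
  proof -
    have "v \<in> flip m (Kf r) \<longleftrightarrow> v \<in> flip m K" for v
    proof (cases "v < m")
      case True
      then show ?thesis using ext_zr_iff[OF KL(2)[OF r] pr True] ext_zr_iff[OF KL(2)[OF p0(1)] pr True] unfolding K_def by simp
    qed (simp add: flip_def)
    then have "flip m (Kf r) = flip m K" by blast
    then show ?thesis using flip_rf sub r p0(1) unfolding K_def by metis
  qed
  have eqL: "Lf r = L" if r: "r < p" for r
  proof -
    have "v \<in> flip n (Lf r) \<longleftrightarrow> v \<in> flip n L" for v
    proof (cases "v < n")
      case True
      then show ?thesis using ext_zr_iff_q[OF KL(2)[OF r] pr True] ext_zr_iff_q[OF KL(2)[OF p0(1)] pr True] unfolding L_def by simp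
    qed (simp add: flip_def)
    then have "flip n (Lf r) = flip n L" by blast
    then show ?thesis using flip_rf sub r p0(1) unfolding L_def by metis
  qed
  have eB': "ext p q m n (B' r) K L" if "r < p" for r using KL(1)[OF that] eqK[OF that] eqL[OF that] by simp
  have eA': "ext p q m n A' (flip m K) (flip n L)" using KL(2)[OF p0(1)] unfolding K_def L_def .
  have KLs: "K \<subseteq> {..<m}" "L \<subseteq> {..<n}" using eB'[OF p0(1)] unfolding ext_def by auto
  \<comment> \<open>Level 0 separates the parts of \<open>B\<close>; within a part all levels move
    up by one.\<close>
  define K' where "K' = insert 0 (Suc ` K)"
  have K's: "K' \<subseteq> {..<Suc m}" using KLs unfolding K'_def by auto
  have fK: "finite K" using KLs finite_subset by blast
  have cK: "card K' = Suc (card K)" unfolding K'_def using fK by (simp add: card_image)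
  have eB: "ext p q (Suc m) n B K' L"
    unfolding ext_def
  proof (intro conjI ballI impI K's KLs(2) D(2))
    show "card B = p ^ card K' * q ^ card L" using eB'[OF p0(1)] cB'[OF p0(1)] cA D(4) cK unfolding ext_def by simp
    fix b b' assume b: "b \<in> B" "b' \<in> B" "b \<noteq> b'"
    define r r' where "r = fst b mod p" and "r' = fst b' mod p"
    have rp: "r < p" "r' < p" using p0 unfolding r_def r'_def by auto
    have l: "lv p (Suc m) (fst b) (fst b') = (if r = r' then Suc (lv p m (fst b div p) (fst b' div p)) else 0)"
      using lv_step[OF p0(1) rp, of m "fst b div p" "fst b' div p"] B_rep[of b r] B_rep[of b' r'] unfolding r_def r'_def by simp
    show "lv p (Suc m) (fst b) (fst b') \<in> K' \<or> lv q n (snd b) (snd b') \<in> L"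
    proof (cases "r = r'")
      case True
      have m: "(fst b div p, snd b) \<in> B' r" "(fst b' div p, snd b') \<in> B' r" using b True unfolding B'_def r_def r'_def by auto
      have "(fst b div p, snd b) \<noteq> (fst b' div p, snd b')"
      proof
        assume e: "(fst b div p, snd b) = (fst b' div p, snd b')"
        then have "fst b = fst b'" using B_rep[of b r] B_rep[of b' r] True unfolding r_def r'_def by simp
        then show False using e b(3) by (simp add: prod_eq_iff)
      qed
      then have "lv p m (fst b div p) (fst b' div p) \<in> K \<or> lv q n (snd b) (snd b') \<in> L"
        using extD[OF eB'[OF rp(1)] m] by simp
      then show ?thesis using l True unfolding K'_def by auto
    qed (use l in \<open>simp add: K'_def\<close>)
  qed
  have eA: "ext p q (Suc m) n A (flip (Suc m) K') (flip n L)"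
    unfolding ext_def
  proof (intro conjI ballI impI flip_sub D(1))
    show "card A = p ^ card (flip (Suc m) K') * q ^ card (flip n L)"
      using eB D(4) unfolding ext_def card_rf[OF K's] card_rf[OF KLs(2)] by simp
    fix b b' assume b: "b \<in> A" "b' \<in> A" "b \<noteq> b'"
    let ?v = "lv p (Suc m) (fst b) (fst b')"
    have vm: "?v \<le> Suc m" by (rule lv_le)
    define c c' where "c = (fst b mod p ^ m, snd b)" and "c' = (fst b' mod p ^ m, snd b')"
    have cm: "c \<in> A'" "c' \<in> A'" using b unfolding A'_def c_def c'_def by auto
    have bd: "fst b = fst c + p ^ m * (fst b div p ^ m)" "fst b' = fst c' + p ^ m * (fst b' div p ^ m)" unfolding c_def c'_def by auto
    show "?v \<in> flip (Suc m) K' \<or> lv q n (snd b) (snd b') \<in> flip n L"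
    proof (cases "c = c'")
      case True
      then have s: "snd b = snd b'" "fst b mod p ^ m = fst b' mod p ^ m" unfolding c_def c'_def by auto
      have mv: "m \<le> ?v" using s(2) by (subst lv_iff) auto
      have "fst b \<noteq> fst b'" using b(3) s by (auto simp: prod_eq_iff)
      moreover have "fst b < p ^ Suc m" "fst b' < p ^ Suc m" using b(1,2) D(1) by auto
      ultimately have "?v \<noteq> Suc m" using lv_eq_iff[of "fst b" p "Suc m" "fst b'"] by blast
      then have "?v = m" using vm mv by simp
      then show ?thesis unfolding flip_def K'_def by simp
    next
      case False
      then have k: "lv p m (fst c) (fst c') \<in> flip m K \<or> lv q n (snd b) (snd b') \<in> flip n L"
        using extD[OF eA' cm] unfolding c_def c'_def by simp
      show ?thesis
      proof (cases "lv p m (fst c) (fst c') \<in> flip m K")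
        case True
        then have l: "lv p m (fst c) (fst c') < m" "m - 1 - lv p m (fst c) (fst c') \<in> K" unfolding flip_def by auto
        have "?v = lv p m (fst c) (fst c')" using lvA[OF l(1), of "fst b div p ^ m" "fst b' div p ^ m"] bd by simp
        moreover have "m - lv p m (fst c) (fst c') = Suc (m - 1 - lv p m (fst c) (fst c'))" using l by simp
        ultimately have "?v \<in> flip (Suc m) K'" using l unfolding flip_def K'_def by simp
        then show ?thesis ..
      qed (use k in simp)
    qed
  qed
  show ?thesis unfolding good_def using eA eB by blast
qed

section \<open>Irreducible spectral pairs\<close>

lemma cn_le_split:
  assumes "finite S" "p > 0" "\<And>x'. x' mod p ^ i = x mod p ^ i \<Longrightarrow> cn p q S (i + d) j x' y \<le> N"
  shows "cn p q S i j x y \<le> p ^ d * N"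
  using assms(3)
proof (induction d arbitrary: N)
  case (Suc d)
  have "cn p q S (i + d) j x' y \<le> p * N" if "x' mod p ^ i = x mod p ^ i" for x'
  proof -
    have "cn p q S (i + d) j x' y \<le> (\<Sum>t<p. N)"
      unfolding cn_split_p[OF assms(1,2), of q "i + d" j x' y]
    proof (rule sum_mono)
      fix t
      have "(x' mod p ^ (i + d) + p ^ (i + d) * t) mod p ^ (i + d) = x' mod p ^ (i + d)" by simp
      then have "(x' mod p ^ (i + d) + p ^ (i + d) * t) mod p ^ i = x' mod p ^ i" by (rule mod_pow_mono) simp
      then show "cn p q S (Suc (i + d)) j (x' mod p ^ (i + d) + p ^ (i + d) * t) y \<le> N"
        using Suc.prems[of "x' mod p ^ (i + d) + p ^ (i + d) * t"] that by simp
    qed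
    then show ?thesis by simp
  qed
  from Suc.IH[OF this] show ?case by (simp add: mult.assoc mult.left_commute)
qed simp

lemma cn_pos_iff: "finite S \<Longrightarrow> cn p q S i j x y > 0 \<longleftrightarrow> (\<exists>z\<in>S. fst z mod p ^ i = x mod p ^ i \<and> snd z mod q ^ j = y mod q ^ j)"
proof -
  assume "finite S"
  then have "cn p q S i j x y > 0 \<longleftrightarrow> cl p q S i j x y \<noteq> {}" unfolding cn_def using cl_fin card_gt_0_iff by blast
  then show ?thesis unfolding cl_def by blast
qed

lemma cn_mono: "finite S \<Longrightarrow> i \<le> i' \<Longrightarrow> j \<le> j' \<Longrightarrow> cn p q S i' j' x y \<le> cn p q S i j x y"
  unfolding cn_def cl_def by (intro card_mono) (auto intro: mod_pow_mono)

text \<open>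
  The elements of \<open>A\<close> form a tree under their \<open>p\<close>-digits; a node at depth \<open>k\<close> is concentrated (\<open>conc\<close>)
  if its elements agree modulo \<open>q\<close>, otherwise it is spread. Going down this tree, the quotients of \<open>B\<close>
  by the subgroups of order \<open>p ^ k\<close>, with fibre counts \<open>f k\<close>, are followed until the first depth \<open>s\<close>
  at which they become invariant under the subgroup of order \<open>q\<close>. Depths in \<open>G\<close> are gaps: there a spread
  node does not branch. All other depths below \<open>s\<close> give zeros of the Fourier transform of \<open>A\<close>.
\<close>

locale chain =
  fixes p q m n :: nat and A B :: "(nat \<times> nat) set"
  assumes sp: "spair p q m n A B" and pr: "prime p" "prime q" "p \<noteq> q" and n0: "n > 0"
    and notinv: "\<exists>x y y'. y mod q ^ (n - 1) = y' mod q ^ (n - 1) \<and> cn p q B m n x y \<noteq> cn p q B m n x y'"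
    and zA01: "zr p q A 0 1" and zBmn: "zr p q B m n"
    and lev: "\<And>v. v < m \<Longrightarrow> \<exists>z\<in>A. \<exists>z'\<in>A. lv p m (fst z) (fst z') = v"
begin

definition f where "f k x y = cn p q B (m - k) n x y"
definition G where "G = {k. \<not> zr p q B (m - k) n}"
text \<open>On the way down, spread nodes split evenly at depths outside \<open>G\<close> and not at
  all at gaps, so \<open>p ^ rho k\<close> is the factor by which a spread node at depth
  \<open>k\<close> has shrunk.\<close>

definition rho where "rho k = card ({..<k} - G)"
text \<open>The relevant cosets of the subgroup of order \<open>q\<close>, at a fixed first
  coordinate, are called columns below; invariance under that subgroup is constancy of the counts on
  all columns.\<close>

definition const where "const k x y \<longleftrightarrow> (\<forall>y'. y' mod q ^ (n - 1) = y mod q ^ (n - 1) \<longrightarrow> f k x y' = f k x y)"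
definition qinv where "qinv k \<longleftrightarrow> (\<forall>x y. const k x y)"
definition node where "node k c = cl p q A k 0 c 0"
definition conc where "conc k c \<longleftrightarrow> (\<exists>e. \<forall>z\<in>node k c. snd z mod q = e)"
abbreviation M where "M \<equiv> card A"

lemmas D = spairD[OF sp]
lemmas fin = spair_finite[OF sp]

lemma p0: "p > 0" "q > 0" "p \<ge> 2" "q \<ge> 2" "M > 0" "card B = M"
  using pr prime_gt_0_nat prime_ge_2_nat spair_pos[OF sp] D(4) by auto

lemma q_not_dvd: "\<not> q dvd p ^ r"
  using pr by (metis prime_dvd_power primes_dvd_imp_eq)

lemma node_iff: "z \<in> node k c \<longleftrightarrow> z \<in> A \<and> fst z mod p ^ k = c mod p ^ k"
  unfolding node_def cl_def by simp

lemma card_node: "card (node k c) = cn p q A k 0 c 0"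
  unfolding node_def cn_def by simp

lemma fin_node: "finite (node k c)" unfolding node_def using fin cl_fin by blast

lemma node_cong: "c mod p ^ k = c' mod p ^ k \<Longrightarrow> node k c = node k c'"
  unfolding node_def cl_def by simp

lemma conc_cong: "c mod p ^ k = c' mod p ^ k \<Longrightarrow> conc k c = conc k c'"
  unfolding conc_def using node_cong by metis

lemma node_Suc_sub: "node (Suc k) c \<subseteq> node k c"
proof
  fix z assume "z \<in> node (Suc k) c"
  then have z: "z \<in> A" "fst z mod p ^ Suc k = c mod p ^ Suc k" by (simp_all add: node_iff del: power_Suc)
  from z(2) have "fst z mod p ^ k = c mod p ^ k" by (rule mod_pow_mono) simp
  then show "z \<in> node k c" using z(1) by (simp add: node_iff)
qed

lemma conc_Suc: "conc k c \<Longrightarrow> conc (Suc k) c"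
  unfolding conc_def using node_Suc_sub by blast

lemma rho_Suc: "rho (Suc k) = (if k \<in> G then rho k else Suc (rho k))"
proof (cases "k \<in> G")
  case True
  then have "{..<Suc k} - G = {..<k} - G" by (auto simp: less_Suc_eq)
  then show ?thesis using True unfolding rho_def by simp
next
  case False
  then have "{..<Suc k} - G = insert k ({..<k} - G)" by (auto simp: less_Suc_eq)
  then show ?thesis using False unfolding rho_def by simp
qed

lemma lvq_0_iff: "lv q n y y' = 0 \<longleftrightarrow> y mod q \<noteq> y' mod q"
  using lv_iff[of 1 n q y y'] n0 by auto

text \<open>Elements of different children with different residues modulo \<open>q\<close> would
  produce the zero of \<open>B\<close> that a gap excludes. So elements of different children agree
  modulo \<open>q\<close>, and an element of another residue, which a spread node contains, would
  have to share a child with both.\<close>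

lemma two_color:
  assumes k: "k \<in> G" "k < m" and s: "\<not> conc k c" and z: "z \<in> node k c" "z' \<in> node k c"
  shows "fst z mod p ^ Suc k = fst z' mod p ^ Suc k"
proof (rule ccontr)
  assume ne: "fst z mod p ^ Suc k \<noteq> fst z' mod p ^ Suc k"
  have bad: "snd u mod q = snd w mod q" if "u \<in> node k c" "w \<in> node k c" "fst u mod p ^ Suc k \<noteq> fst w mod p ^ Suc k" for u w
  proof (rule ccontr)
    assume q: "snd u mod q \<noteq> snd w mod q"
    have l: "lv p m (fst u) (fst w) = k" using that k(2) by (intro lv_eqI) (auto simp: node_iff)
    have l2: "lv q n (snd u) (snd w) = 0" using q lvq_0_iff by blast
    have "u \<noteq> w" using q by auto
    then have "zr p q B (m - k) (n - 0)" using D(6)[of u w] that l l2 by (simp add: node_iff)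
    then show False using k(1) unfolding G_def by simp
  qed
  obtain w where w: "w \<in> node k c" "snd w mod q \<noteq> snd z mod q" using s unfolding conc_def by blast
  have "fst w mod p ^ Suc k = fst z mod p ^ Suc k" using bad[OF w(1) z(1)] w(2) by blast
  then have "snd w mod q = snd z' mod q" using bad[OF w(1) z(2)] ne by metis
  moreover have "snd z mod q = snd z' mod q" using bad[OF z ne] .
  ultimately show False using w(2) by simp
qed

section \<open>Invariants of the walk\<close>

lemma spread_leaf: "\<not> conc m c \<Longrightarrow> zr p q B 0 n"
proof -
  assume "\<not> conc m c"
  then obtain z w where zw: "z \<in> node m c" "w \<in> node m c" "snd z mod q \<noteq> snd w mod q" unfolding conc_def by metis
  then have "lv p m (fst z) (fst w) = m" using lv_iff[of m m p "fst z" "fst w"] lv_le[of p m "fst z" "fst w"] by (simp add: node_iff)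
  moreover have "lv q n (snd z) (snd w) = 0" using zw lvq_0_iff by blast
  moreover have "z \<noteq> w" using zw by auto
  ultimately show ?thesis using D(6)[of z w] zw by (simp add: node_iff)
qed

text \<open>The three invariants support one another: \<open>conc_dvd\<close> guarantees that a
  spread node is left, its mass by \<open>spread_mass\<close> bounds the fibre counts of
  \<open>B\<close>, and \<open>nonconst_01\<close> says that a column that is not constant reaches
  this bound, which determines its siblings.\<close>

definition spread_mass where "spread_mass k \<longleftrightarrow> (\<forall>c. \<not> conc k c \<longrightarrow> card (node k c) * p ^ rho k = M)"
definition conc_dvd where "conc_dvd k \<longleftrightarrow> (\<forall>c e. M dvd p ^ rho k * card {z \<in> A. fst z mod p = c \<and> snd z mod q = e \<and> conc k (fst z)})"
definition nonconst_01 where "nonconst_01 k \<longleftrightarrow> (\<forall>x y. \<not> const k x y \<longrightarrow> (\<forall>y'. y' mod q ^ (n - 1) = y mod q ^ (n - 1) \<longrightarrow> f k x y' \<in> {0, p ^ rho k}))"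

lemma class_q: "q * cn p q A 0 1 0 e = M"
proof -
  have "M = cn p q A 0 0 0 0" unfolding cn_def cl_def by simp
  also have "\<dots> = (\<Sum>t<q. cn p q A 0 (Suc 0) 0 t)" using cn_split_q[OF fin(1) p0(2), of p 0 0 0 0] by simp
  also have "\<dots> = (\<Sum>t<q. cn p q A 0 1 0 e)"
    by (rule sum.cong[OF refl]) (use zA01[unfolded One_nat_def zr.simps] in auto)
  finally show ?thesis by simp
qed

text \<open>If all nodes were concentrated, a class modulo \<open>q\<close>, of size
  \<open>M / q\<close>, would be composed of concentrated masses, and \<open>q\<close> would divide
  a power of \<open>p\<close>.\<close>

lemma spread_exists:
  assumes "conc_dvd k" shows "\<exists>z\<in>A. \<not> conc k (fst z)"
proof (rule ccontr)
  assume "\<not> ?thesis"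
  then have all: "conc k (fst z)" if "z \<in> A" for z using that by blast
  have "cl p q A 0 1 0 0 = (\<Union>c<p. {z \<in> A. fst z mod p = c \<and> snd z mod q = 0 \<and> conc k (fst z)})"
    using all p0 unfolding cl_def by auto
  then have "cn p q A 0 1 0 0 = card (\<Union>c<p. {z \<in> A. fst z mod p = c \<and> snd z mod q = 0 \<and> conc k (fst z)})" unfolding cn_def by simp
  also have "\<dots> = (\<Sum>c<p. card {z \<in> A. fst z mod p = c \<and> snd z mod q = 0 \<and> conc k (fst z)})"
    by (rule card_UN_disjoint) (use fin in auto)
  finally have "p ^ rho k * cn p q A 0 1 0 0 = (\<Sum>c<p. p ^ rho k * card {z \<in> A. fst z mod p = c \<and> snd z mod q = 0 \<and> conc k (fst z)})"
    by (simp add: sum_distrib_left)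
  then have "M dvd p ^ rho k * cn p q A 0 1 0 0" using assms unfolding conc_dvd_def by (simp add: dvd_sum)
  then have "q * cn p q A 0 1 0 0 dvd p ^ rho k * cn p q A 0 1 0 0" unfolding class_q .
  moreover have "cn p q A 0 1 0 0 > 0" using class_q[of 0] p0(5) by (metis gr0I mult_0_right)
  ultimately have "q dvd p ^ rho k" by simp
  then show False using q_not_dvd by blast
qed

text \<open>A spread node of mass \<open>M / p ^ rho k\<close> exists, and its product with a dual
  class of \<open>B\<close> is at most \<open>M\<close>.\<close>

lemma f_le_pow: assumes "spread_mass k" "conc_dvd k" "k \<le> m" shows "f k x y \<le> p ^ rho k"
proof -
  obtain z where z: "z \<in> A" "\<not> conc k (fst z)" using spread_exists assms by blast
  have "card (node k (fst z)) * p ^ rho k = M" using assms(1) z unfolding spread_mass_def by blast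
  moreover have "f k x y * card (node k (fst z)) \<le> M"
    using coset_card_bound'[OF sp pr(1,2) assms(3), of 0 x y "fst z" 0] unfolding f_def card_node by simp
  ultimately have "f k x y * card (node k (fst z)) \<le> p ^ rho k * card (node k (fst z))" by (simp add: mult.commute)
  moreover have "card (node k (fst z)) > 0" using z fin_node by (auto simp: card_gt_0_iff node_iff)
  ultimately show ?thesis by simp
qed

lemma const_cong: "x mod p ^ (m - k) = x' mod p ^ (m - k) \<Longrightarrow> y mod q ^ (n - 1) = y' mod q ^ (n - 1) \<Longrightarrow> const k x y = const k x' y'"
proof -
  assume h: "x mod p ^ (m - k) = x' mod p ^ (m - k)" "y mod q ^ (n - 1) = y' mod q ^ (n - 1)"
  have "f k x w = f k x' w" for w unfolding f_def by (rule cn_cong[OF h(1) refl])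
  then show ?thesis unfolding const_def using h(2) by metis
qed

lemma nonconst_vals:
  assumes "nonconst_01 k" "\<not> const k x y"
  shows "\<exists>u w. u mod q ^ (n - 1) = y mod q ^ (n - 1) \<and> w mod q ^ (n - 1) = y mod q ^ (n - 1) \<and> f k x u = p ^ rho k \<and> f k x w = 0"
proof -
  obtain y' where y': "y' mod q ^ (n - 1) = y mod q ^ (n - 1)" "f k x y' \<noteq> f k x y" using assms(2) unfolding const_def by blast
  have "f k x y' \<in> {0, p ^ rho k}" "f k x y \<in> {0, p ^ rho k}" using assms y'(1) unfolding nonconst_01_def by blast+
  then show ?thesis using y' by (metis insertE singletonD)
qed

text \<open>The column of \<open>x\<close> attains \<open>p ^ rho k\<close> at some \<open>u\<close>
  and 0 at some \<open>w\<close>. The four-term relation gives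
  \<open>f k x' u - f k x' w = p ^ rho k\<close>, which the bound permits only for
  \<open>f k x' w = 0\<close>; comparison with \<open>w\<close> then identifies the columns.\<close>

lemma cols_notG:
  assumes k: "k \<notin> G" "k < m" and I: "nonconst_01 k" and nc: "\<not> const k x y" and f_le_pow: "\<And>x y. f k x y \<le> p ^ rho k"
    and x': "x' mod p ^ (m - Suc k) = x mod p ^ (m - Suc k)" and y': "y' mod q ^ (n - 1) = y mod q ^ (n - 1)"
  shows "f k x' y' = f k x y'"
proof -
  have e: "m - k = Suc (m - Suc k)" "n = Suc (n - 1)" using k(2) n0 by auto
  have z: "zr p q B (Suc (m - Suc k)) (Suc (n - 1))" using k(1) unfolding G_def e(1)[symmetric] e(2)[symmetric] by blast
  have grid: "f k x u + f k x' w = f k x w + f k x' u" if "u mod q ^ (n - 1) = y mod q ^ (n - 1)" "w mod q ^ (n - 1) = y mod q ^ (n - 1)" for u w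
    using z[unfolded zr.simps] x' that unfolding f_def e(1) e(2)[symmetric] by metis
  obtain u w where uw: "u mod q ^ (n - 1) = y mod q ^ (n - 1)" "w mod q ^ (n - 1) = y mod q ^ (n - 1)" "f k x u = p ^ rho k" "f k x w = 0"
    using nonconst_vals[OF I nc] by blast
  have "p ^ rho k + f k x' w = f k x' u" using grid[OF uw(1,2)] uw by simp
  then have "f k x' w = 0" using f_le_pow[of x' u] by simp
  then show ?thesis using grid[OF y' uw(2)] uw(4) by simp
qed

lemma f_split: "k < m \<Longrightarrow> f (Suc k) x y = (\<Sum>t<p. f k (x mod p ^ (m - Suc k) + p ^ (m - Suc k) * t) y)"
  unfolding f_def using cn_split_p[OF fin(2) p0(1), of q "m - Suc k" n x y] by (simp add: Suc_diff_Suc)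

lemma f_mono: "f k x y \<le> f (Suc k) x y"
  unfolding f_def by (rule cn_mono[OF fin(2)]) auto

lemma f_two:
  assumes k: "k < m" and x': "x' mod p ^ (m - Suc k) = x mod p ^ (m - Suc k)" "x' mod p ^ (m - k) \<noteq> x mod p ^ (m - k)"
  shows "f k x y + f k x' y \<le> f (Suc k) x y"
proof -
  have "cl p q B (m - k) n x y \<union> cl p q B (m - k) n x' y \<subseteq> cl p q B (m - Suc k) n x y"
  proof
    fix z assume "z \<in> cl p q B (m - k) n x y \<union> cl p q B (m - k) n x' y"
    then have z: "z \<in> B" "snd z mod q ^ n = y mod q ^ n" "fst z mod p ^ (m - k) = x mod p ^ (m - k) \<or> fst z mod p ^ (m - k) = x' mod p ^ (m - k)"
      unfolding cl_def by auto
    from z(3) have "fst z mod p ^ (m - Suc k) = x mod p ^ (m - Suc k)"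
    proof
      assume "fst z mod p ^ (m - k) = x mod p ^ (m - k)"
      then show ?thesis by (rule mod_pow_mono) simp
    next
      assume "fst z mod p ^ (m - k) = x' mod p ^ (m - k)"
      then have "fst z mod p ^ (m - Suc k) = x' mod p ^ (m - Suc k)" by (rule mod_pow_mono) simp
      then show ?thesis using x'(1) by simp
    qed
    then show "z \<in> cl p q B (m - Suc k) n x y" using z(1,2) unfolding cl_def by blast
  qed
  then have "card (cl p q B (m - k) n x y \<union> cl p q B (m - k) n x' y) \<le> f (Suc k) x y"
    unfolding f_def cn_def by (intro card_mono cl_fin fin)
  moreover have "cl p q B (m - k) n x y \<inter> cl p q B (m - k) n x' y = {}" using x'(2) unfolding cl_def by auto
  ultimately show ?thesis unfolding f_def cn_def by (subst (asm) card_Un_disjoint) (auto intro: cl_fin fin)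
qed

text \<open>At a gap the bound does not grow with the depth, so beside a maximal entry of the column
  of \<open>x\<close> the sibling has entry 0; being constant, it is 0 throughout.\<close>

lemma cols_G:
  assumes k: "k \<in> G" "k < m" and I: "nonconst_01 k" and nc: "\<not> const k x y" and f_le_pow: "\<And>x y. f (Suc k) x y \<le> p ^ rho k"
    and x': "x' mod p ^ (m - Suc k) = x mod p ^ (m - Suc k)" and c: "const k x' y" and y': "y' mod q ^ (n - 1) = y mod q ^ (n - 1)"
  shows "f k x' y' = 0"
proof -
  obtain u where u: "u mod q ^ (n - 1) = y mod q ^ (n - 1)" "f k x u = p ^ rho k" using nonconst_vals[OF I nc] by blast
  have "x' mod p ^ (m - k) \<noteq> x mod p ^ (m - k)" using nc c const_cong by blast
  from f_two[OF k(2) x' this, of u] have "f k x' u = 0" using f_le_pow[of x u] u(2) by simp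
  then show ?thesis using c u(1) y' unfolding const_def by metis
qed

text \<open>By \<open>cols_notG\<close> the column of \<open>x\<close> and its sibling at
  \<open>x + p ^ i\<close> are occupied at the same \<open>u\<close>. The two elements of
  \<open>B\<close> found there differ by an element of order \<open>p ^ (k + 1)\<close>.\<close>

lemma zr_A:
  assumes k: "k \<notin> G" "k < m" and I: "nonconst_01 k" and nc: "\<not> qinv k" and f_le_pow: "\<And>x y. f k x y \<le> p ^ rho k"
  shows "zr p q A (Suc k) 0"
proof -
  obtain x y where xy: "\<not> const k x y" using nc unfolding qinv_def by blast
  obtain u where u: "u mod q ^ (n - 1) = y mod q ^ (n - 1)" "f k x u = p ^ rho k" using nonconst_vals[OF I xy] by blast
  define i where "i = m - Suc k"
  have mk: "m - k = Suc i" "i < m" "m - i = Suc k" using k(2) unfolding i_def by auto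
  define x' where "x' = x + p ^ i"
  have x': "x' mod p ^ i = x mod p ^ i" unfolding x'_def by simp
  have nx: "x' mod p ^ Suc i \<noteq> x mod p ^ Suc i"
  proof
    assume "x' mod p ^ Suc i = x mod p ^ Suc i"
    then have "dg p i x' = dg p i x" unfolding mod_eq_dg by blast
    moreover have "x' div p ^ i = Suc (x div p ^ i)" unfolding x'_def using p0 by simp
    ultimately have "Suc (x div p ^ i) mod p = (x div p ^ i) mod p" unfolding dg_def by simp
    then show False using p0(3) mod_Suc[of "x div p ^ i" p] by (auto split: if_splits)
  qed
  have "f k x' u = p ^ rho k" using cols_notG[OF k I xy f_le_pow, of x' u] x' u unfolding i_def by simp
  then have "f k x' u > 0" "f k x u > 0" using u p0 by auto
  then obtain w w' where w: "w \<in> B" "fst w mod p ^ Suc i = x mod p ^ Suc i" "snd w mod q ^ n = u mod q ^ n"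
     "w' \<in> B" "fst w' mod p ^ Suc i = x' mod p ^ Suc i" "snd w' mod q ^ n = u mod q ^ n"
    unfolding f_def mk(1) cn_pos_iff[OF fin(2)] by blast
  have l1: "lv p m (fst w) (fst w') = i"
  proof (rule lv_eqI[OF mk(2)])
    have "fst w mod p ^ i = x mod p ^ i" using w(2) by (rule mod_pow_mono) simp
    moreover have "fst w' mod p ^ i = x' mod p ^ i" using w(5) by (rule mod_pow_mono) simp
    ultimately show "fst w mod p ^ i = fst w' mod p ^ i" using x' by simp
    show "fst w mod p ^ Suc i \<noteq> fst w' mod p ^ Suc i" using w nx by simp
  qed
  have l2: "lv q n (snd w) (snd w') = n" using lv_iff[of n n q "snd w" "snd w'"] lv_le[of q n "snd w" "snd w'"] w(3,6) by simp
  have "w \<noteq> w'" using w(2,5) nx by metis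
  from D(5)[OF w(1,4) this] show ?thesis unfolding l1 l2 mk(3) diff_self_eq_0 .
qed

lemma child_mass:
  assumes k: "k < m" and I: "spread_mass k" "conc_dvd k" "nonconst_01 k" "\<not> qinv k" and z: "z \<in> A" "\<not> conc k (fst z)"
  shows "card (node (Suc k) (fst z)) * p ^ rho (Suc k) = M"
proof (cases "k \<in> G")
  case True
  have "node (Suc k) (fst z) = node k (fst z)"
  proof
    show "node k (fst z) \<subseteq> node (Suc k) (fst z)"
    proof
      fix w assume w: "w \<in> node k (fst z)"
      have "z \<in> node k (fst z)" using z by (simp add: node_iff)
      from two_color[OF True k z(2) w this] show "w \<in> node (Suc k) (fst z)" using w by (simp add: node_iff)
    qed
  qed (rule node_Suc_sub)
  then show ?thesis using I(1) z(2) True unfolding spread_mass_def rho_Suc by simp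
next
  case False
  have za: "zr p q A (Suc k) 0" by (rule zr_A[OF False k I(3,4)]) (use f_le_pow[OF I(1,2)] k in simp)
  have "card (node k (fst z)) = (\<Sum>t<p. cn p q A (Suc k) 0 (fst z mod p ^ k + p ^ k * t) 0)"
    unfolding card_node by (rule cn_split_p[OF fin(1) p0(1)])
  also have "\<dots> = (\<Sum>t<p. cn p q A (Suc k) 0 (fst z) 0)"
  proof (rule sum.cong[OF refl])
    fix t
    have "(fst z mod p ^ k + p ^ k * t) mod p ^ k = fst z mod p ^ k" by simp
    then show "cn p q A (Suc k) 0 (fst z mod p ^ k + p ^ k * t) 0 = cn p q A (Suc k) 0 (fst z) 0"
      using za unfolding zr.simps by blast
  qed
  also have "\<dots> = p * card (node (Suc k) (fst z))" unfolding card_node by simp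
  finally have "card (node k (fst z)) = p * card (node (Suc k) (fst z))" .
  moreover have "card (node k (fst z)) * p ^ rho k = M" using I(1) z(2) unfolding spread_mass_def by blast
  ultimately show ?thesis using False unfolding rho_Suc by (simp add: mult_ac)
qed

lemma spread_mass_Suc:
  assumes k: "k < m" and I: "spread_mass k" "conc_dvd k" "nonconst_01 k" "\<not> qinv k"
  shows "spread_mass (Suc k)"
  unfolding spread_mass_def
proof (intro allI impI)
  fix c assume c: "\<not> conc (Suc k) c"
  then obtain z where z: "z \<in> node (Suc k) c" unfolding conc_def by blast
  then have e: "fst z mod p ^ Suc k = c mod p ^ Suc k" "z \<in> A" by (auto simp: node_iff)
  have "\<not> conc (Suc k) (fst z)" using c conc_cong[OF e(1)] by blast
  then have "\<not> conc k (fst z)" using conc_Suc by blast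
  from child_mass[OF k I e(2) this] show "card (node (Suc k) c) * p ^ rho (Suc k) = M" unfolding node_cong[OF e(1)] .
qed

text \<open>A newly concentrated node is a child of a spread node, so it has mass
  \<open>M / p ^ rho (Suc k)\<close> by \<open>child_mass\<close>, and it lies in a single class
  modulo \<open>p\<close> and \<open>q\<close>.\<close>

lemma conc_dvd_Suc:
  assumes k: "k < m" and I: "spread_mass k" "conc_dvd k" "nonconst_01 k" "\<not> qinv k"
  shows "conc_dvd (Suc k)"
  unfolding conc_dvd_def
proof (intro allI)
  fix c e
  let ?S = "\<lambda>k. {z \<in> A. fst z mod p = c \<and> snd z mod q = e \<and> conc k (fst z)}"
  define N where "N = {z \<in> A. fst z mod p = c \<and> snd z mod q = e \<and> conc (Suc k) (fst z) \<and> \<not> conc k (fst z)}"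
  have fN: "finite N" unfolding N_def using fin by simp
  have "?S (Suc k) = ?S k \<union> N" unfolding N_def using conc_Suc by blast
  then have cS: "card (?S (Suc k)) = card (?S k) + card N"
    using card_Un_disjoint[of "?S k" N] fin unfolding N_def by auto
  have "M dvd p ^ rho (Suc k) * card (?S k)"
  proof -
    have "p ^ rho k dvd p ^ rho (Suc k)" by (rule le_imp_power_dvd) (simp add: rho_Suc)
    then have "p ^ rho k * card (?S k) dvd p ^ rho (Suc k) * card (?S k)" by (rule mult_dvd_mono) simp
    then show ?thesis using I(2) dvd_trans unfolding conc_dvd_def by blast
  qed
  moreover have "M dvd p ^ rho (Suc k) * card N"
  proof -
    let ?F = "\<lambda>r. {z \<in> N. fst z mod p ^ Suc k = r}"
    have "card N = (\<Sum>r<p ^ Suc k. card (?F r))"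
    proof -
      have "(\<lambda>z. fst z mod p ^ Suc k) ` N \<subseteq> {..<p ^ Suc k}" using p0(1) by auto
      from sum.group[OF fN _ this, of "\<lambda>_. 1::nat"] show ?thesis by simp
    qed
    then have "p ^ rho (Suc k) * card N = (\<Sum>r<p ^ Suc k. p ^ rho (Suc k) * card (?F r))" by (simp only: sum_distrib_left)
    moreover have "M dvd p ^ rho (Suc k) * card (?F r)" for r
    proof (cases "?F r = {}")
      case False
      then obtain z where z: "z \<in> N" "fst z mod p ^ Suc k = r" by blast
      have zA: "z \<in> A" "\<not> conc k (fst z)" "conc (Suc k) (fst z)" "fst z mod p = c" "snd z mod q = e" using z unfolding N_def by auto
      have "?F r = node (Suc k) (fst z)"
      proof (intro equalityI subsetI)
        fix w assume w: "w \<in> node (Suc k) (fst z)"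
        have zn: "z \<in> node (Suc k) (fst z)" using zA by (simp add: node_iff)
        have fw: "fst w mod p ^ Suc k = fst z mod p ^ Suc k" "w \<in> A" using w by (auto simp: node_iff)
        have f1: "fst w mod p ^ 1 = fst z mod p ^ 1" using fw(1) by (rule mod_pow_mono) simp
        have fk: "fst w mod p ^ k = fst z mod p ^ k" using fw(1) by (rule mod_pow_mono) simp
        have "snd w mod q = snd z mod q" using zA(3) w zn unfolding conc_def by metis
        then have "w \<in> N" using fw zA f1 conc_cong[OF fw(1)] conc_cong[OF fk] unfolding N_def by simp
        then show "w \<in> ?F r" using fw z by simp
      next
        fix w assume "w \<in> ?F r" then show "w \<in> node (Suc k) (fst z)" using z unfolding N_def by (simp add: node_iff)
      qed
      then have "p ^ rho (Suc k) * card (?F r) = M" using child_mass[OF k I zA(1,2)] by (simp add: mult.commute)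
      then show ?thesis by simp
    qed (metis card.empty dvd_0_right mult_0_right)
    ultimately show ?thesis by (simp add: dvd_sum)
  qed
  ultimately show "M dvd p ^ rho (Suc k) * card (?S (Suc k))" unfolding cS distrib_left by simp
qed

text \<open>A column at depth \<open>Suc k\<close> is the sum of \<open>p\<close> siblings, one of
  them not constant. Outside \<open>G\<close> they are all equal, and values are multiplied by
  \<open>p\<close>; at a gap every entry is 0 or maximal, and the bound leaves room for one maximal
  entry.\<close>

lemma nonconst_01_Suc:
  assumes k: "k < m" and I: "spread_mass k" "conc_dvd k" "nonconst_01 k" "\<not> qinv k"
  shows "nonconst_01 (Suc k)"
  unfolding nonconst_01_def
proof (intro allI impI)
  fix x y y' assume nc: "\<not> const (Suc k) x y" and y': "y' mod q ^ (n - 1) = y mod q ^ (n - 1)"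
  let ?x = "\<lambda>t. x mod p ^ (m - Suc k) + p ^ (m - Suc k) * t"
  have xt: "?x t mod p ^ (m - Suc k) = x mod p ^ (m - Suc k)" for t by simp
  have b: "f k x y \<le> p ^ rho k" for x y using f_le_pow[OF I(1,2)] k by simp
  have b': "f (Suc k) x y \<le> p ^ rho (Suc k)" for x y using f_le_pow[OF spread_mass_Suc[OF k I] conc_dvd_Suc[OF k I]] k by simp
  obtain t0 where t0: "\<not> const k (?x t0) y"
  proof (rule ccontr)
    assume H: "\<not> thesis"
    have "const (Suc k) x y" unfolding const_def f_split[OF k]
      by (intro allI impI sum.cong refl) (use H that in \<open>auto simp: const_def\<close>)
    then show False using nc by blast
  qed
  show "f (Suc k) x y' \<in> {0, p ^ rho (Suc k)}"
  proof (cases "k \<in> G")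
    case False
    have "f k (?x t) y' = f k (?x t0) y'" for t
      by (rule cols_notG[OF False k I(3) t0 b _ y']) (simp add: xt)
    then have "(\<Sum>t<p. f k (?x t) y') = (\<Sum>t<p. f k (?x t0) y')" by (intro sum.cong refl)
    then have "f (Suc k) x y' = p * f k (?x t0) y'" unfolding f_split[OF k] by simp
    moreover have "f k (?x t0) y' \<in> {0, p ^ rho k}" using I(3) t0 y' unfolding nonconst_01_def by blast
    ultimately show ?thesis using False unfolding rho_Suc by auto
  next
    case True
    then have r: "rho (Suc k) = rho k" unfolding rho_Suc by simp
    have v: "f k (?x t) y' \<in> {0, p ^ rho k}" for t
    proof (cases "const k (?x t) y")
      case c: True
      have "f k (?x t) y' = 0"
        by (rule cols_G[OF True k I(3) t0 _ _ c y']) (use b' r xt in \<open>simp_all\<close>)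
      then show ?thesis by simp
    next
      case False then show ?thesis using I(3) y' unfolding nonconst_01_def by blast
    qed
    show ?thesis
    proof (cases "\<exists>t<p. f k (?x t) y' = p ^ rho k")
      case True
      then obtain t where t: "t < p" "f k (?x t) y' = p ^ rho k" by blast
      have "f k (?x t) y' \<le> f (Suc k) x y'" unfolding f_split[OF k] by (rule member_le_sum) (use t in auto)
      then show ?thesis using t b'[of x y'] r by simp
    next
      case False
      then have "f k (?x t) y' = 0" if "t < p" for t using v[of t] that by blast
      then have "f (Suc k) x y' = 0" unfolding f_split[OF k] by simp
      then show ?thesis by simp
    qed
  qed
qed

lemma rho_0: "rho 0 = 0" unfolding rho_def by simp

lemma invariants_0: "spread_mass 0" "conc_dvd 0" "nonconst_01 0"
proof -
  have nA: "node 0 c = A" for c unfolding node_def cl_def by simp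
  show "spread_mass 0" unfolding spread_mass_def nA rho_0 by simp
  have "\<not> conc 0 c" for c
  proof
    assume "conc 0 c"
    then obtain e where e: "\<And>z. z \<in> A \<Longrightarrow> snd z mod q = e" unfolding conc_def nA by blast
    have "cn p q A 0 1 0 (Suc e) > 0" using class_q[of "Suc e"] p0(5) by (metis gr0I mult_0_right)
    then obtain z where "z \<in> A" "snd z mod q = Suc e mod q" unfolding cn_pos_iff[OF fin(1)] by auto
    then have "e = Suc e mod q" using e by metis
    moreover have "Suc e mod q < q" using p0 by simp
    ultimately have "e < q" "e = Suc e mod q" by auto
    then show False using p0(4) by (cases "Suc e = q") auto
  qed
  then show "conc_dvd 0" unfolding conc_dvd_def by simp
  show "nonconst_01 0" unfolding nonconst_01_def
  proof (intro allI impI)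
    fix x y y'
    have "card (cl p q B m n x y') \<le> 1"
    proof (rule card_le_Suc0_iff_eq[THEN iffD2, unfolded One_nat_def[symmetric]])
      show "finite (cl p q B m n x y')" using fin cl_fin by blast
      show "\<forall>z\<in>cl p q B m n x y'. \<forall>w\<in>cl p q B m n x y'. z = w"
      proof (intro ballI)
        fix z w assume zw: "z \<in> cl p q B m n x y'" "w \<in> cl p q B m n x y'"
        then have "z \<in> B" "w \<in> B" unfolding cl_def by auto
        then have "fst z < p ^ m" "fst w < p ^ m" "snd z < q ^ n" "snd w < q ^ n" using D(2) by auto
        then show "z = w" using zw unfolding cl_def by (auto simp: prod_eq_iff)
      qed
    qed
    then have "f 0 x y' \<le> 1" unfolding f_def cn_def by simp
    then show "f 0 x y' \<in> {0, p ^ rho 0}" unfolding rho_0 by auto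
  qed
qed

lemma invariants: "k \<le> m \<Longrightarrow> (\<And>j. j < k \<Longrightarrow> \<not> qinv j) \<Longrightarrow> spread_mass k \<and> conc_dvd k \<and> nonconst_01 k"
proof (induction k)
  case (Suc k)
  then have "spread_mass k \<and> conc_dvd k \<and> nonconst_01 k" "\<not> qinv k" "k < m" by auto
  then show ?case using spread_mass_Suc conc_dvd_Suc nonconst_01_Suc by blast
qed (use invariants_0 in blast)

lemma qinv_m: "zr p q B 0 n \<Longrightarrow> qinv m"
proof -
  assume z: "zr p q B 0 n"
  obtain n' where n': "n = Suc n'" using n0 by (cases n) auto
  have eq: "cn p q B 0 n x u = cn p q B 0 n x y" if "u mod q ^ (n - 1) = y mod q ^ (n - 1)" for x u y
  proof -
    have "cn p q B 0 n x w = cn p q B 0 n 0 w" for w by (rule cn_cong) simp_all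
    moreover have "cn p q B 0 n 0 u = cn p q B 0 n 0 y"
      using z that unfolding n' zr.simps diff_Suc_1 by blast
    ultimately show ?thesis by metis
  qed
  have mm: "m - m = 0" by simp
  have "f m x u = f m x y" if "u mod q ^ (n - 1) = y mod q ^ (n - 1)" for x u y
    unfolding f_def mm by (rule eq[OF that])
  then show ?thesis unfolding qinv_def const_def by blast
qed

text \<open>Otherwise a spread node would survive to depth \<open>m\<close>; its two residues modulo
  \<open>q\<close> give a zero of \<open>B\<close> of order \<open>q ^ n\<close>, which is
  invariance at depth \<open>m\<close>.\<close>

lemma qinv_exists: "\<exists>s\<le>m. qinv s"
proof (rule ccontr)
  assume H: "\<not> ?thesis"
  then have "conc_dvd m" using invariants[of m] by auto
  from spread_exists[OF this] obtain z where "z \<in> A" "\<not> conc m (fst z)" by blast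
  then have "qinv m" using spread_leaf qinv_m by blast
  then show False using H by blast
qed

section \<open>Stopping depth and first gap\<close>

definition s where "s = (LEAST k. qinv k)"

lemma s: "qinv s" "s \<le> m" "\<And>j. j < s \<Longrightarrow> \<not> qinv j" "s > 0"
proof -
  obtain k where "k \<le> m" "qinv k" using qinv_exists by blast
  then show "qinv s" "s \<le> m" unfolding s_def by (auto intro: LeastI Least_le order_trans)
  show "\<And>j. j < s \<Longrightarrow> \<not> qinv j" unfolding s_def by (rule not_less_Least)
  have "\<not> qinv 0" using notinv unfolding qinv_def const_def f_def by auto
  then show "s > 0" using \<open>qinv s\<close> by (cases s) auto
qed

lemma invariants_s: assumes "k \<le> s" shows "spread_mass k" "conc_dvd k" "nonconst_01 k"
  using invariants[of k] assms s by auto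

lemma f_le_s: "k \<le> s \<Longrightarrow> f k x y \<le> p ^ rho k"
  using f_le_pow invariants_s s by (meson le_trans)

text \<open>Outside \<open>G\<close>, a column that is not constant at depth \<open>s - 1\<close>
  would merely be multiplied by \<open>p\<close> and stay so at depth \<open>s\<close>.\<close>

lemma pred_s_in_G: "s - 1 \<in> G"
proof (rule ccontr)
  assume H: "s - 1 \<notin> G"
  have k: "s - 1 < m" "s - 1 \<le> s" "s - 1 < s" "Suc (s - 1) = s" using s by auto
  obtain x y where xy: "\<not> const (s - 1) x y" using s(3)[OF k(3)] unfolding qinv_def by blast
  let ?x = "\<lambda>t. x mod p ^ (m - Suc (s - 1)) + p ^ (m - Suc (s - 1)) * t"
  have "f s x u = p * f (s - 1) x u" if "u mod q ^ (n - 1) = y mod q ^ (n - 1)" for u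
  proof -
    have "f (s - 1) (?x t) u = f (s - 1) x u" for t
      by (rule cols_notG[OF H k(1) invariants_s(3)[OF k(2)] xy f_le_s[OF k(2)] _ that]) simp
    then show ?thesis using f_split[OF k(1), of x u] k(4) by simp
  qed
  moreover obtain u where u: "u mod q ^ (n - 1) = y mod q ^ (n - 1)" "f (s - 1) x u \<noteq> f (s - 1) x y" using xy unfolding const_def by blast
  ultimately have "f s x u \<noteq> f s x y" using p0 by simp
  then show False using s(1) u(1) unfolding qinv_def const_def by blast
qed

lemma zr_A_s: "j < s \<Longrightarrow> j \<notin> G \<Longrightarrow> zr p q A (Suc j) 0"
  by (rule zr_A) (use s invariants_s f_le_s in auto)

definition a where "a = (LEAST k. k \<in> G)"

lemma a: "a \<in> G" "a < s" "a < m" "a > 0" "\<And>j. j < a \<Longrightarrow> j \<notin> G"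
proof -
  show aG: "a \<in> G" unfolding a_def using pred_s_in_G by (rule LeastI)
  have "a \<le> s - 1" unfolding a_def using pred_s_in_G by (rule Least_le)
  then show as: "a < s" using s(4) by simp
  then show "a < m" using s(2) by simp
  have "0 \<notin> G" using zBmn unfolding G_def by simp
  then show "a > 0" using aG by (cases a) auto
  show "\<And>j. j < a \<Longrightarrow> j \<notin> G" unfolding a_def by (rule not_less_Least)
qed

lemma rho_le: "rho k \<le> k"
  unfolding rho_def using card_mono[of "{..<k}" "{..<k} - G"] by simp

lemma rho_a: "k \<le> a \<Longrightarrow> rho k = k"
proof -
  assume "k \<le> a"
  then have "{..<k} - G = {..<k}" using a(5) by auto
  then show ?thesis unfolding rho_def by simp
qed

lemma rho_mono: "k \<le> l \<Longrightarrow> rho k \<le> rho l"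
  unfolding rho_def by (intro card_mono) auto

text \<open>Unlike \<open>spread_mass\<close> this concerns all nodes: every depth before the first
  gap gives a zero of \<open>A\<close>, so the tree is regular down to depth
  \<open>a\<close>.\<close>

lemma node_a: "k \<le> a \<Longrightarrow> card (node k c) * p ^ k = M"
proof (induction k arbitrary: c)
  case 0 then show ?case unfolding node_def cl_def by simp
next
  case (Suc k)
  have z: "zr p q A (Suc k) 0" by (rule zr_A_s) (use Suc.prems a in auto)
  have "card (node k c) = (\<Sum>t<p. cn p q A (Suc k) 0 (c mod p ^ k + p ^ k * t) 0)"
    unfolding card_node by (rule cn_split_p[OF fin(1) p0(1)])
  also have "\<dots> = (\<Sum>t<p. cn p q A (Suc k) 0 c 0)"
  proof (rule sum.cong[OF refl])
    fix t
    have "(c mod p ^ k + p ^ k * t) mod p ^ k = c mod p ^ k" by simp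
    then show "cn p q A (Suc k) 0 (c mod p ^ k + p ^ k * t) 0 = cn p q A (Suc k) 0 c 0"
      using z unfolding zr.simps by blast
  qed
  also have "\<dots> = p * card (node (Suc k) c)" unfolding card_node by simp
  finally have "card (node k c) * p ^ k = card (node (Suc k) c) * p ^ Suc k" by (simp add: mult_ac)
  then show ?case using Suc.IH[of c] Suc.prems by simp
qed

text \<open>Every level occurs in \<open>A\<close>, so some node at depth \<open>a\<close> branches,
  and at a gap only a concentrated node can.\<close>

lemma conc_node: "\<exists>c e. node a c = cl p q A a 1 c e \<and> card (cl p q A a 1 c e) * p ^ a = M"
proof -
  obtain z z' where z: "z \<in> A" "z' \<in> A" "lv p m (fst z) (fst z') = a" using lev[OF a(3)] by blast
  have "fst z mod p ^ a = fst z' mod p ^ a" using lv_mod[of "fst z" p m "fst z'"] z(3) by simp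
  moreover have "fst z mod p ^ Suc a \<noteq> fst z' mod p ^ Suc a" using lv_less_neq[of p m "fst z" "fst z'"] z(3) a(3) by simp
  ultimately have "conc a (fst z)" using two_color[OF a(1,3), of "fst z" z z'] z by (auto simp: node_iff)
  then obtain e where e: "\<And>w. w \<in> node a (fst z) \<Longrightarrow> snd w mod q = e" unfolding conc_def by blast
  have "e = snd z mod q" using e[of z] z by (simp add: node_iff)
  then have "e mod q = e" by simp
  then have "node a (fst z) = cl p q A a 1 (fst z) e" using e unfolding node_def cl_def by auto
  then show ?thesis using node_a[of a "fst z"] by auto
qed

definition conc_child where "conc_child = (SOME ce. node a (fst ce) = cl p q A a 1 (fst ce) (snd ce) \<and> card (cl p q A a 1 (fst ce) (snd ce)) * p ^ a = M)"
definition S where "S = cl p q A a 1 (fst conc_child) (snd conc_child)"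

lemma S: "node a (fst conc_child) = S" "card S * p ^ a = M"
proof -
  have "\<exists>ce. node a (fst ce) = cl p q A a 1 (fst ce) (snd ce) \<and> card (cl p q A a 1 (fst ce) (snd ce)) * p ^ a = M"
    using conc_node by auto
  from someI_ex[OF this] show "node a (fst conc_child) = S" "card S * p ^ a = M" unfolding S_def conc_child_def by auto
qed

lemma S_pos: "card S > 0" using S(2) p0(5) by (metis gr0I mult_0)

text \<open>\<open>S\<close> has mass \<open>M / p ^ a\<close> although it lies in one class modulo
  \<open>q\<close>. Hence the bound \<open>p ^ a\<close> holds for a whole class modulo
  \<open>q ^ (n - 1)\<close>, and not just for single entries of \<open>f a\<close>.\<close>

lemma bound_a: "cn p q B (m - a) (n - 1) x y \<le> p ^ a"
proof -
  have "cn p q B (m - a) (n - 1) x y * card S \<le> M"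
    using coset_card_bound'[OF sp pr(1,2), of a 1 x y "fst conc_child" "snd conc_child"] a(3) n0 unfolding S_def cn_def by simp
  then have "cn p q B (m - a) (n - 1) x y * card S \<le> p ^ a * card S" using S(2) by (simp add: mult.commute)
  then show ?thesis using S_pos by simp
qed

text \<open>A sibling column above an element of \<open>B\<close> cannot be constant: outside
  \<open>G\<close> it copies the given column, and at a gap constant siblings are empty.\<close>

lemma cols:
  assumes k: "k < s" and nc: "\<not> const k x y" and w: "w \<in> cl p q B (m - Suc k) (n - 1) x y"
  shows "\<not> const k (fst w) y"
proof
  assume c: "const k (fst w) y"
  have km: "k < m" "k \<le> s" "Suc k \<le> s" using k s by auto
  have w': "w \<in> B" "fst w mod p ^ (m - Suc k) = x mod p ^ (m - Suc k)" "snd w mod q ^ (n - 1) = y mod q ^ (n - 1)" using w unfolding cl_def by auto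
  have f1: "f k (fst w) (snd w) > 0" unfolding f_def using cn_pos_iff[OF fin(2)] w'(1) by blast
  show False
  proof (cases "k \<in> G")
    case True
    have "f k (fst w) (snd w) = 0"
      by (rule cols_G[OF True km(1) invariants_s(3)[OF km(2)] nc _ w'(2) c w'(3)])
         (use f_le_s[OF km(3)] True in \<open>simp add: rho_Suc\<close>)
    then show False using f1 by simp
  next
    case False
    have e: "f k (fst w) u = f k x u" if "u mod q ^ (n - 1) = y mod q ^ (n - 1)" for u
      by (rule cols_notG[OF False km(1) invariants_s(3)[OF km(2)] nc f_le_s[OF km(2)] w'(2) that])
    then have "const k x y" using c unfolding const_def by metis
    then show False using nc by blast
  qed
qed

text \<open>By \<open>cols\<close> the column of depth \<open>k - 1\<close> through any such
  \<open>w\<close> is again not constant. Descending to \<open>a\<close>, one of its entries equals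
  \<open>p ^ a\<close>, all that \<open>bound_a\<close> allows for the entire class. These classes
  are the partners of \<open>S\<close> in the equality case.\<close>

lemma good_a: "a \<le> k \<Longrightarrow> k < s \<Longrightarrow> \<not> const k x y \<Longrightarrow> w \<in> cl p q B (m - k) (n - 1) x y \<Longrightarrow>
   cn p q B (m - a) (n - 1) (fst w) (snd w) = p ^ a"
proof (induction k arbitrary: x y rule: dec_induct)
  case base
  obtain u where u: "u mod q ^ (n - 1) = y mod q ^ (n - 1)" "f a x u = p ^ rho a"
    using nonconst_vals[OF invariants_s(3) base(2)] a by auto
  have "p ^ a \<le> cn p q B (m - a) n x u" using u(2) rho_a[of a] unfolding f_def by simp
  also have "\<dots> \<le> cn p q B (m - a) (n - 1) x u" by (rule cn_mono[OF fin(2)]) auto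
  also have "\<dots> = cn p q B (m - a) (n - 1) (fst w) (snd w)"
    by (rule cn_cong) (use u base(3) in \<open>auto simp: cl_def\<close>)
  finally show ?case using bound_a[of "fst w" "snd w"] by simp
next
  case (step k)
  have w: "w \<in> B" "snd w mod q ^ (n - 1) = y mod q ^ (n - 1)" using step.prems unfolding cl_def by auto
  have ks: "k < s" using step.prems by simp
  obtain t where t: "t < p" "\<not> const k (x mod p ^ (m - Suc k) + p ^ (m - Suc k) * t) y"
  proof (rule ccontr)
    assume H: "\<not> thesis"
    have km: "k < m" using ks s by simp
    have "const (Suc k) x y" unfolding const_def f_split[OF km]
    proof (intro allI impI sum.cong refl)
      fix u t assume u: "u mod q ^ (n - 1) = y mod q ^ (n - 1)" "t \<in> {..<p}"
      have "const k (x mod p ^ (m - Suc k) + p ^ (m - Suc k) * t) y" using H that u(2) by blast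
      then show "f k (x mod p ^ (m - Suc k) + p ^ (m - Suc k) * t) u = f k (x mod p ^ (m - Suc k) + p ^ (m - Suc k) * t) y"
        using u(1) unfolding const_def by blast
    qed
    then show False using step.prems by blast
  qed
  have "w \<in> cl p q B (m - Suc k) (n - 1) (x mod p ^ (m - Suc k) + p ^ (m - Suc k) * t) y"
    using step.prems(3) unfolding cl_def by simp
  from cols[OF ks t(2) this] have "\<not> const k (fst w) y" .
  then show ?case by (rule step.IH[OF ks]) (use w in \<open>simp add: cl_def\<close>)
qed

text \<open>A column that is not constant at \<open>s - 1\<close> has a maximal entry; at the gap
  \<open>s - 1\<close> the maximum does not grow, and invariance at \<open>s\<close> spreads it over
  the whole column.\<close>

lemma full_coset: "\<exists>x y. (\<forall>u. u mod q ^ (n - 1) = y mod q ^ (n - 1) \<longrightarrow> f s x u = p ^ rho s) \<and>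
    (\<forall>w\<in>cl p q B (m - s) (n - 1) x y. cn p q B (m - a) (n - 1) (fst w) (snd w) = p ^ a)"
proof -
  have k: "s - 1 < s" "Suc (s - 1) = s" "a \<le> s - 1" "s - 1 \<le> s" using s a by auto
  obtain x y where xy: "\<not> const (s - 1) x y" using s(3)[OF k(1)] unfolding qinv_def by blast
  obtain u where u: "u mod q ^ (n - 1) = y mod q ^ (n - 1)" "f (s - 1) x u = p ^ rho (s - 1)"
    using nonconst_vals[OF invariants_s(3)[OF k(4)] xy] by blast
  have r: "rho s = rho (s - 1)" using rho_Suc[of "s - 1"] pred_s_in_G k(2) by simp
  have "p ^ rho s \<le> f s x u" using f_mono[of "s - 1" x u] u(2) r k(2) by simp
  then have "f s x u = p ^ rho s" using f_le_s[of s x u] by simp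
  moreover have "const s x u" using s(1) unfolding qinv_def by blast
  ultimately have "f s x u' = p ^ rho s" if "u' mod q ^ (n - 1) = y mod q ^ (n - 1)" for u'
    using that u(1) unfolding const_def by metis
  moreover have "cn p q B (m - a) (n - 1) (fst w) (snd w) = p ^ a" if w: "w \<in> cl p q B (m - s) (n - 1) x y" for w
  proof -
    have w2: "w \<in> B" "snd w mod q ^ (n - 1) = y mod q ^ (n - 1)" using w unfolding cl_def by auto
    have "\<not> const (s - 1) (fst w) y" by (rule cols[OF k(1) xy]) (use w k(2) in simp)
    then show ?thesis by (rule good_a[OF k(3,1)]) (use w2 in \<open>simp add: cl_def\<close>)
  qed
  ultimately show ?thesis by blast
qed

definition X where "X = (SOME x. \<exists>y. (\<forall>u. u mod q ^ (n - 1) = y mod q ^ (n - 1) \<longrightarrow> f s x u = p ^ rho s) \<and>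
    (\<forall>w\<in>cl p q B (m - s) (n - 1) x y. cn p q B (m - a) (n - 1) (fst w) (snd w) = p ^ a))"
definition Y where "Y = (SOME y. (\<forall>u. u mod q ^ (n - 1) = y mod q ^ (n - 1) \<longrightarrow> f s X u = p ^ rho s) \<and>
    (\<forall>w\<in>cl p q B (m - s) (n - 1) X y. cn p q B (m - a) (n - 1) (fst w) (snd w) = p ^ a))"
definition C where "C = cl p q B (m - s) (n - 1) X Y"

lemma XY: "\<And>u. u mod q ^ (n - 1) = Y mod q ^ (n - 1) \<Longrightarrow> f s X u = p ^ rho s"
   "\<And>w. w \<in> C \<Longrightarrow> cn p q B (m - a) (n - 1) (fst w) (snd w) = p ^ a"
  using someI_ex[OF someI_ex[OF full_coset, folded X_def], folded Y_def] unfolding C_def by blast+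

section \<open>Size, divisibility and class masses at the stopping depth\<close>

lemma card_C: "card C = q * p ^ rho s"
proof -
  have "card C = (\<Sum>t<q. cn p q B (m - s) (Suc (n - 1)) X (Y mod q ^ (n - 1) + q ^ (n - 1) * t))"
    using cn_split_q[OF fin(2) p0(2), of p "m - s" "n - 1" X Y] unfolding C_def cn_def by simp
  also have "\<dots> = (\<Sum>t<q. p ^ rho s)"
    by (rule sum.cong[OF refl]) (use XY(1) n0 in \<open>simp add: f_def\<close>)
  finally show ?thesis by simp
qed

text \<open>\<open>C\<close> has \<open>q * p ^ rho s\<close> elements but is covered by
  \<open>p ^ (s - a)\<close> classes of size at most \<open>p ^ a\<close>; the gaps,
  \<open>s - rho s\<close> in number, have to make room for the factor \<open>q\<close>.\<close>

lemma gap_large: "q \<le> p ^ (s - rho s)"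
proof -
  have "card C \<le> p ^ (s - a) * p ^ a"
    unfolding C_def using cn_le_split[OF fin(2) p0(1), of "m - s" X q "s - a" "n - 1" Y "p ^ a"] bound_a a s
    by (simp add: cn_def)
  also have "\<dots> = p ^ s" using a by (simp flip: power_add)
  also have "\<dots> = p ^ (s - rho s) * p ^ rho s" using rho_le[of s] by (simp flip: power_add)
  finally show ?thesis unfolding card_C using p0 by simp
qed

text \<open>Against \<open>C\<close> the coset bound allows at most
  \<open>M / (q * p ^ rho s)\<close> for each residue modulo \<open>q\<close>. The mass
  \<open>M / p ^ rho s\<close> of the node is the sum of these \<open>q\<close> bounds, so all are
  attained.\<close>

lemma spread_uniform:
  assumes c: "\<not> conc s c"
  shows "cn p q A s 1 c e * (q * p ^ rho s) = M"
proof -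
  have le: "cn p q A s 1 c t * (q * p ^ rho s) \<le> M" for t
    using coset_card_bound'[OF sp pr(1,2) s(2), of 1 X Y c t] n0 card_C unfolding C_def cn_def by (simp add: mult.commute)
  have "card (node s c) * p ^ rho s = M" using invariants_s(1)[of s] c unfolding spread_mass_def by simp
  moreover have "card (node s c) = (\<Sum>t<q. cn p q A s 1 c t)"
    using cn_split_q[OF fin(1) p0(2), of p s 0 c 0] unfolding card_node by simp
  ultimately have "(\<Sum>t<q. cn p q A s 1 c t) * (q * p ^ rho s) = q * M" by (metis mult.assoc mult.commute)
  then have "(\<Sum>t<q. cn p q A s 1 c t * (q * p ^ rho s)) = (\<Sum>t<q. M)"
    by (simp add: sum_distrib_right)
  then have "(\<Sum>t<q. M - cn p q A s 1 c t * (q * p ^ rho s)) = 0"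
    using le by (subst sum_subtractf_nat) auto
  then have "\<forall>t\<in>{..<q}. M - cn p q A s 1 c t * (q * p ^ rho s) = 0" by (subst (asm) sum_eq_0_iff) auto
  moreover have "e mod q \<in> {..<q}" using p0 by simp
  ultimately have "M - cn p q A s 1 c (e mod q) * (q * p ^ rho s) = 0" by blast
  then have "cn p q A s 1 c (e mod q) * (q * p ^ rho s) = M" using le[of "e mod q"] by linarith
  moreover have "cn p q A s 1 c (e mod q) = cn p q A s 1 c e" by (rule cn_cong) simp_all
  ultimately show ?thesis by simp
qed

lemma zr_B_0n: "zr p q B 0 n"
proof -
  have "qinv k" if "s \<le> k" "k \<le> m" for k using that
  proof (induction k rule: dec_induct)
    case base then show ?case using s by blast
  next
    case (step k)
    then have "qinv k" "k < m" by auto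
    show ?case unfolding qinv_def const_def f_split[OF \<open>k < m\<close>]
    proof (intro allI impI sum.cong refl)
      fix x y u t assume "u mod q ^ (n - 1) = y mod q ^ (n - 1)"
      then show "f k (x mod p ^ (m - Suc k) + p ^ (m - Suc k) * t) u = f k (x mod p ^ (m - Suc k) + p ^ (m - Suc k) * t) y"
        using \<open>qinv k\<close> unfolding qinv_def const_def by blast
    qed
  qed
  then have "qinv m" using s by blast
  then have f: "f m 0 y = f m 0 y'" if "y mod q ^ (n - 1) = y' mod q ^ (n - 1)" for y y'
    using that unfolding qinv_def const_def by blast
  have mm: "m - m = 0" by simp
  have eq: "cn p q B 0 n 0 y = cn p q B 0 n 0 y'" if "y mod q ^ (n - 1) = y' mod q ^ (n - 1)" for y y'
    using f[OF that] unfolding f_def mm .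
  show ?thesis
  proof (cases n)
    case (Suc n')
    show ?thesis unfolding Suc zr.simps using eq[unfolded Suc diff_Suc_1] by blast
  qed (use n0 in simp)
qed

text \<open>A spread node at depth \<open>s\<close> has mass \<open>M / p ^ rho s\<close> and at
  most \<open>p ^ (m - s)\<close> leaves. Elements of one leaf differ by elements of order
  \<open>q ^ j\<close> at which \<open>B\<close> has a zero, so a leaf has at most one factor
  \<open>q\<close> for each such \<open>j\<close>.\<close>

lemma size_bound: "M * p ^ (s - rho s) \<le> p ^ m * q ^ card {j \<in> {1..n}. zr p q B 0 j}"
proof -
  let ?V = "{j \<in> {1..n}. zr p q B 0 j}"
  have leaf: "cn p q A m 0 x 0 \<le> q ^ card ?V" for x
  proof -
    let ?L = "cl p q A m 0 x 0"
    have inj: "inj_on snd ?L"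
    proof (rule inj_onI)
      fix z w assume zw: "z \<in> ?L" "w \<in> ?L" "snd z = snd w"
      then have "fst z mod p ^ m = fst w mod p ^ m" "z \<in> A" "w \<in> A" unfolding cl_def by auto
      moreover from this have "fst z < p ^ m" "fst w < p ^ m" using D(1) by auto
      ultimately have "fst z = fst w" by simp
      then show "z = w" using zw by (simp add: prod_eq_iff)
    qed
    have "card (snd ` ?L) \<le> q ^ card ((\<lambda>j. n - j) ` ?V)"
    proof (rule card_le_pow_levels[where m = n])
      fix y y' assume "y \<in> snd ` ?L" "y' \<in> snd ` ?L" "y \<noteq> y'"
      then obtain z w where zw: "z \<in> ?L" "w \<in> ?L" "y = snd z" "y' = snd w" by blast
      then have zA: "z \<in> A" "w \<in> A" "fst z mod p ^ m = fst w mod p ^ m" unfolding cl_def by auto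
      have "z \<noteq> w" using zw \<open>y \<noteq> y'\<close> by auto
      have "lv p m (fst z) (fst w) = m" using zA lv_iff[of m m p "fst z" "fst w"] lv_le[of p m "fst z" "fst w"] by simp
      then have z: "zr p q B 0 (n - lv q n y y')" using D(6)[OF zA(1,2) \<open>z \<noteq> w\<close>] zw by simp
      then have "n - lv q n y y' > 0" by (cases "n - lv q n y y'") auto
      then have "lv q n y y' < n" by simp
      moreover from this have "n - lv q n y y' \<in> ?V" using z by simp
      then have "n - (n - lv q n y y') \<in> (\<lambda>j. n - j) ` ?V" by blast
      ultimately show "lv q n y y' < n \<and> lv q n y y' \<in> (\<lambda>j. n - j) ` ?V" by simp
    qed (use p0 in auto)
    also have "card ((\<lambda>j. n - j) ` ?V) = card ?V" by (rule card_image) (auto intro!: inj_onI)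
    finally show ?thesis using inj unfolding cn_def by (simp add: card_image)
  qed
  obtain z where z: "z \<in> A" "\<not> conc s (fst z)" using spread_exists[OF invariants_s(2)] by blast
  have "card (node s (fst z)) * p ^ rho s = M" using invariants_s(1)[of s] z unfolding spread_mass_def by simp
  moreover have "card (node s (fst z)) \<le> p ^ (m - s) * q ^ card ?V"
    unfolding card_node by (rule cn_le_split[OF fin(1) p0(1)]) (use leaf s in simp)
  ultimately have "M \<le> p ^ (m - s) * q ^ card ?V * p ^ rho s" by (metis mult_le_mono1)
  then have "M * p ^ (s - rho s) \<le> p ^ (m - s) * q ^ card ?V * p ^ rho s * p ^ (s - rho s)" by (rule mult_le_mono1)
  also have "\<dots> = p ^ (m - s + rho s + (s - rho s)) * q ^ card ?V" by (simp add: power_add mult_ac)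
  also have "m - s + rho s + (s - rho s) = m" using s rho_le[of s] by simp
  finally show ?thesis .
qed

text \<open>Before depth \<open>s\<close> there is still a spread node, and at a gap it occupies
  only one of its \<open>p\<close> children.\<close>

lemma gap_not_uniform: assumes j: "j < s" "j \<in> G" shows "\<not> zr p q A (Suc j) 0"
proof
  assume z: "zr p q A (Suc j) 0"
  have jm: "j < m" "j \<le> s" using j s by auto
  obtain w where w: "w \<in> A" "\<not> conc j (fst w)" using spread_exists[OF invariants_s(2)[OF jm(2)]] by blast
  have wn: "w \<in> node j (fst w)" using w by (simp add: node_iff)
  define x where "x = fst w + p ^ j"
  have x: "x mod p ^ j = fst w mod p ^ j" unfolding x_def by simp
  have "cn p q A (Suc j) 0 x 0 = cn p q A (Suc j) 0 (fst w) 0" using z x unfolding zr.simps by blast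
  moreover have "cn p q A (Suc j) 0 (fst w) 0 > 0" unfolding cn_pos_iff[OF fin(1)] using w by auto
  ultimately obtain u where u: "u \<in> A" "fst u mod p ^ Suc j = x mod p ^ Suc j" unfolding cn_pos_iff[OF fin(1), of p q "Suc j" 0 x 0, symmetric]
    using cn_pos_iff[OF fin(1), of p q "Suc j" 0 x 0] by auto
  have "fst u mod p ^ j = x mod p ^ j" using u(2) by (rule mod_pow_mono) simp
  then have "u \<in> node j (fst w)" using u x by (simp add: node_iff)
  from two_color[OF j(2) jm(1) w(2) wn this] have "fst w mod p ^ Suc j = x mod p ^ Suc j" using u by simp
  then have "dg p j (fst w) = dg p j x" unfolding mod_eq_dg by blast
  moreover have "x div p ^ j = Suc (fst w div p ^ j)" unfolding x_def using p0 by simp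
  ultimately have "Suc (fst w div p ^ j) mod p = (fst w div p ^ j) mod p" unfolding dg_def by simp
  then show False using p0(3) mod_Suc[of "fst w div p ^ j" p] by (auto split: if_splits)
qed

text \<open>
  The concentrated node \<open>S\<close> meets the bound \<open>coset_card_bound\<close> with equality against the classes of \<open>C\<close>,
  which forces additional uniform levels of \<open>A\<close> above depth \<open>a\<close>.
\<close>

definition U where "U = {i \<in> {1..m}. zr p q A i 0}"

lemma U_low: "i \<in> {1..a} \<Longrightarrow> i \<in> U"
  unfolding U_def using zr_A_s[of "i - 1"] a by auto

lemma divisibility: "\<exists>x. q \<le> p ^ x \<and> p ^ (card U + x) dvd M"
proof -
  define V where "V = U \<inter> {a<..m}"
  \<comment> \<open>The orders \<open>p ^ i\<close>, \<open>i > a\<close>, of differences inside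
    \<open>C\<close>: these levels separate the classes of \<open>C\<close> modulo
    \<open>p ^ (m - a)\<close>, so \<open>C\<close> has at most \<open>p ^ card J * p ^ a\<close>
    elements.\<close>
  define J where "J = {i \<in> {a<..s}. \<exists>w\<in>C. \<exists>w'\<in>C. lv p m (fst w) (fst w') = m - i}"
  have fin3: "finite V" "finite J" "finite U" unfolding V_def J_def U_def by auto
  have Cs: "C \<subseteq> B" "finite C" unfolding C_def cl_def using fin by auto
  define R where "R = (\<lambda>w. fst w mod p ^ (m - a)) ` C"
  have fR: "finite R" unfolding R_def using Cs by simp
  have cC: "card C \<le> card R * p ^ a"
  proof -
    have "card C = (\<Sum>r\<in>R. card {w \<in> C. fst w mod p ^ (m - a) = r})"
      using sum.group[OF Cs(2) fR, of "\<lambda>w. fst w mod p ^ (m - a)" "\<lambda>_. 1::nat"] unfolding R_def by simp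
    also have "\<dots> \<le> (\<Sum>r\<in>R. p ^ a)"
    proof (rule sum_mono)
      fix r assume "r \<in> R"
      have "{w \<in> C. fst w mod p ^ (m - a) = r} \<subseteq> cl p q B (m - a) (n - 1) r Y"
        unfolding C_def cl_def by (auto simp: mod_mod_trivial)
      then have "card {w \<in> C. fst w mod p ^ (m - a) = r} \<le> cn p q B (m - a) (n - 1) r Y"
        unfolding cn_def by (intro card_mono cl_fin fin)
      then show "card {w \<in> C. fst w mod p ^ (m - a) = r} \<le> p ^ a" using bound_a order_trans by blast
    qed
    finally show ?thesis by simp
  qed
  have cR: "card R \<le> p ^ card ((\<lambda>i. m - i) ` J)"
  proof (rule card_le_pow_levels[where m = "m - a"])
    fix x x' assume x: "x \<in> R" "x' \<in> R" "x \<noteq> x'"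
    then obtain w w' where w: "w \<in> C" "w' \<in> C" "x = fst w mod p ^ (m - a)" "x' = fst w' mod p ^ (m - a)" unfolding R_def by blast
    let ?v = "lv p m (fst w) (fst w')"
    have v: "?v < m - a" using lv_iff[of "m - a" m p "fst w" "fst w'"] w x(3) by auto
    have "fst w mod p ^ (m - s) = fst w' mod p ^ (m - s)" using w unfolding C_def cl_def by simp
    then have v2: "m - s \<le> ?v" by (subst lv_iff) auto
    have dgm: "dg p u (fst z mod p ^ (m - a)) = dg p u (fst z)" if "u < m - a" for u and z :: "nat \<times> nat"
      using mod_eq_dg[of "fst z mod p ^ (m - a)" p "m - a" "fst z"] that by simp
    have "lv p (m - a) x x' = ?v"
      unfolding w(3,4)
    proof (rule lv_dgI[OF v])
      fix u assume "u < ?v"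
      then show "dg p u (fst w mod p ^ (m - a)) = dg p u (fst w' mod p ^ (m - a))" using dgm v lv_dg_eq by simp
    next
      have "dg p ?v (fst w) \<noteq> dg p ?v (fst w')" by (rule lv_dg_neq) (use v in simp)
      then show "dg p ?v (fst w mod p ^ (m - a)) \<noteq> dg p ?v (fst w' mod p ^ (m - a))" using dgm[OF v] by simp
    qed
    moreover have "m - ?v \<in> J" unfolding J_def using v v2 w s by auto
    then have "m - (m - ?v) \<in> (\<lambda>i. m - i) ` J" by blast
    ultimately show "lv p (m - a) x x' < m - a \<and> lv p (m - a) x x' \<in> (\<lambda>i. m - i) ` J" using v by simp
  qed (use p0 fin3 in auto)
  have "card ((\<lambda>i. m - i) ` J) \<le> card J" by (rule card_image_le[OF fin3(2)])
  then have "p ^ card ((\<lambda>i. m - i) ` J) \<le> p ^ card J" using p0(1) by (intro power_increasing) auto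
  then have "card R \<le> p ^ card J" using cR by (rule le_trans[rotated])
  then have q1: "q * p ^ rho s \<le> p ^ card J * p ^ a" using cC card_C by (metis mult_le_mono1 le_trans)
  have zJ: "zr p q S i 0" if i: "i \<in> J" for i
  proof -
    obtain w w' where w: "w \<in> C" "w' \<in> C" "lv p m (fst w) (fst w') = m - i" "a < i" "i \<le> s" using i unfolding J_def by auto
    have B: "w \<in> B" "snd w mod q ^ (n - 1) = snd w' mod q ^ (n - 1)" using w unfolding C_def cl_def by auto
    have sp': "spair p q m n B A" using sp spair_sym by blast
    \<comment> \<open>With the roles of \<open>A\<close> and \<open>B\<close> exchanged: the full
      class around \<open>w'\<close> and the node \<open>S\<close> attain the coset bound, and
      \<open>w\<close> lies outside that class since \<open>i > a\<close>.\<close>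
    have t: "cn p q B (m - a) (n - 1) (fst w') (snd w') * cn p q A a 1 (fst conc_child) (snd conc_child) = card B"
      using XY(2)[OF w(2)] S(2) p0(6) unfolding S_def cn_def by (simp add: mult.commute)
    show ?thesis unfolding S_def
      by (rule tight_uniform[OF sp' pr(1,2) _ _ t B]) (use a n0 w s in auto)
  qed
  \<comment> \<open>\<open>S\<close> is a complete node at depth \<open>a\<close>, so it inherits
    the uniform levels of \<open>A\<close> beyond \<open>a\<close>.\<close>
  have zV: "zr p q S i 0" if i: "i \<in> V" for i
  proof -
    obtain i' where i': "i = Suc i'" "a \<le> i'" using i unfolding V_def by (cases i) auto
    have "zr p q A i 0" using i unfolding V_def U_def by blast
    then have zA: "zr p q A (Suc i') 0" unfolding i'(1) .
    have c: "cn p q S (Suc i') 0 x 0 = (if x mod p ^ a = fst conc_child mod p ^ a then cn p q A (Suc i') 0 x 0 else 0)" for x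
    proof -
      have imp: "fst z mod p ^ Suc i' = x mod p ^ Suc i' \<Longrightarrow> fst z mod p ^ a = x mod p ^ a" for z :: "nat \<times> nat"
        by (erule mod_pow_mono) (use i' in simp)
      have "z \<in> cl p q S (Suc i') 0 x 0 \<longleftrightarrow> x mod p ^ a = fst conc_child mod p ^ a \<and> z \<in> cl p q A (Suc i') 0 x 0" for z
      proof -
        have 1: "z \<in> cl p q S' i'' 0 x 0 \<longleftrightarrow> z \<in> S' \<and> fst z mod p ^ i'' = x mod p ^ i''" for S' i'' unfolding cl_def by simp
        have 2: "z \<in> S \<longleftrightarrow> z \<in> A \<and> fst z mod p ^ a = fst conc_child mod p ^ a" using S(1) node_iff by blast
        show ?thesis
        proof (cases "fst z mod p ^ Suc i' = x mod p ^ Suc i'")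
          case True
          show ?thesis unfolding 1 2 imp[OF True] using True by blast
        next
          case False
          then show ?thesis unfolding 1 by blast
        qed
      qed
      then have "cl p q S (Suc i') 0 x 0 = (if x mod p ^ a = fst conc_child mod p ^ a then cl p q A (Suc i') 0 x 0 else {})"
        by (simp add: set_eq_iff)
      then show ?thesis unfolding cn_def by simp
    qed
    show ?thesis unfolding i' zr.simps c
    proof (intro allI impI)
      fix x x' assume x: "x mod p ^ i' = x' mod p ^ i'"
      then have "x mod p ^ a = x' mod p ^ a" using i'(2) mod_pow_mono by blast
      moreover have "cn p q A (Suc i') 0 x 0 = cn p q A (Suc i') 0 x' 0" using zA x unfolding zr.simps by blast
      ultimately show "(if x mod p ^ a = fst conc_child mod p ^ a then cn p q A (Suc i') 0 x 0 else 0) =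
          (if x' mod p ^ a = fst conc_child mod p ^ a then cn p q A (Suc i') 0 x' 0 else 0)" by simp
    qed
  qed
  have fS: "finite S" unfolding S_def using fin cl_fin by blast
  have "p ^ card ((\<lambda>i. i - 1) ` (J \<union> V)) dvd card S"
  proof (rule pow_dvd_card[OF fS p0(1)])
    show "(\<lambda>i. i - 1) ` (J \<union> V) \<subseteq> {..<m}" using s unfolding J_def V_def by auto
    fix i assume "i \<in> (\<lambda>i. i - 1) ` (J \<union> V)"
    then obtain i0 where "i0 \<in> J \<union> V" "i = i0 - 1" by blast
    then have "i0 \<in> J \<union> V" "Suc i = i0" unfolding J_def V_def by auto
    then show "zr p q S (Suc i) 0" using zJ zV by blast
  qed
  moreover have "card ((\<lambda>i. i - 1) ` (J \<union> V)) = card (J \<union> V)"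
    by (rule card_image) (auto intro!: inj_onI simp: J_def V_def)
  moreover have "card (J \<union> V) = card V + card (J - V)"
    using card_Un_disjoint[of V "J - V"] fin3 by (simp add: Un_commute)
  ultimately have dS: "p ^ (card V + card (J - V)) dvd card S" by simp
  have "U = {1..a} \<union> V" using U_low unfolding V_def U_def by auto
  moreover have "{1..a} \<inter> V = {}" unfolding V_def by auto
  ultimately have cU: "card U = a + card V" using card_Un_disjoint[of "{1..a}" V] fin3 by simp
  have "p ^ (card V + card (J - V)) * p ^ a dvd card S * p ^ a" using dS by (rule mult_dvd_mono) simp
  then have dM: "p ^ (card U + card (J - V)) dvd M" unfolding S(2) cU by (simp add: power_add mult_ac)
  \<comment> \<open>A level in both sets does not come from a gap, so it is already counted by
    \<open>rho s\<close>. The rest, \<open>J - V\<close>, is new divisibility, and it alone has to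
    absorb the factor \<open>q\<close> in the size of \<open>C\<close>.\<close>
  have "J \<inter> V \<subseteq> Suc ` ({a..<s} - G)"
  proof
    fix i assume i: "i \<in> J \<inter> V"
    then obtain i' where i': "i = Suc i'" "a \<le> i'" "i' < s" unfolding J_def by (cases i) auto
    have "zr p q A i 0" using i unfolding V_def U_def by blast
    then have "i' \<notin> G" using gap_not_uniform[OF i'(3)] unfolding i'(1) by blast
    then have "i' \<in> {a..<s} - G" using i'(2,3) by simp
    then show "i \<in> Suc ` ({a..<s} - G)" unfolding i'(1) by (rule imageI)
  qed
  then have "card (J \<inter> V) \<le> card (Suc ` ({a..<s} - G))" by (intro card_mono) auto
  also have "\<dots> = card ({a..<s} - G)" by (simp add: card_image)
  finally have cJV: "a + card (J \<inter> V) \<le> rho s"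
  proof -
    assume h: "card (J \<inter> V) \<le> card ({a..<s} - G)"
    have "{..<s} - G = {..<a} \<union> ({a..<s} - G)" using a by auto
    moreover have "card ({..<a} \<union> ({a..<s} - G)) = card {..<a} + card ({a..<s} - G)" by (rule card_Un_disjoint) auto
    ultimately show ?thesis using h unfolding rho_def by simp
  qed
  have "(J \<inter> V) \<inter> (J - V) = {}" by blast
  then have "card J = card (J \<inter> V) + card (J - V)"
    using card_Un_disjoint[of "J \<inter> V" "J - V"] fin3 by (simp add: Int_Diff_Un)
  then have "q * p ^ rho s \<le> p ^ (a + card (J \<inter> V)) * p ^ card (J - V)" using q1 by (simp add: power_add mult_ac)
  also have "\<dots> \<le> p ^ rho s * p ^ card (J - V)" using cJV p0 by (intro mult_le_mono1 power_increasing) auto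
  finally have "q \<le> p ^ card (J - V)" using p0 by simp
  then show ?thesis using dM by blast
qed

text \<open>After scaling, concentrated nodes contribute multiples of \<open>q\<close>. A spread
  node gives the same mass to each residue \<open>e\<close> by \<open>spread_uniform\<close>, so
  \<open>K\<close>, the number of spread nodes at depth \<open>s\<close> above \<open>c\<close>, is
  independent of \<open>e\<close>.\<close>

lemma class_masses:
  "\<exists>K. \<forall>e<q. \<exists>k. cn p q A 1 1 c e * (q * p ^ rho s) = M * (q * k + K)"
proof (rule exI[of _ "card {r \<in> {..<p ^ s}. r mod p = c mod p \<and> \<not> conc s r}"], intro allI impI)
  fix e assume e: "e < q"
  let ?K = "{r \<in> {..<p ^ s}. r mod p = c mod p \<and> \<not> conc s r}"
  let ?N1 = "{z \<in> A. fst z mod p = c mod p \<and> snd z mod q = e \<and> conc s (fst z)}"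
  let ?N2 = "{z \<in> A. fst z mod p = c mod p \<and> snd z mod q = e \<and> \<not> conc s (fst z)}"
  have "cl p q A 1 1 c e = ?N1 \<union> ?N2" using e unfolding cl_def by auto
  moreover have "card (?N1 \<union> ?N2) = card ?N1 + card ?N2" by (rule card_Un_disjoint) (use fin in auto)
  ultimately have tot: "cn p q A 1 1 c e = card ?N1 + card ?N2" unfolding cn_def by simp
  obtain k where k: "p ^ rho s * card ?N1 = M * k" using invariants_s(2)[of s] unfolding conc_dvd_def by blast
  have N2: "card ?N2 * (q * p ^ rho s) = M * card ?K"
  proof -
    have "(\<lambda>z. fst z mod p ^ s) ` ?N2 \<subseteq> ?K"
    proof
      fix r assume "r \<in> (\<lambda>z. fst z mod p ^ s) ` ?N2"
      then obtain z where z: "z \<in> ?N2" "r = fst z mod p ^ s" by blast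
      have "r mod p ^ s = fst z mod p ^ s" using z by simp
      then have c1: "r mod p ^ 1 = fst z mod p ^ 1" by (rule mod_pow_mono) (use s(4) in simp)
      have c2: "conc s r = conc s (fst z)" by (rule conc_cong) fact
      have "r < p ^ s" using z(2) p0 by simp
      then show "r \<in> ?K" using z(1) c1 c2 by simp
    qed
    then have "card ?N2 = (\<Sum>r\<in>?K. card {z \<in> ?N2. fst z mod p ^ s = r})"
      using sum.group[of ?N2 ?K "\<lambda>z. fst z mod p ^ s" "\<lambda>_. 1::nat"] fin by simp
    also have "\<dots> = (\<Sum>r\<in>?K. cn p q A s 1 r e)"
    proof (rule sum.cong[OF refl])
      fix r assume r: "r \<in> ?K"
      have "{z \<in> ?N2. fst z mod p ^ s = r} = cl p q A s 1 r e"
      proof (intro equalityI subsetI)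
        fix z assume "z \<in> cl p q A s 1 r e"
        then have z: "z \<in> A" "fst z mod p ^ s = r mod p ^ s" "snd z mod q = e" using e unfolding cl_def by auto
        have "fst z mod p ^ 1 = r mod p ^ 1" using z(2) by (rule mod_pow_mono) (use s in simp)
        then show "z \<in> {z \<in> ?N2. fst z mod p ^ s = r}" using z r conc_cong[OF z(2)] by simp
      qed (use r e in \<open>auto simp: cl_def\<close>)
      then show "card {z \<in> ?N2. fst z mod p ^ s = r} = cn p q A s 1 r e" unfolding cn_def by simp
    qed
    finally have "card ?N2 * (q * p ^ rho s) = (\<Sum>r\<in>?K. cn p q A s 1 r e * (q * p ^ rho s))" by (simp only: sum_distrib_right)
    also have "\<dots> = (\<Sum>r\<in>?K. M)" by (rule sum.cong[OF refl]) (use spread_uniform in simp)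
    finally show ?thesis by simp
  qed
  have "cn p q A 1 1 c e * (q * p ^ rho s) = q * (p ^ rho s * card ?N1) + card ?N2 * (q * p ^ rho s)"
    unfolding tot by (simp add: algebra_simps)
  also have "\<dots> = M * (q * k + card ?K)" unfolding k N2 by (simp add: algebra_simps)
  finally show "\<exists>k. cn p q A 1 1 c e * (q * p ^ rho s) = M * (q * k + card ?K)" by blast
qed

lemma rho_pos: "rho s > 0" using rho_mono[of a s] rho_a[of a] a by simp

lemma zr_A_1: "zr p q A 1 0" using zr_A_s[of 0] s(4) a(4) a(5)[of 0] by simp

end

section \<open>Equidistribution modulo \<open>p * q\<close> and the numerical bounds\<close>

lemma Suc_mod_neq: "q \<ge> 2 \<Longrightarrow> Suc k mod q \<noteq> k mod q"
  by (simp add: mod_Suc)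

lemma swap_swap[simp]: "prod.swap ` prod.swap ` S = S"
  by (simp add: image_image)

text \<open>
  By \<open>class_masses\<close> the \<open>q\<close> classes modulo \<open>p * q\<close> with fixed first coordinate have, after scaling, masses in one residue
  class modulo \<open>q\<close>; as these masses add up to \<open>q\<close> and each is at most \<open>p < q\<close>, they are equal.
\<close>

lemma uniform_pq_aux:
  assumes c1: "chain p q m n A B" and c2: "chain q p n m (prod.swap ` A) (prod.swap ` B)" and pq: "p < q"
  shows "p * q * cn p q A 1 1 c e = card A"
proof -
  interpret C1: chain p q m n A B by fact
  interpret C2: chain q p n m "prod.swap ` A" "prod.swap ` B" by fact
  define M where "M = card A"
  have M0: "M > 0" using C1.p0 unfolding M_def by simp
  have cM: "card (prod.swap ` A) = M" unfolding M_def by (simp add: card_image)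
  define t where "t = cn p q A 1 1"
  obtain r where r: "C1.rho C1.s = Suc r" using C1.rho_pos by (cases "C1.rho C1.s") auto
  obtain r2 where r2: "C2.rho C2.s = Suc r2" using C2.rho_pos by (cases "C2.rho C2.s") auto
  have d2: "M dvd (t c e * (p * q)) * q ^ r2" if c: "c < p" for c e
  proof -
    obtain K where "\<forall>e'<p. \<exists>k. cn q p (prod.swap ` A) 1 1 e e' * (p * q ^ C2.rho C2.s) = card (prod.swap ` A) * (p * k + K)"
      using C2.class_masses by blast
    then obtain k where "cn q p (prod.swap ` A) 1 1 e c * (p * q ^ C2.rho C2.s) = card (prod.swap ` A) * (p * k + K)" using c by blast
    then have "t c e * (p * q) * q ^ r2 = M * (p * k + K)" unfolding cn_swap cM r2 t_def by (simp add: mult_ac)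
    then show ?thesis by (metis dvd_triv_left)
  qed
  have d1: "\<exists>K. \<forall>e<q. \<exists>k. (t c e * (p * q)) * p ^ r = M * (q * k + K)" for c
    using C1.class_masses[of c] unfolding r M_def[symmetric] t_def[symmetric] by (simp add: mult_ac)
  \<comment> \<open>One walk gives divisibility up to a power of \<open>p\<close>, the other up to a
    power of \<open>q\<close>; the greatest common divisor removes both powers.\<close>
  have dM: "M dvd t c e * (p * q)" if c: "c < p" and e: "e < q" for c e
  proof -
    have "M dvd (t c e * (p * q)) * p ^ r" using d1[of c] e by (metis dvd_triv_left)
    then have "M dvd gcd ((t c e * (p * q)) * p ^ r) ((t c e * (p * q)) * q ^ r2)" using d2[OF c] by (rule gcd_greatest)
    also have "\<dots> = (t c e * (p * q)) * gcd (p ^ r) (q ^ r2)" by (rule gcd_mult_distrib_nat[symmetric])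
    also have "gcd (p ^ r) (q ^ r2) = 1"
      using C1.pr primes_coprime[of p q] by (simp add: coprime_iff_gcd_eq_1[symmetric])
    finally show ?thesis by simp
  qed
  define mu where "mu c e = t c e * (p * q) div M" for c e
  have mu: "t c e * (p * q) = M * mu c e" if "c < p" "e < q" for c e using dM[OF that] unfolding mu_def by simp
  have sum_e: "(\<Sum>e<q. mu c e) = q" if c: "c < p" for c
  proof -
    have "cn p q A 1 0 c 0 = (\<Sum>e<q. t c e)" using cn_split_q[OF C1.fin(1) C1.p0(2), of p 1 0 c 0] unfolding t_def by simp
    moreover have "p * cn p q A 1 0 c 0 = M"
    proof -
      have "M = cn p q A 0 0 0 0" unfolding M_def cn_def cl_def by simp
      also have "\<dots> = (\<Sum>u<p. cn p q A (Suc 0) 0 u 0)" using cn_split_p[OF C1.fin(1) C1.p0(1), of q 0 0 0 0] by simp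
      also have "\<dots> = (\<Sum>u<p. cn p q A 1 0 c 0)"
        by (rule sum.cong[OF refl]) (use C1.zr_A_1[unfolded One_nat_def zr.simps] in auto)
      finally show ?thesis by simp
    qed
    ultimately have "p * (\<Sum>e<q. t c e) = M" by simp
    then have "M * q = (\<Sum>e<q. t c e) * (p * q)" by (simp add: mult_ac)
    also have "\<dots> = (\<Sum>e<q. M * mu c e)" unfolding sum_distrib_right by (rule sum.cong[OF refl]) (use mu c in simp)
    also have "\<dots> = M * (\<Sum>e<q. mu c e)" by (simp add: sum_distrib_left)
    finally show ?thesis using M0 by simp
  qed
  have sum_c: "(\<Sum>c<p. mu c e) = p" if e: "e < q" for e
  proof -
    have "cn p q A 0 1 0 e = (\<Sum>c<p. t c e)" using cn_split_p[OF C1.fin(1) C1.p0(1), of q 0 1 0 e] unfolding t_def by simp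
    then have "q * (\<Sum>c<p. t c e) = M" using C1.class_q[of e] unfolding M_def by simp
    then have "M * p = (\<Sum>c<p. t c e) * (p * q)" by (simp add: mult_ac)
    also have "\<dots> = (\<Sum>c<p. M * mu c e)" unfolding sum_distrib_right by (rule sum.cong[OF refl]) (use mu e in simp)
    also have "\<dots> = M * (\<Sum>c<p. mu c e)" by (simp add: sum_distrib_left)
    finally show ?thesis using M0 by simp
  qed
  have mu1: "mu c e \<ge> 1" if c: "c < p" and e: "e < q" for c e
  proof -
    obtain K where K: "\<And>e. e < q \<Longrightarrow> \<exists>k. (t c e * (p * q)) * p ^ r = M * (q * k + K)" using d1[of c] by blast
    have K': "\<exists>k. mu c e * p ^ r = q * k + K" if e: "e < q" for e
    proof -
      obtain k where "(t c e * (p * q)) * p ^ r = M * (q * k + K)" using K[OF e] by blast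
      then have "M * (mu c e * p ^ r) = M * (q * k + K)" unfolding mu[OF c e] by (simp add: mult_ac)
      then show ?thesis using M0 by auto
    qed
    \<comment> \<open>For \<open>K = 0\<close> the prime \<open>q\<close> would divide every
      \<open>mu c e\<close>, which is at most \<open>p < q\<close>; all of them would be 0, although
      they add up to \<open>q\<close>.\<close>
    have "K > 0"
    proof (rule ccontr)
      assume "\<not> K > 0"
      have "mu c e = 0" if e: "e < q" for e
      proof -
        obtain k where "mu c e * p ^ r = q * k" using K'[OF e] \<open>\<not> K > 0\<close> by auto
        then have "q dvd mu c e * p ^ r" by simp
        then have "q dvd mu c e" using C1.pr C1.q_not_dvd prime_dvd_mult_iff by blast
        moreover have "mu c e \<le> (\<Sum>c<p. mu c e)" by (rule member_le_sum) (use c in auto)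
        ultimately show ?thesis using sum_c[OF e] pq by (metis dvd_imp_le le_less_trans not_le neq0_conv)
      qed
      then show False using sum_e[OF c] C1.p0 by simp
    qed
    then show ?thesis using K'[OF e] by (metis One_nat_def Suc_leI add_gr_0 gr0I mult_eq_0_iff less_numeral_extra(3))
  qed
  have mu_eq: "mu c e = 1" if c: "c < p" and e: "e < q" for c e
  proof -
    have "(\<Sum>e<q. mu c e - 1) = (\<Sum>e<q. mu c e) - (\<Sum>e<q. 1)" by (rule sum_subtractf_nat) (use mu1 c in auto)
    then have "(\<Sum>e<q. mu c e - 1) = 0" using sum_e[OF c] by simp
    then have "\<forall>e\<in>{..<q}. mu c e - 1 = 0" by (subst (asm) sum_eq_0_iff) auto
    then have "mu c e - 1 = 0" using e by blast
    then show ?thesis using mu1[OF c e] by linarith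
  qed
  have "p * q * t (c mod p) (e mod q) = M" using mu[of "c mod p" "e mod q"] mu_eq[of "c mod p" "e mod q"] C1.p0 by (simp add: mult.commute)
  moreover have "t (c mod p) (e mod q) = t c e" unfolding t_def by (rule cn_cong) simp_all
  ultimately show ?thesis unfolding t_def M_def by simp
qed

lemma uniform_pq:
  assumes c1: "chain p q m n A B" and c2: "chain q p n m (prod.swap ` A) (prod.swap ` B)"
  shows "p * q * cn p q A 1 1 c e = card A"
proof (cases "p < q")
  case True then show ?thesis using uniform_pq_aux[OF c1 c2] by blast
next
  case False
  then have "q < p" using chain.pr(3)[OF c1] by simp
  from uniform_pq_aux[OF c2 _ this, unfolded swap_swap, OF c1, of e c] show ?thesis
    unfolding cn_swap by (simp add: card_image mult_ac)
qed

lemma final_bound: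
  assumes c1: "chain p q m n A B" and c2: "chain q p n m (prod.swap ` A) (prod.swap ` B)"
    and c3: "chain p q m n B A" and c4: "chain q p n m (prod.swap ` B) (prod.swap ` A)"
  shows "p\<^sup>2 * q ^ 4 < p ^ m" and "p < q \<Longrightarrow> 10 \<le> m" and "q < p \<Longrightarrow> 7 \<le> m"
proof -
  interpret C1: chain p q m n A B by fact
  interpret C2: chain q p n m "prod.swap ` A" "prod.swap ` B" by fact
  interpret C3: chain p q m n B A by fact
  interpret C4: chain q p n m "prod.swap ` B" "prod.swap ` A" by fact
  define M where "M = card A"
  have M0: "M > 0" using C1.p0 unfolding M_def by simp
  have cM: "card (prod.swap ` A) = M" "card B = M" using C1.p0(6) unfolding M_def by (simp_all add: card_image)
  define u where "u = card C1.U"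
  define v where "v = card {j \<in> {1..n}. zr p q A 0 j}"
  have vU: "C2.U = {j \<in> {1..n}. zr p q A 0 j}" unfolding C2.U_def zr_swap ..
  obtain x where x: "q \<le> p ^ x" "p ^ (u + x) dvd M" using C1.divisibility unfolding u_def M_def by blast
  obtain y where y: "p \<le> q ^ y" "q ^ (v + y) dvd M" using C2.divisibility unfolding vU v_def cM by blast
  \<comment> \<open>The walk for the exchanged pair is taken because its size bound involves the
    pure \<open>q\<close>-zeros of \<open>A\<close>: their number \<open>v\<close> is also the
    exponent that \<open>C2.divisibility\<close> puts into \<open>M\<close>, and it cancels.\<close>
  define g where "g = C3.s - C3.rho C3.s"
  have g: "q \<le> p ^ g" using C3.gap_large unfolding g_def .
  have size: "M * p ^ g \<le> p ^ m * q ^ v" using C3.size_bound unfolding cM g_def v_def .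
  have "coprime (p ^ (u + x)) (q ^ (v + y))" using C1.pr primes_coprime[of p q] by simp
  then have "p ^ (u + x) * q ^ (v + y) dvd M" using x(2) y(2) by (rule divides_mult[rotated 2])
  then have "p ^ (u + x) * q ^ (v + y) \<le> M" using M0 by (rule dvd_imp_le)
  then have "p ^ (u + x) * q ^ (v + y) * p ^ g \<le> p ^ m * q ^ v" using size by (meson mult_le_mono1 le_trans)
  then have "(p ^ (u + x + g) * q ^ y) * q ^ v \<le> p ^ m * q ^ v" by (simp add: power_add mult_ac)
  then have main: "p ^ (u + x + g) * q ^ y \<le> p ^ m" using C1.p0 by simp
  have zm: "zr p q A m 0" using C4.zr_B_0n unfolding zr_swap .
  \<comment> \<open>One more uniform level, beyond \<open>a\<close>: the walk for \<open>q\<close>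
    on the exchanged pair ends in a zero of \<open>A\<close> of order \<open>p ^ m\<close>.\<close>
  have "insert m {1..C1.a} \<subseteq> C1.U" using C1.U_low zm C1.a(3) unfolding C1.U_def by auto
  then have "card (insert m {1..C1.a}) \<le> u" unfolding u_def by (intro card_mono) (auto simp: C1.U_def)
  then have ua: "C1.a + 1 \<le> u" using C1.a(3) by simp
  obtain a' where a': "C1.a = Suc a'" using C1.a(4) by (cases C1.a) auto
  \<comment> \<open>A concentrated node of mass \<open>M / p ^ a\<close> lies in one class modulo
    \<open>p * q\<close>, whose mass is \<open>M / (p * q)\<close>.\<close>
  have qa: "q \<le> p ^ a'"
  proof -
    obtain c e where ce: "card (cl p q A C1.a 1 c e) * p ^ C1.a = M" using C1.conc_node unfolding M_def by blast
    have "card (cl p q A C1.a 1 c e) \<le> cn p q A 1 1 c e"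
      unfolding cn_def[symmetric] by (rule cn_mono[OF C1.fin(1)]) (use C1.a in auto)
    then have "p * q * card (cl p q A C1.a 1 c e) \<le> M"
      using uniform_pq[OF c1 c2, of c e] unfolding M_def[symmetric] by (metis mult_le_mono2)
    then have "card (cl p q A C1.a 1 c e) * (p * q) \<le> card (cl p q A C1.a 1 c e) * p ^ C1.a" unfolding ce by (simp add: mult.commute)
    moreover have "card (cl p q A C1.a 1 c e) > 0" using ce M0 by (metis gr0I mult_0)
    ultimately have "p * q \<le> p * p ^ a'" unfolding a' by simp
    then show ?thesis using C1.p0 by simp
  qed
  have ne: "q \<noteq> p ^ k" for k using C1.q_not_dvd[of k] by (metis dvd_refl)
  have ne2: "p \<noteq> q ^ k" for k using C2.q_not_dvd[of k] by (metis dvd_refl)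
  have lt: "q < p ^ a'" "q < p ^ x" "q < p ^ g" "p < q ^ y" using qa x(1) g y(1) ne ne2 by (metis le_neq_implies_less)+
  have y1: "y \<ge> 1" using lt(4) C1.p0 by (cases y) auto
  have qy: "q \<le> q ^ y" using y1 C1.p0 by (metis power_increasing power_one_right One_nat_def Suc_leI)
  have le: "p ^ (a' + 2 + x + g) * q ^ y \<le> p ^ m"
  proof -
    have "p ^ (a' + 2 + x + g) \<le> p ^ (u + x + g)" using ua a' C1.p0 by (intro power_increasing) auto
    then show ?thesis using main by (meson mult_le_mono1 le_trans)
  qed
  have "p\<^sup>2 * q ^ 4 = p\<^sup>2 * (q * q * q) * q" by (simp add: power4_eq_xxxx mult_ac)
  also have "\<dots> < p\<^sup>2 * (p ^ a' * p ^ x * p ^ g) * q"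
  proof -
    have "q * q * q < p ^ a' * p ^ x * p ^ g" using lt C1.p0(1) by (intro mult_strict_mono) auto
    then show ?thesis using C1.p0 by simp
  qed
  also have "\<dots> \<le> p\<^sup>2 * (p ^ a' * p ^ x * p ^ g) * q ^ y" using qy by simp
  also have "\<dots> = p ^ (a' + 2 + x + g) * q ^ y" by (simp add: power_add mult_ac power2_eq_square)
  finally show "p\<^sup>2 * q ^ 4 < p ^ m" using le by simp
  have strict: "p ^ (a' + 2 + x + g + 1) < p ^ m"
  proof -
    have "p ^ (a' + 2 + x + g + 1) = p ^ (a' + 2 + x + g) * p" by simp
    also have "\<dots> < p ^ (a' + 2 + x + g) * q ^ y" using lt(4) C1.p0 by simp
    also note le
    finally show ?thesis .
  qed
  have p1: "p > 1" using C1.p0 by simp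
  have m: "a' + 2 + x + g + 1 < m" using strict power_less_imp_less_exp[OF p1] by blast
  show "10 \<le> m" if "p < q"
  proof -
    have "k \<ge> 2" if "q < p ^ k" for k
    proof (rule ccontr)
      assume "\<not> k \<ge> 2"
      then have "p ^ k \<le> p ^ 1" using p1 by (intro power_increasing) auto
      then show False using that \<open>p < q\<close> by simp
    qed
    then have "a' \<ge> 2" "x \<ge> 2" "g \<ge> 2" using lt by blast+
    then show ?thesis using m by simp
  qed
  show "7 \<le> m" if "q < p"
  proof -
    have "k \<ge> 1" if "q < p ^ k" for k using that C1.p0 by (cases k) auto
    then have "a' \<ge> 1" "x \<ge> 1" "g \<ge> 1" using lt by blast+
    then show ?thesis using m by simp
  qed
qed

definition top_inv :: "nat \<Rightarrow> nat \<Rightarrow> (nat \<times> nat) set \<Rightarrow> bool" where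
  "top_inv p m S \<longleftrightarrow> (\<forall>x x' y. (x, y) \<in> S \<longrightarrow> x' < p ^ m \<longrightarrow> x' mod p ^ (m - 1) = x mod p ^ (m - 1) \<longrightarrow> (x', y) \<in> S)"

definition all_levels :: "nat \<Rightarrow> nat \<Rightarrow> (nat \<times> nat) set \<Rightarrow> bool" where
  "all_levels p m S \<longleftrightarrow> (\<forall>v<m. \<exists>z\<in>S. \<exists>z'\<in>S. lv p m (fst z) (fst z') = v)"

lemma cn_top:
  assumes "S \<subseteq> {..<p ^ m} \<times> {..<q ^ n}" "x < p ^ m" "y < q ^ n"
  shows "cn p q S m n x y = (if (x, y) \<in> S then 1 else 0)"
proof -
  have "z = (x, y)" if "z \<in> S" "fst z mod p ^ m = x mod p ^ m" "snd z mod q ^ n = y mod q ^ n" for z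
  proof -
    have "fst z < p ^ m" "snd z < q ^ n" using that(1) assms(1) by auto
    then show ?thesis using that assms by (simp add: prod_eq_iff)
  qed
  then have sub: "cl p q S m n x y \<subseteq> {(x, y)}" unfolding cl_def by blast
  have mem: "(x, y) \<in> cl p q S m n x y \<longleftrightarrow> (x, y) \<in> S" unfolding cl_def by simp
  show ?thesis
  proof (cases "(x, y) \<in> S")
    case True
    then have "cl p q S m n x y = {(x, y)}" using sub mem by blast
    then show ?thesis using True unfolding cn_def by simp
  next
    case False
    then have "cl p q S m n x y = {}" using sub mem by blast
    then show ?thesis using False unfolding cn_def by simp
  qed
qed

lemma chainI:
  assumes sp: "spair p q m n A B" and pr: "prime p" "prime q" "p \<noteq> q" and mn: "m > 0" "n > 0"
    and l: "all_levels p m A" "all_levels q n (prod.swap ` A)" and ni: "\<not> top_inv p m B" "\<not> top_inv q n (prod.swap ` B)"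
  shows "chain p q m n A B"
proof -
  note D = spairD[OF sp]
  have q0: "q > 0" "p > 0" "q \<ge> 2" using pr prime_gt_0_nat prime_ge_2_nat by auto
  have lq0: "lv q n y y' = 0 \<longleftrightarrow> y mod q \<noteq> y' mod q" for y y' using lv_iff[of 1 n q y y'] mn by auto
  have lp0: "lv p m y y' = 0 \<longleftrightarrow> y mod p \<noteq> y' mod p" for y y' using lv_iff[of 1 m p y y'] mn by auto
  obtain b b' where b: "b \<in> A" "b' \<in> A" "fst b mod p \<noteq> fst b' mod p" using l(1) mn lp0 unfolding all_levels_def by blast
  obtain c c' where c: "c \<in> A" "c' \<in> A" "snd c mod q \<noteq> snd c' mod q" using l(2) mn lq0 unfolding all_levels_def by auto
  \<comment> \<open>If \<open>b\<close> and \<open>b'\<close> agree modulo \<open>q\<close>, a point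
    with another residue modulo \<open>q\<close> differs from at least one of them modulo
    \<open>p\<close>.\<close>
  have "\<exists>z\<in>A. \<exists>z'\<in>A. fst z mod p \<noteq> fst z' mod p \<and> snd z mod q \<noteq> snd z' mod q"
  proof (rule ccontr)
    assume H: "\<not> ?thesis"
    then have e: "snd b mod q = snd b' mod q" using b by blast
    obtain d where d: "d \<in> A" "snd d mod q \<noteq> snd b mod q" using c by metis
    then have "fst d mod p = fst b mod p" "fst d mod p = fst b' mod p" using H b e by metis+
    then show False using b(3) by simp
  qed
  then obtain z z' where z: "z \<in> A" "z' \<in> A" "lv p m (fst z) (fst z') = 0" "lv q n (snd z) (snd z') = 0" using lq0 lp0 by blast
  then have "z \<noteq> z'" using mn by auto
  from D(6)[OF z(1,2) this] have zmn: "zr p q B m n" using z by simp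
  obtain x y y' where xy: "(x, y) \<in> B" "y' < q ^ n" "y' mod q ^ (n - 1) = y mod q ^ (n - 1)" "(x, y') \<notin> B"
    using ni(2) unfolding top_inv_def by force
  have "x < p ^ m" "y < q ^ n" using xy D(2) by auto
  then have "cn p q B m n x y \<noteq> cn p q B m n x y'" using cn_top[OF D(2)] xy by simp
  then have n1: "\<exists>x y y'. y mod q ^ (n - 1) = y' mod q ^ (n - 1) \<and> cn p q B m n x y \<noteq> cn p q B m n x y'" using xy(3) by metis
  obtain x x' y where xx: "(x, y) \<in> B" "x' < p ^ m" "x' mod p ^ (m - 1) = x mod p ^ (m - 1)" "(x', y) \<notin> B"
    using ni(1) unfolding top_inv_def by blast
  have lt: "x < p ^ m" "y < q ^ n" using xx D(2) by auto
  define w where "w = y + q ^ (n - 1)"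
  have w: "w mod q ^ (n - 1) = y mod q ^ (n - 1)" unfolding w_def by simp
  obtain m' n' where mn': "m = Suc m'" "n = Suc n'" using mn by (cases m; cases n) auto
  \<comment> \<open>Since \<open>(x, y)\<close> is in \<open>B\<close> but its translate
    \<open>(x', y)\<close> by an element of order \<open>p\<close> is not, the four-term relation
    forces \<open>(x, y + q ^ (n - 1))\<close> into \<open>B\<close>, a point at a difference of
    order \<open>q\<close>.\<close>
  have "cn p q B m n x y + cn p q B m n x' w = cn p q B m n x w + cn p q B m n x' y"
    using zmn w xx(3) unfolding mn' zr.simps diff_Suc_1 by metis
  then have "cn p q B m n x w > 0" using cn_top[OF D(2) lt] cn_top[OF D(2) xx(2) lt(2)] xx by simp
  then obtain d where d: "d \<in> B" "fst d mod p ^ m = x mod p ^ m" "snd d mod q ^ n = w mod q ^ n"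
    unfolding cn_pos_iff[OF spair_finite(2)[OF sp]] by blast
  have wn: "w mod q ^ Suc (n - 1) \<noteq> y mod q ^ Suc (n - 1)"
  proof
    assume "w mod q ^ Suc (n - 1) = y mod q ^ Suc (n - 1)"
    then have "dg q (n - 1) w = dg q (n - 1) y" unfolding mod_eq_dg by blast
    moreover have "w div q ^ (n - 1) = Suc (y div q ^ (n - 1))" unfolding w_def using q0 by simp
    ultimately have "Suc (y div q ^ (n - 1)) mod q = (y div q ^ (n - 1)) mod q" unfolding dg_def by simp
    then show False using Suc_mod_neq[OF q0(3)] by blast
  qed
  have sn: "Suc (n - 1) = n" using mn by simp
  have l1: "lv q n (snd d) y = n - 1"
  proof (rule lv_eqI)
    have "snd d mod q ^ (n - 1) = w mod q ^ (n - 1)" using d(3) by (rule mod_pow_mono) simp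
    then show "snd d mod q ^ (n - 1) = y mod q ^ (n - 1)" using w by simp
    show "snd d mod q ^ Suc (n - 1) \<noteq> y mod q ^ Suc (n - 1)" using d(3) wn unfolding sn by simp
  qed (use mn in simp)
  have l2: "lv p m (fst d) x = m" using lv_iff[of m m p "fst d" x] lv_le[of p m "fst d" x] d(2) by simp
  have "snd d \<noteq> y" using d(3) wn unfolding sn by metis
  then have "d \<noteq> (x, y)" by auto
  from D(5)[OF d(1) xx(1) this] have z01: "zr p q A 0 1" using l1 l2 mn by simp
  show ?thesis
    by unfold_locales (use sp pr mn n1 z01 zmn l(1) in \<open>auto simp: all_levels_def\<close>)
qed

definition reducible where "reducible p m A B \<longleftrightarrow> m > 0 \<and> (\<not> all_levels p m A \<or> \<not> all_levels p m B \<or> top_inv p m A \<or> top_inv p m B)"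

lemma reduce_p:
  assumes sp: "spair p q m n A B" and pr: "prime p" "prime q" "p \<noteq> q" and r: "reducible p m A B"
    and IH: "\<And>A' B'. spair p q (m - 1) n A' B' \<Longrightarrow> good p q (m - 1) n A' B'"
  shows "good p q m n A B"
proof -
  obtain k where k: "m = Suc k" using r unfolding reducible_def by (cases m) auto
  have IH': "\<And>A' B'. spair p q k n A' B' \<Longrightarrow> good p q k n A' B'" using IH k by simp
  have abs: "good p q m n A B" if "spair p q m n A B" "\<not> all_levels p m B" for A B
  proof -
    note sp2 = that(1)[unfolded k] and l2 = that(2)
    obtain v where v: "v \<le> k" "\<And>z z'. z \<in> B \<Longrightarrow> z' \<in> B \<Longrightarrow> lv p (Suc k) (fst z) (fst z') \<noteq> v"
      using l2 unfolding all_levels_def k less_Suc_eq_le by blast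
    show ?thesis unfolding k by (rule good_of_absent_level[OF sp2 pr v IH'])
  qed
  have inv: "good p q m n A B" if "spair p q m n A B" "top_inv p m A" for A B
    using good_of_invariant[OF that(1)[unfolded k] pr _ IH'] that(2) unfolding top_inv_def k diff_Suc_1 by blast
  show ?thesis
    using r abs[OF sp] abs[OF spair_sym[OF sp]] inv[OF sp] inv[OF spair_sym[OF sp]] good_sym unfolding reducible_def by blast
qed

text \<open>A pair in \<open>B\<close> at \<open>q\<close>-level 0 gives a zero of \<open>A\<close>
  of order \<open>q ^ n\<close>; without a \<open>p\<close>-part this condition is invariance under
  the subgroup of order \<open>q\<close>. So a pair with one prime only is always reducible.\<close>

lemma top_inv_of_trivial:
  assumes sp: "spair p q 0 n A B" and n: "n > 0" and l: "all_levels q n (prod.swap ` B)"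
  shows "top_inv q n (prod.swap ` A)"
  unfolding top_inv_def
proof (intro allI impI)
  note D = spairD[OF sp]
  fix y y' x assume h: "(y, x) \<in> prod.swap ` A" "y' < q ^ n" "y' mod q ^ (n - 1) = y mod q ^ (n - 1)"
  then have xy: "(x, y) \<in> A" by auto
  then have x0: "x = 0" "y < q ^ n" using D(1) by auto
  obtain b b' where b: "b \<in> B" "b' \<in> B" "lv q n (snd b) (snd b') = 0" using l n unfolding all_levels_def by auto
  then have "b \<noteq> b'" using n by auto
  have "lv p 0 (fst b) (fst b') = 0" using lv_le[of p 0] by simp
  then have z: "zr p q A 0 n" using D(5)[OF b(1,2) \<open>b \<noteq> b'\<close>] b(3) by simp
  obtain n' where n': "n = Suc n'" using n by (cases n) auto
  have "cn p q A 0 n 0 y' = cn p q A 0 n 0 y" using z h(3) unfolding n' zr.simps diff_Suc_1 by blast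
  moreover have "cn p q A 0 n 0 y = 1" using cn_top[OF D(1), of 0 y] x0 xy by simp
  moreover have "cn p q A 0 n 0 y' = (if (0, y') \<in> A then 1 else 0)" using cn_top[OF D(1), of 0 y'] h(2) by simp
  ultimately have "(0, y') \<in> A" by (metis zero_neq_one)
  then show "(y', x) \<in> prod.swap ` A" unfolding x0(1) by (metis image_eqI swap_simp)
qed

text \<open>A form of the hypotheses stable under exchanging the primes and lowering an exponent;
  multiplying out the power condition keeps it meaningful below exponent 2. Each alternative
  contradicts \<open>final_bound\<close> for one of the two orders of the primes.\<close>

definition small :: "nat \<Rightarrow> nat \<Rightarrow> nat \<Rightarrow> nat \<Rightarrow> bool" where
  "small p q m n \<longleftrightarrow> (p < q \<and> (m \<le> 9 \<or> n \<le> 6)) \<or> (q < p \<and> (n \<le> 9 \<or> m \<le> 6)) \<or> p ^ m \<le> p\<^sup>2 * q ^ 4 \<or> q ^ n \<le> q\<^sup>2 * p ^ 4"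

lemma small_swap: "small p q m n = small q p n m" unfolding small_def by auto

lemma small_pred: assumes "p > 0" "small p q m n" shows "small p q (m - 1) n"
proof -
  have "p ^ (m - 1) \<le> p ^ m" using assms(1) by (intro power_increasing) auto
  then show ?thesis using assms(2) unfolding small_def by auto
qed

theorem spair_good:
  assumes "spair p q m n A B" "prime p" "prime q" "p \<noteq> q" "small p q m n"
  shows "good p q m n A B"
  using assms
proof (induction "m + n" arbitrary: p q m n A B rule: less_induct)
  case less
  note sp = less.prems(1) and pr = less.prems(2-4) and sm = less.prems(5)
  note sw = spair_swap[OF sp]
  have p0: "p > 0" "q > 0" using pr prime_gt_0_nat by auto
  show ?case
  proof (cases "reducible p m A B")
    case True
    then have "m - 1 + n < m + n" unfolding reducible_def by simp
    from less.hyps[OF this _ pr small_pred[OF p0(1) sm]] show ?thesis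
      using reduce_p[OF sp pr True] by blast
  next
    case np: False
    show ?thesis
    proof (cases "reducible q n (prod.swap ` A) (prod.swap ` B)")
      case True
      then have "n > 0" unfolding reducible_def by blast
      then have lt: "n - 1 + m < m + n" by simp
      have "good q p n m (prod.swap ` A) (prod.swap ` B)"
        by (rule reduce_p[OF sw pr(2,1) pr(3)[symmetric] True])
           (use less.hyps[OF lt _ pr(2,1) pr(3)[symmetric] small_pred[OF p0(2)]] sm small_swap in blast)
      from good_swap[OF this] show ?thesis by simp
    next
      case nq: False
      consider "m = 0" "n = 0" | "m = 0" "n > 0" | "m > 0" "n = 0" | "m > 0" "n > 0" by blast
      then show ?thesis
      proof cases
        case 1
        have "A = {(0, 0)}" "B = {(0, 0)}" using spairD(1-3)[OF sp] spair_pos(3)[OF sp] 1 by auto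
        then have "ext p q m n B {} {}" "ext p q m n A (flip m {}) (flip n {})" using 1 unfolding ext_def flip_def by auto
        then show ?thesis unfolding good_def by blast
      next
        case 2
        have "top_inv q n (prod.swap ` A)" using top_inv_of_trivial[OF sp[unfolded 2(1)] 2(2)] nq 2 unfolding reducible_def by blast
        then show ?thesis using nq 2 unfolding reducible_def by blast
      next
        case 3
        have "top_inv p m A" using top_inv_of_trivial[OF sw[unfolded 3(2)] 3(1)] np 3 unfolding reducible_def by simp
        then show ?thesis using np 3 unfolding reducible_def by blast
      next
        case 4
        have P: "all_levels p m A" "all_levels p m B" "\<not> top_inv p m A" "\<not> top_inv p m B" using np 4 unfolding reducible_def by blast+
        have Q: "all_levels q n (prod.swap ` A)" "all_levels q n (prod.swap ` B)" "\<not> top_inv q n (prod.swap ` A)" "\<not> top_inv q n (prod.swap ` B)"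
          using nq 4 unfolding reducible_def by blast+
        note ps = pr(2,1) pr(3)[symmetric]
        have c1: "chain p q m n A B" by (rule chainI[OF sp pr 4 P(1) Q(1) P(4) Q(4)])
        have c3: "chain p q m n B A" by (rule chainI[OF spair_sym[OF sp] pr 4 P(2) Q(2) P(3) Q(3)])
        have c2: "chain q p n m (prod.swap ` A) (prod.swap ` B)"
          by (rule chainI[OF sw ps 4(2,1) Q(1) _ Q(4)]) (use P in simp_all)
        have c4: "chain q p n m (prod.swap ` B) (prod.swap ` A)"
          by (rule chainI[OF spair_sym[OF sw] ps 4(2,1) Q(2) _ Q(3)]) (use P in simp_all)
        note F1 = final_bound[OF c1 c2 c3 c4]
        note F2 = final_bound[OF c2 _ c4 _, unfolded swap_swap, OF c1 c3]
        show ?thesis using F1 F2 sm unfolding small_def by linarith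
      qed
    qed
  qed
qed

section \<open>Galois invariance of zeros\<close>

text \<open>The integral group ring of the cyclic group, viewed as functions of the frequency
  \<open>j\<close>. On whole functions, unlike single values, the coefficients are unique, so
  congruences between them make sense without cyclotomic Galois theory.\<close>

definition int_chars :: "nat \<Rightarrow> (int \<Rightarrow> complex) \<Rightarrow> bool" where
  "int_chars N g \<longleftrightarrow> (\<exists>c :: nat \<Rightarrow> int. \<forall>j. g j = (\<Sum>x<N. of_int (c x) * E N (int x * j)))"

lemma int_chars_add: "int_chars N g \<Longrightarrow> int_chars N h \<Longrightarrow> int_chars N (\<lambda>j. g j + h j)"
proof -
  assume "int_chars N g" "int_chars N h"
  then obtain c d where "\<And>j. g j = (\<Sum>x<N. of_int (c x) * E N (int x * j))" "\<And>j. h j = (\<Sum>x<N. of_int (d x) * E N (int x * j))"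
    unfolding int_chars_def by blast
  then have "\<forall>j. g j + h j = (\<Sum>x<N. of_int (c x + d x) * E N (int x * j))" by (simp add: ring_distribs sum.distrib)
  then show ?thesis unfolding int_chars_def by (intro exI[of _ "\<lambda>x. c x + d x"])
qed

lemma int_chars_cmult: "int_chars N g \<Longrightarrow> int_chars N (\<lambda>j. of_int k * g j)"
proof -
  assume "int_chars N g"
  then obtain c where "\<And>j. g j = (\<Sum>x<N. of_int (c x) * E N (int x * j))" unfolding int_chars_def by blast
  then have "\<forall>j. of_int k * g j = (\<Sum>x<N. of_int (k * c x) * E N (int x * j))" by (simp add: sum_distrib_left mult_ac)
  then show ?thesis unfolding int_chars_def by (intro exI[of _ "\<lambda>x. k * c x"])
qed

lemma int_chars_chi: assumes "N > 0" shows "int_chars N (\<lambda>j. E N (a * j))"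
proof -
  have "\<forall>j. E N (a * j) = (\<Sum>x<N. of_int (if x = nat (a mod int N) then 1 else 0) * E N (int x * j))"
  proof
    fix j
    have lt: "nat (a mod int N) < N" using assms by (simp add: nat_less_iff)
    have i: "int (nat (a mod int N)) = a mod int N" using assms by simp
    have "(\<Sum>x<N. of_int (if x = nat (a mod int N) then 1 else 0) * E N (int x * j)) = (\<Sum>x<N. if x = nat (a mod int N) then E N (int x * j) else 0)"
      by (rule sum.cong) auto
    also have "\<dots> = E N (int (nat (a mod int N)) * j)" using lt by simp
    also have "\<dots> = E N (a * j)" unfolding i
    proof (rule E_cong[OF assms])
      have "int N dvd a mod int N - a" by (simp add: mod_eq_dvd_iff[symmetric])
      then show "int N dvd a mod int N * j - a * j" unfolding left_diff_distrib[symmetric] by (rule dvd_mult2)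
    qed
    finally show "E N (a * j) = (\<Sum>x<N. of_int (if x = nat (a mod int N) then 1 else 0) * E N (int x * j))" by simp
  qed
  then show ?thesis unfolding int_chars_def by (intro exI)
qed

lemma int_chars_0: "int_chars N (\<lambda>j. 0)" unfolding int_chars_def by (intro exI[of _ "\<lambda>x. 0"]) simp

lemma int_chars_const: assumes "N > 0" shows "int_chars N (\<lambda>j. of_int k)"
  using int_chars_cmult[OF int_chars_chi[OF assms, of 0], of k] by simp

lemma int_chars_sum: "finite S \<Longrightarrow> (\<And>x. x \<in> S \<Longrightarrow> int_chars N (g x)) \<Longrightarrow> int_chars N (\<lambda>j. \<Sum>x\<in>S. g x j)"
  by (induction S rule: finite_induct) (auto intro: int_chars_0 int_chars_add)

lemma int_chars_mult: assumes "N > 0" "int_chars N g" "int_chars N h" shows "int_chars N (\<lambda>j. g j * h j)"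
proof -
  obtain c d where cd: "\<And>j. g j = (\<Sum>x<N. of_int (c x) * E N (int x * j))" "\<And>j. h j = (\<Sum>x<N. of_int (d x) * E N (int x * j))"
    using assms(2,3) unfolding int_chars_def by blast
  have "g j * h j = (\<Sum>x<N. \<Sum>y<N. of_int (c x * d y) * E N ((int x + int y) * j))" for j
    unfolding cd sum_product by (intro sum.cong refl) (simp add: ring_distribs E_add)
  moreover have "int_chars N (\<lambda>j. \<Sum>x<N. \<Sum>y<N. of_int (c x * d y) * E N ((int x + int y) * j))"
    by (intro int_chars_sum int_chars_cmult int_chars_chi assms) auto
  ultimately show ?thesis by simp
qed

lemma int_chars_pow: assumes "N > 0" "int_chars N g" shows "int_chars N (\<lambda>j. g j ^ i)"
proof (induction i)
  case 0 show ?case using int_chars_const[OF assms(1), of 1] by simp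
next
  case (Suc i) then show ?case using int_chars_mult[OF assms(1,2)] by simp
qed

lemma int_chars_unique:
  assumes "N > 0" "\<And>j. (\<Sum>x<N. of_int (c x) * E N (int x * j)) = 0" "y < N"
  shows "c y = (0::int)"
proof -
  have "0 = (\<Sum>j<N. (\<Sum>x<N. of_int (c x) * E N (int x * int j)) * E N (- (int y * int j)))" using assms(2) by simp
  also have "\<dots> = (\<Sum>j<N. \<Sum>x<N. of_int (c x) * E N (int j * (int x - int y)))"
  proof (intro sum.cong refl)
    fix j
    have "E N (int x * int j) * E N (- (int y * int j)) = E N (int j * (int x - int y))" for x
      unfolding E_add[symmetric] by (simp add: algebra_simps)
    then show "(\<Sum>x<N. of_int (c x) * E N (int x * int j)) * E N (- (int y * int j)) = (\<Sum>x<N. of_int (c x) * E N (int j * (int x - int y)))"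
      unfolding sum_distrib_right mult.assoc by simp
  qed
  also have "\<dots> = (\<Sum>x<N. of_int (c x) * (\<Sum>j<N. E N (int j * (int x - int y))))"
    by (subst sum.swap) (simp add: sum_distrib_left)
  also have "\<dots> = (\<Sum>x<N. if x = y then of_int (c x) * of_nat N else 0)"
  proof (rule sum.cong[OF refl])
    fix x assume "x \<in> {..<N}"
    then have "int N dvd int x - int y \<longleftrightarrow> x = y"
      using assms(3) by (simp add: nat_mod_eq_int_dvd[symmetric])
    then show "of_int (c x) * (\<Sum>j<N. E N (int j * (int x - int y))) = (if x = y then of_int (c x) * of_nat N else 0)"
      using sum_E[OF assms(1), of "int x - int y"] by simp
  qed
  also have "\<dots> = of_int (c y) * of_nat N" using assms(3) by simp
  finally show ?thesis using assms(1) by simp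
qed

text \<open>The inner binomial coefficients are divisible by the prime \<open>l\<close>, so the
  error is \<open>l\<close> times an element of the same ring.\<close>

lemma freshman2:
  assumes N: "N > 0" and l: "prime l" and g: "int_chars N g" "int_chars N h"
  shows "\<exists>r. int_chars N r \<and> (\<forall>j. (g j + h j) ^ l = g j ^ l + h j ^ l + of_nat l * r j)"
proof -
  define r where "r = (\<lambda>j. \<Sum>k\<in>{0<..<l}. of_int (int ((l choose k) div l)) * (g j ^ k * h j ^ (l - k)))"
  have "int_chars N r" unfolding r_def by (intro int_chars_sum int_chars_cmult int_chars_mult int_chars_pow N g) simp
  moreover have "(g j + h j) ^ l = g j ^ l + h j ^ l + of_nat l * r j" for j
  proof -
    have l1: "l > 1" using l prime_gt_1_nat by blast
    have "{..l} = insert 0 (insert l {0<..<l})" using l1 by auto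
    then have "(g j + h j) ^ l = h j ^ l + (g j ^ l + (\<Sum>k\<in>{0<..<l}. of_nat (l choose k) * g j ^ k * h j ^ (l - k)))"
      unfolding binomial_ring using l1 by simp
    moreover have "(\<Sum>k\<in>{0<..<l}. of_nat (l choose k) * g j ^ k * h j ^ (l - k)) = of_nat l * r j"
      unfolding r_def sum_distrib_left
    proof (rule sum.cong[OF refl])
      fix k assume k: "k \<in> {0<..<l}"
      have "l dvd (l choose k)" using k l by (intro dvd_choose_prime) auto
      then have "l choose k = l * ((l choose k) div l)" by simp
      then have "(of_nat (l choose k) :: complex) = of_nat l * of_nat ((l choose k) div l)" by (metis of_nat_mult)
      then show "of_nat (l choose k) * g j ^ k * h j ^ (l - k) = of_nat l * (of_int (int ((l choose k) div l)) * (g j ^ k * h j ^ (l - k)))"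
        by simp
    qed
    ultimately show ?thesis by simp
  qed
  ultimately show ?thesis by blast
qed

lemma freshman:
  assumes N: "N > 0" and l: "prime l" and S: "finite S" and g: "\<And>x. x \<in> S \<Longrightarrow> int_chars N (g x)"
  shows "\<exists>r. int_chars N r \<and> (\<forall>j. (\<Sum>x\<in>S. g x j) ^ l = (\<Sum>x\<in>S. g x j ^ l) + of_nat l * r j)"
  using S g
proof (induction S rule: finite_induct)
  case empty
  then show ?case using l prime_gt_0_nat by (intro exI[of _ "\<lambda>j. 0"]) (auto simp: int_chars_0 zero_power)
next
  case (insert x S)
  then obtain r where r: "int_chars N r" "\<And>j. (\<Sum>x\<in>S. g x j) ^ l = (\<Sum>x\<in>S. g x j ^ l) + of_nat l * r j" by auto
  have R: "int_chars N (\<lambda>j. \<Sum>x\<in>S. g x j)" using insert by (intro int_chars_sum) auto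
  obtain r' where r': "int_chars N r'" "\<And>j. (g x j + (\<Sum>x\<in>S. g x j)) ^ l = g x j ^ l + (\<Sum>x\<in>S. g x j) ^ l + of_nat l * r' j"
    using freshman2[OF N l _ R, of "g x"] insert by auto
  show ?case
    by (intro exI[of _ "\<lambda>j. r j + r' j"] conjI int_chars_add r r') (use insert r(2) r'(2) in \<open>simp add: ring_distribs\<close>)
qed

lemma int_fermat: assumes l: "prime l" shows "int l dvd a ^ l - a"
proof -
  have nat: "int l dvd int k ^ l - int k" for k
  proof (induction k)
    case 0 then show ?case using l prime_gt_0_nat by (simp add: zero_power)
  next
    case (Suc k)
    have l1: "l > 1" using l prime_gt_1_nat by blast
    have "{..l} = insert 0 (insert l {0<..<l})" using l1 by auto
    then have "(int k + 1) ^ l = 1 + (int k ^ l + (\<Sum>i\<in>{0<..<l}. of_nat (l choose i) * int k ^ i * 1 ^ (l - i)))"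
      unfolding binomial_ring using l1 by simp
    moreover have "int l dvd (\<Sum>i\<in>{0<..<l}. of_nat (l choose i) * int k ^ i * 1 ^ (l - i))"
    proof (rule dvd_sum)
      fix i assume i: "i \<in> {0<..<l}"
      have "l dvd (l choose i)" using i l by (intro dvd_choose_prime) auto
      then show "int l dvd of_nat (l choose i) * int k ^ i * 1 ^ (l - i)" by (simp add: dvd_mult2)
    qed
    ultimately have "int l dvd (int k + 1) ^ l - 1 - int k ^ l" by simp
    then have "int l dvd ((int k + 1) ^ l - 1 - int k ^ l) + (int k ^ l - int k)" using Suc by (rule dvd_add)
    then show ?case by (simp add: algebra_simps)
  qed
  define k where "k = nat (a mod int l)"
  have k: "int k = a mod int l" using l prime_gt_0_nat unfolding k_def by simp
  have d: "[a = int k] (mod int l)" unfolding k by (simp add: cong_def)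
  then have "[a ^ l - a = int k ^ l - int k] (mod int l)" by (intro cong_diff cong_pow)
  moreover have "[int k ^ l - int k = 0] (mod int l)" using nat[of k] by (simp add: cong_0_iff)
  ultimately have "[a ^ l - a = 0] (mod int l)" by (rule cong_trans)
  then show ?thesis by (simp add: cong_0_iff)
qed

text \<open>
  Up to the factor \<open>D\<close>, \<open>e\<close> is the idempotent of the zero set of \<open>g\<close>. Pigeonhole yields a nontrivial
  integral relation between the powers of \<open>g\<close>; divided by its lowest power of \<open>g\<close>, it is nonzero
  exactly where \<open>g\<close> vanishes.
\<close>

lemma zero_idempotent:
  assumes N: "N > 0" and g: "int_chars N g"
  shows "\<exists>e D. int_chars N e \<and> D \<noteq> (0::int) \<and> (\<forall>j. e j = (if g j = 0 then of_int D else 0))"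
proof -
  have "\<forall>i. \<exists>c :: nat \<Rightarrow> int. \<forall>j. g j ^ i = (\<Sum>x<N. of_int (c x) * E N (int x * j))"
    using int_chars_pow[OF N g] unfolding int_chars_def by blast
  then obtain c :: "nat \<Rightarrow> nat \<Rightarrow> int" where c: "\<And>i j. g j ^ i = (\<Sum>x<N. of_int (c i x) * E N (int x * j))" by metis
  define H where "H = nat (\<Sum>i\<le>N. \<Sum>x<N. \<bar>c i x\<bar>)"
  have H: "(\<Sum>i\<le>N. \<bar>c i x\<bar>) \<le> int H" if "x < N" for x
  proof -
    have "(\<Sum>i\<le>N. \<bar>c i x\<bar>) \<le> (\<Sum>i\<le>N. \<Sum>x<N. \<bar>c i x\<bar>)"
      by (intro sum_mono member_le_sum) (use that in auto)
    then show ?thesis unfolding H_def by simp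
  qed
  \<comment> \<open>Coefficients from 0 to \<open>L\<close> give \<open>(L + 1) ^ (N + 1)\<close>
    combinations of the \<open>N + 1\<close> powers, with at most \<open>(2 * H * L + 1) ^ N\<close>
    coefficient vectors; for this \<open>L\<close> the former number is larger.\<close>
  define L where "L = (2 * H + 1) ^ N"
  have coset_card_bound: "L \<ge> 1" unfolding L_def by simp
  let ?D = "PiE {..N} (\<lambda>_. {0..int L})"
  let ?V = "\<lambda>a. restrict (\<lambda>x. \<Sum>i\<le>N. a i * c i x) {..<N}"
  let ?R = "PiE {..<N} (\<lambda>_. {- int (H * L)..int (H * L)})"
  have sub: "?V ` ?D \<subseteq> ?R"
  proof
    fix y assume "y \<in> ?V ` ?D"
    then obtain a where a: "a \<in> ?D" "y = ?V a" by blast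
    have "\<bar>\<Sum>i\<le>N. a i * c i x\<bar> \<le> int (H * L)" if x: "x < N" for x
    proof -
      have "\<bar>\<Sum>i\<le>N. a i * c i x\<bar> \<le> (\<Sum>i\<le>N. \<bar>a i * c i x\<bar>)" by (rule sum_abs)
      also have "\<dots> \<le> (\<Sum>i\<le>N. int L * \<bar>c i x\<bar>)"
      proof (rule sum_mono)
        fix i assume "i \<in> {..N}"
        then have "a i \<in> {0..int L}" using a(1) by blast
        then show "\<bar>a i * c i x\<bar> \<le> int L * \<bar>c i x\<bar>" by (simp add: abs_mult mult_right_mono)
      qed
      also have "\<dots> = int L * (\<Sum>i\<le>N. \<bar>c i x\<bar>)" by (simp add: sum_distrib_left)
      also have "\<dots> \<le> int L * int H" by (intro mult_left_mono H x) simp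
      finally show ?thesis by (simp add: mult.commute)
    qed
    then show "y \<in> ?R" unfolding a(2) by (auto simp: abs_le_iff) (smt (verit))+
  qed
  have finR: "finite ?R" by (rule finite_PiE) auto
  have lt: "card ?R < card ?D"
  proof -
    have "card ?R = (2 * (H * L) + 1) ^ N" 
    proof -
      have "card {- int (H * L)..int (H * L)} = nat (int (H * L) + 1 + int (H * L))" by simp
      also have "\<dots> = 2 * (H * L) + 1" by linarith
      finally show ?thesis by (simp only: card_PiE[OF finite_lessThan] prod_constant card_lessThan)
    qed
    also have "\<dots> \<le> (L * (2 * H + 1)) ^ N" using coset_card_bound by (intro power_mono) (auto simp: algebra_simps)
    also have "\<dots> = L ^ N * L" unfolding power_mult_distrib L_def ..
    also have "\<dots> = L ^ Suc N" by simp
    also have "\<dots> < (L + 1) ^ Suc N" by (rule power_strict_mono) simp_all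
    also have "\<dots> = card ?D" by (simp add: card_PiE nat_add_distrib)
    finally show ?thesis .
  qed
  have "\<not> inj_on ?V ?D"
  proof
    assume "inj_on ?V ?D"
    then have "card ?D \<le> card ?R" using sub finR by (rule card_inj_on_le)
    then show False using lt by simp
  qed
  then obtain a b where ab: "a \<in> ?D" "b \<in> ?D" "?V a = ?V b" "a \<noteq> b" unfolding inj_on_def by blast
  define d where "d = (\<lambda>i. a i - b i)"
  have "\<exists>i\<le>N. d i \<noteq> 0"
  proof (rule ccontr)
    assume "\<not> ?thesis"
    then have "a i = b i" if "i \<in> {..N}" for i using that unfolding d_def by auto
    then have "a = b" by (rule PiE_ext[OF ab(1,2)])
    then show False using ab(4) by blast
  qed
  define t where "t = (LEAST i. d i \<noteq> 0)"
  have t: "d t \<noteq> 0" "t \<le> N" "\<And>i. i < t \<Longrightarrow> d i = 0"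
  proof -
    from \<open>\<exists>i\<le>N. d i \<noteq> 0\<close> obtain i where "i \<le> N" "d i \<noteq> 0" by blast
    then show "d t \<noteq> 0" "t \<le> N" unfolding t_def
      using LeastI[of "\<lambda>i. d i \<noteq> 0" i] Least_le[of "\<lambda>i. d i \<noteq> 0" i] by simp_all
    show "\<And>i. i < t \<Longrightarrow> d i = 0" unfolding t_def using not_less_Least by blast
  qed
  have rel: "(\<Sum>i\<le>N. of_int (d i) * g j ^ i) = 0" for j
  proof -
    have z: "(\<Sum>i\<le>N. d i * c i x) = 0" if "x < N" for x
      using fun_cong[OF ab(3), of x] that unfolding d_def by (simp add: left_diff_distrib sum_subtractf)
    have "(\<Sum>i\<le>N. of_int (d i) * g j ^ i) = (\<Sum>x<N. of_int (\<Sum>i\<le>N. d i * c i x) * E N (int x * j))"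
      unfolding c sum_distrib_left of_int_sum sum_distrib_right by (subst sum.swap) (simp add: mult_ac)
    then show ?thesis using z by simp
  qed
  define e where "e = (\<lambda>j. \<Sum>i\<in>{t..N}. of_int (d i) * g j ^ (i - t))"
  have "int_chars N e" unfolding e_def by (intro int_chars_sum int_chars_cmult int_chars_pow N g) simp
  moreover have "e j = (if g j = 0 then of_int (d t) else 0)" for j
  proof (cases "g j = 0")
    case True
    have "e j = (\<Sum>i\<in>{t..N}. if i = t then of_int (d t) else 0)"
      unfolding e_def by (rule sum.cong[OF refl]) (auto simp: True zero_power)
    then show ?thesis using True t(2) by simp
  next
    case False
    have "g j ^ t * e j = (\<Sum>i\<in>{t..N}. of_int (d i) * g j ^ i)"
      unfolding e_def sum_distrib_left by (rule sum.cong[OF refl]) (simp add: mult.left_commute flip: power_add)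
    also have "\<dots> = (\<Sum>i\<le>N. of_int (d i) * g j ^ i)"
      by (rule sum.mono_neutral_left) (use t(3) in auto)
    finally show ?thesis using rel False by simp
  qed
  ultimately show ?thesis using t(1) by blast
qed

text \<open>
  For a prime \<open>l\<close>, the functions \<open>e ^ l\<close> and \<open>\<lambda>j. e (l * j)\<close> have the same Fourier coefficients modulo \<open>l\<close>,
  and \<open>e ^ l\<close> agrees with \<open>e\<close> up to a power of \<open>D\<close>. If \<open>l\<close> exceeds all coefficients, the congruence
  is an equality.
\<close>

lemma frobenius_zero:
  assumes N: "N > 0" and g: "int_chars N g"
  shows "\<exists>B0. \<forall>l. prime l \<longrightarrow> l > B0 \<longrightarrow> (\<forall>j. g j = 0 \<longrightarrow> g (int l * j) = 0)"
proof -
  obtain e D where e: "int_chars N e" "D \<noteq> 0" "\<And>j. e j = (if g j = 0 then of_int D else 0)" using zero_idempotent[OF N g] by blast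
  obtain c where c: "\<And>j. e j = (\<Sum>x<N. of_int (c x) * E N (int x * j))" using e(1) unfolding int_chars_def by blast
  define H where "H = (\<Sum>x<N. \<bar>c x\<bar>)"
  \<comment> \<open>Beyond \<open>2 * H\<close>, coefficients congruent modulo \<open>l\<close> are
    equal; beyond \<open>\<bar>D\<bar>\<close>, \<open>l\<close> does not divide \<open>D\<close>;
    beyond \<open>N\<close>, multiplication by \<open>l\<close> permutes the residues.\<close>
  define B0 where "B0 = nat (2 * H + \<bar>D\<bar> + int N)"
  have "g (int l * j) = 0" if l: "prime l" "l > B0" and gj: "g j = 0" for l j
  proof -
    have H0: "H \<ge> 0" unfolding H_def by (simp add: sum_nonneg)
    have lb: "int l > 2 * H" "int l > \<bar>D\<bar>" "l > N" using l(2) H0 unfolding B0_def by linarith+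
    obtain r where r: "int_chars N r" "\<And>j. (\<Sum>x<N. of_int (c x) * E N (int x * j)) ^ l = (\<Sum>x<N. (of_int (c x) * E N (int x * j)) ^ l) + of_nat l * r j"
      using freshman[OF N l(1), of "{..<N}" "\<lambda>x j. of_int (c x) * E N (int x * j)"] int_chars_cmult int_chars_chi[OF N] by auto
    obtain c' where c': "\<And>j. r j = (\<Sum>x<N. of_int (c' x) * E N (int x * j))" using r(1) unfolding int_chars_def by blast
    have Epow: "E N k ^ i = E N (int i * k)" for k i by (induction i) (simp_all add: ring_distribs E_add)
    define k where "k = (\<lambda>x. (c x ^ l - c x) div int l)"
    have k: "c x ^ l = c x + int l * k x" for x using int_fermat[OF l(1), of "c x"] unfolding k_def by simp
    have cop: "coprime l N" using l(1) lb(3) N by (metis dvd_imp_le not_le prime_imp_coprime)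
    define s where "s = (\<lambda>x. l * x mod N)"
    have bij: "bij_betw s {..<N} {..<N}"
    proof -
      have "inj_on s {..<N}"
      proof (rule inj_onI)
        fix x y assume xy: "x \<in> {..<N}" "y \<in> {..<N}" "s x = s y"
        then have "[l * x = l * y] (mod N)" unfolding s_def cong_def by simp
        then have "[x = y] (mod N)" using cong_mult_lcancel_nat[OF cop] by blast
        then show "x = y" using xy unfolding cong_def by simp
      qed
      moreover have "s ` {..<N} \<subseteq> {..<N}" using N unfolding s_def by auto
      ultimately show ?thesis by (simp add: bij_betw_def endo_inj_surj)
    qed
    define s' where "s' = inv_into {..<N} s"
    have s': "s' y < N" "s (s' y) = y" if "y < N" for y
    proof -
      have y: "y \<in> s ` {..<N}" using bij that unfolding bij_betw_def by simp
      show "s' y < N" using inv_into_into[OF y] unfolding s'_def by simp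
      show "s (s' y) = y" using f_inv_into_f[OF y] unfolding s'_def .
    qed
    have s's: "s' (s x) = x" if "x < N" for x
      using bij that unfolding s'_def bij_betw_def by (simp add: inv_into_f_f)
    have twist: "(\<Sum>x<N. of_int (h x) * E N (int x * (int l * j))) = (\<Sum>y<N. of_int (h (s' y)) * E N (int y * j))" for h :: "nat \<Rightarrow> int" and j
    proof -
      have "(\<Sum>y<N. of_int (h (s' y)) * E N (int y * j)) = (\<Sum>x<N. of_int (h (s' (s x))) * E N (int (s x) * j))"
        by (rule sum.reindex_bij_betw[OF bij, symmetric])
      also have "\<dots> = (\<Sum>x<N. of_int (h x) * E N (int x * (int l * j)))"
      proof (rule sum.cong[OF refl])
        fix x assume "x \<in> {..<N}"
        have "int N dvd int (s x) - int (l * x)" unfolding s_def nat_mod_eq_int_dvd[symmetric] by simp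
        then have "int N dvd (int (s x) - int (l * x)) * j" by (rule dvd_mult2)
        then have "E N (int (s x) * j) = E N (int x * (int l * j))" by (intro E_cong[OF N]) (simp add: algebra_simps)
        then show "of_int (h (s' (s x))) * E N (int (s x) * j) = of_int (h x) * E N (int x * (int l * j))" using s's \<open>x \<in> {..<N}\<close> by simp
      qed
      finally show ?thesis by simp
    qed
    have key: "(\<Sum>y<N. of_int (D ^ (l - 1) * c y - c (s' y) - int l * k (s' y) - int l * c' y) * E N (int y * j)) = 0" for j
    proof -
      have l0: "l = Suc (l - 1)" using l(1) prime_gt_0_nat by simp
      have "e j ^ l = of_int (D ^ (l - 1)) * e j"
      proof (cases "g j = 0")
        case True
        have "D ^ l = D ^ (l - 1) * D" by (subst l0) (rule power_Suc2)
        then have "(of_int (D ^ l) :: complex) = of_int (D ^ (l - 1) * D)" by simp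
        then show ?thesis unfolding e(3) using True by simp
      next
        case False
        have "l \<noteq> 0" using l0 by simp
        then show ?thesis unfolding e(3) using False by (simp add: zero_power)
      qed
      moreover have "e j ^ l = (\<Sum>x<N. of_int (c x + int l * k x) * E N (int x * (int l * j))) + of_nat l * r j"
      proof -
        have "(of_int (c x) * E N (int x * j)) ^ l = of_int (c x + int l * k x) * E N (int x * (int l * j))" for x
          unfolding power_mult_distrib Epow k[symmetric] by (simp add: mult.left_commute)
        then show ?thesis using r(2)[of j] unfolding c by simp
      qed
      ultimately have "of_int (D ^ (l - 1)) * e j = (\<Sum>y<N. of_int (c (s' y) + int l * k (s' y)) * E N (int y * j)) + of_nat l * r j"
        using twist[of "\<lambda>x. c x + int l * k x" j] by simp
      then have "(\<Sum>y<N. of_int (D ^ (l - 1) * c y) * E N (int y * j)) = 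
          (\<Sum>y<N. of_int (c (s' y) + int l * k (s' y)) * E N (int y * j)) + (\<Sum>y<N. of_int (int l * c' y) * E N (int y * j))"
        unfolding c c' by (simp add: sum_distrib_left mult.assoc)
      then show ?thesis by (simp add: left_diff_distrib sum_subtractf ring_distribs sum.distrib)
    qed
    have ceq: "c y = c (s' y)" if y: "y < N" for y
    proof -
      have z: "D ^ (l - 1) * c y - c (s' y) - int l * k (s' y) - int l * c' y = 0" by (rule int_chars_unique[OF N key y])
      have "int l dvd D ^ (l - 1) - 1"
      proof -
        have "int l dvd D * (D ^ (l - 1) - 1)"
        proof -
          have "D ^ l = D * D ^ (l - 1)" using l(1) prime_gt_0_nat by (metis Suc_pred' power_Suc)
          then show ?thesis using int_fermat[OF l(1), of D] by (simp add: right_diff_distrib)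
        qed
        moreover have "\<not> int l dvd D" using e(2) lb(2) by (metis dvd_imp_le_int of_nat_0_le_iff abs_of_nonneg linorder_not_less)
        ultimately show ?thesis using l(1) by (simp add: prime_dvd_mult_iff)
      qed
      then have "int l dvd (D ^ (l - 1) - 1) * c y" by (rule dvd_mult2)
      moreover have "int l dvd int l * k (s' y) + int l * c' y" by simp
      ultimately have "int l dvd (int l * k (s' y) + int l * c' y) - (D ^ (l - 1) - 1) * c y" by (intro dvd_diff)
      moreover have "(int l * k (s' y) + int l * c' y) - (D ^ (l - 1) - 1) * c y = c y - c (s' y)" using z by (simp add: algebra_simps)
      ultimately have "int l dvd c y - c (s' y)" by simp
      moreover have "\<bar>c x\<bar> \<le> H" if "x < N" for x unfolding H_def by (rule member_le_sum) (use that in auto)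
      then have "\<bar>c y - c (s' y)\<bar> < int l" using lb(1) y s'(1)[OF y] by (smt (verit))
      ultimately have "c y - c (s' y) = 0" using dvd_imp_le_int[of "c y - c (s' y)" "int l"] by linarith
      then show ?thesis by simp
    qed
    have "e (int l * j) = e j"
    proof -
      have "e (int l * j) = (\<Sum>y<N. of_int (c (s' y)) * E N (int y * j))" unfolding c twist ..
      also have "\<dots> = e j" unfolding c by (rule sum.cong[OF refl]) (use ceq in simp)
      finally show ?thesis .
    qed
    then show ?thesis using e(2,3) gj by (metis of_int_eq_0_iff)
  qed
  then show ?thesis by blast
qed

text \<open>
  Dirichlet's theorem is avoided: \<open>k\<close> is congruent modulo \<open>N\<close> to a number all of whose prime factors are large.
\<close>

lemma galois:
  assumes N: "N > 0" and g: "int_chars N g" and per: "\<And>j j'. int N dvd j - j' \<Longrightarrow> g j = g j'" and z: "g j = 0" and k: "coprime k (int N)"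
  shows "g (k * j) = 0"
proof -
  obtain B0 where B0: "\<And>l j. prime l \<Longrightarrow> l > B0 \<Longrightarrow> g j = 0 \<Longrightarrow> g (int l * j) = 0" using frobenius_zero[OF N g] by blast
  have rough: "(\<And>l. prime l \<Longrightarrow> l dvd t \<Longrightarrow> l > B0) \<Longrightarrow> t > 0 \<Longrightarrow> g j = 0 \<Longrightarrow> g (int t * j) = 0" for t j
  proof (induction t arbitrary: j rule: less_induct)
    case (less t)
    show ?case
    proof (cases "t = 1")
      case True then show ?thesis using less by simp
    next
      case False
      then obtain l where l: "prime l" "l dvd t" using prime_factor_nat by blast
      then obtain t' where t': "t = l * t'" by (elim dvdE)
      have t'0: "t' > 0" using t' less.prems(2) by (cases t') auto
      moreover have "t' * 1 < t' * l" using t'0 prime_gt_1_nat[OF l(1)] by (intro mult_strict_left_mono) auto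
      ultimately have "t' < t" "t' > 0" unfolding t' by (simp_all add: mult.commute)
      have "g (int l * j) = 0" using B0 l less.prems by blast
      then have "g (int t' * (int l * j)) = 0"
        using less.IH[OF \<open>t' < t\<close> _ \<open>t' > 0\<close>] less.prems(1) t' by (metis dvd_mult)
      then show ?thesis unfolding t' by (simp add: mult_ac)
    qed
  qed
  define k0 where "k0 = nat (k mod int N)"
  have k0: "int k0 = k mod int N" unfolding k0_def using N by simp
  have cop0: "coprime k0 N"
  proof -
    have "coprime (k mod int N) (int N)" using k N by (simp add: coprime_mod_left_iff)
    then show ?thesis unfolding k0[symmetric] by simp
  qed
  \<comment> \<open>The small primes prime to \<open>N\<close>. A number congruent to
    \<open>k\<close> modulo \<open>N\<close> and to 1 modulo \<open>Q\<close> has no prime factor up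
    to \<open>B0\<close>; adding \<open>N * Q\<close> makes it positive.\<close>
  define Q where "Q = \<Prod>{l. prime l \<and> l \<le> B0 \<and> \<not> l dvd N}"
  have finQ: "finite {l. prime l \<and> l \<le> B0 \<and> \<not> l dvd N}" by simp
  have "coprime N Q" unfolding Q_def by (rule prod_coprime_right) (auto intro: prime_imp_coprime simp: coprime_commute)
  then obtain t0 where t0: "[t0 = k0] (mod N)" "[t0 = 1] (mod Q)" using binary_chinese_remainder_nat by blast
  have Q0: "Q > 0" unfolding Q_def by (rule prod_pos) (auto simp: prime_gt_0_nat)
  define t where "t = t0 + N * Q"
  have t: "[t = k0] (mod N)" "[t = 1] (mod Q)" "t > 0" using t0 N Q0 unfolding t_def cong_def by auto
  have "l > B0" if l: "prime l" "l dvd t" for l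
  proof (rule ccontr)
    assume "\<not> l > B0"
    show False
    proof (cases "l dvd N")
      case True
      then have "[t = k0] (mod l)" using t(1) cong_dvd_modulus_nat by blast
      then have "l dvd k0" using l(2) cong_dvd_iff by blast
      then show False using cop0 True l(1) by (metis coprime_common_divisor not_prime_unit)
    next
      case False
      then have "l \<in> {l. prime l \<and> l \<le> B0 \<and> \<not> l dvd N}" using l \<open>\<not> l > B0\<close> by simp
      then have "l dvd Q" unfolding Q_def using finQ by (metis dvd_prodI)
      then have "[t = 1] (mod l)" using t(2) cong_dvd_modulus_nat by blast
      then have "l dvd 1" using l(2) cong_dvd_iff by blast
      then show False using l(1) by (metis not_prime_unit)
    qed
  qed
  then have "g (int t * j) = 0" using rough t(3) z by blast
  moreover have "g (int t * j) = g (k * j)"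
  proof (rule per)
    have "int N dvd int t - int k0" using t(1) nat_mod_eq_int_dvd unfolding cong_def by blast
    moreover have "int N dvd int k0 - k" unfolding k0 by (simp add: mod_eq_dvd_iff[symmetric])
    ultimately have "int N dvd (int t - int k0) + (int k0 - k)" by (rule dvd_add)
    then have "int N dvd (int t - k) * j" by simp
    then show "int N dvd int t * j - k * j" by (simp add: left_diff_distrib)
  qed
  ultimately show ?thesis by simp
qed

section \<open>Transfer to the cyclic group\<close>

definition crt :: "nat \<Rightarrow> nat \<Rightarrow> nat \<Rightarrow> nat \<Rightarrow> int \<Rightarrow> nat \<times> nat" where
  "crt p q m n a = (nat (a mod int (p ^ m)), nat (a mod int (q ^ n)))"

lemma nat_mod_dvd: assumes "P > 0" "k dvd P" shows "int k dvd int (nat (a mod int P)) - b \<longleftrightarrow> int k dvd a - b"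
proof -
  have "int P dvd a - a mod int P" by (simp add: minus_mod_eq_mult_div)
  moreover have "int k dvd int P" using assms(2) by simp
  ultimately have d: "int k dvd a - a mod int P" by (rule dvd_trans[rotated])
  have e: "int (nat (a mod int P)) = a mod int P" using assms(1) by simp
  have "a - b = (a mod int P - b) + (a - a mod int P)" by simp
  then show ?thesis unfolding e using d by (metis dvd_add_left_iff)
qed

lemma lv_crt:
  assumes "p > 0"
  shows "v \<le> m \<Longrightarrow> v \<le> lv p m (nat (a mod int (p ^ m))) (nat (b mod int (p ^ m))) \<longleftrightarrow> int (p ^ v) dvd a - b"
proof -
  assume v: "v \<le> m"
  then have d: "p ^ v dvd p ^ m" by (rule le_imp_power_dvd)
  have P: "p ^ m > 0" using assms by simp
  have "v \<le> lv p m (nat (a mod int (p ^ m))) (nat (b mod int (p ^ m))) \<longleftrightarrow>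
     int (p ^ v) dvd int (nat (a mod int (p ^ m))) - int (nat (b mod int (p ^ m)))"
    unfolding lv_iff[OF v] nat_mod_eq_int_dvd ..
  also have "\<dots> \<longleftrightarrow> int (p ^ v) dvd a - int (nat (b mod int (p ^ m)))" by (rule nat_mod_dvd[OF P d])
  also have "\<dots> \<longleftrightarrow> int (p ^ v) dvd int (nat (b mod int (p ^ m))) - a" by (rule dvd_diff_commute)
  also have "\<dots> \<longleftrightarrow> int (p ^ v) dvd b - a" by (rule nat_mod_dvd[OF P d])
  also have "\<dots> \<longleftrightarrow> int (p ^ v) dvd a - b" by (rule dvd_diff_commute)
  finally show ?thesis .
qed

lemma lv_crt_factor:
  assumes p: "prime p" and v: "v = lv p m (nat (a mod int (p ^ m))) (nat (b mod int (p ^ m)))"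
  shows "int (p ^ v) dvd a - b" and "v < m \<Longrightarrow> \<not> int (p ^ Suc v) dvd a - b" and "v \<le> m"
proof -
  have p0: "p > 0" using p prime_gt_0_nat by blast
  show vm: "v \<le> m" unfolding v by (rule lv_le)
  show "int (p ^ v) dvd a - b" using lv_crt[OF p0 vm, of a b] v by simp
  show "v < m \<Longrightarrow> \<not> int (p ^ Suc v) dvd a - b" using lv_crt[OF p0, of "Suc v" m a b] v by auto
qed

locale cyclic_pq =
  fixes p q m n N :: nat
  assumes pr: "prime p" "prime q" "p \<noteq> q" and N: "N = p ^ m * q ^ n"
begin

lemma p0: "p > 0" "q > 0" "N > 0" "p ^ m > 0" "q ^ n > 0" using pr prime_gt_0_nat N by auto

lemma cop: "coprime (int (p ^ i)) (int (q ^ j))"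
  using primes_coprime[OF pr(1,2,3)] by simp

lemma pq_dvd: "int (p ^ i * q ^ j) dvd d \<longleftrightarrow> int (p ^ i) dvd d \<and> int (q ^ j) dvd d"
proof
  assume h: "int (p ^ i * q ^ j) dvd d"
  have e: "int (p ^ i * q ^ j) = int (p ^ i) * int (q ^ j)" by simp
  show "int (p ^ i) dvd d \<and> int (q ^ j) dvd d" using h unfolding e using dvd_mult_left dvd_mult_right by blast
next
  assume "int (p ^ i) dvd d \<and> int (q ^ j) dvd d"
  then have "int (p ^ i) * int (q ^ j) dvd d" using cop divides_mult by blast
  then show "int (p ^ i * q ^ j) dvd d" by simp
qed

lemma crt_eq_iff: "crt p q m n a = crt p q m n b \<longleftrightarrow> int N dvd a - b"
proof -
  have "nat (a mod int P) = nat (b mod int P) \<longleftrightarrow> int P dvd a - b" if "P > 0" for P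
    using that by (simp add: mod_eq_dvd_iff[symmetric] nat_eq_iff)
  note e = this[OF p0(4)] this[OF p0(5)]
  show ?thesis unfolding crt_def N prod.inject e pq_dvd ..
qed

lemma crt_inj: "inj_on (crt p q m n) {0..<int N}"
proof (rule inj_onI)
  fix a b assume ab: "a \<in> {0..<int N}" "b \<in> {0..<int N}" "crt p q m n a = crt p q m n b"
  then have "a mod int N = b mod int N" unfolding crt_eq_iff mod_eq_dvd_iff by blast
  then show "a = b" using ab(1,2) by simp
qed

lemma crt_box: "crt p q m n a \<in> {..<p ^ m} \<times> {..<q ^ n}"
  unfolding crt_def using p0 by (simp add: nat_less_iff)

lemma crt_bij: "bij_betw (crt p q m n) {0..<int N} ({..<p ^ m} \<times> {..<q ^ n})"
proof -
  have "card (crt p q m n ` {0..<int N}) = N" using card_image[OF crt_inj] by simp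
  also have "\<dots> = card ({..<p ^ m} \<times> {..<q ^ n})" using N by (simp add: card_cartesian_product)
  finally have "crt p q m n ` {0..<int N} = {..<p ^ m} \<times> {..<q ^ n}"
    using crt_box by (intro card_subset_eq) blast+
  then show ?thesis using crt_inj by (simp add: bij_betw_def)
qed

lemma cn_crt:
  assumes A: "A \<subseteq> {0..<int N}" and ij: "i \<le> m" "j \<le> n"
  shows "cn p q (crt p q m n ` A) i j x y = card {a \<in> A. int (p ^ i) dvd a - int x \<and> int (q ^ j) dvd a - int y}"
proof -
  have "fst (crt p q m n a) mod p ^ i = x mod p ^ i \<longleftrightarrow> int (p ^ i) dvd a - int x" for a
    unfolding nat_mod_eq_int_dvd crt_def fst_conv by (rule nat_mod_dvd) (use p0 ij in \<open>simp_all add: le_imp_power_dvd\<close>)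
  moreover have "snd (crt p q m n a) mod q ^ j = y mod q ^ j \<longleftrightarrow> int (q ^ j) dvd a - int y" for a
    unfolding nat_mod_eq_int_dvd crt_def snd_conv by (rule nat_mod_dvd) (use p0 ij in \<open>simp_all add: le_imp_power_dvd\<close>)
  ultimately have "cl p q (crt p q m n ` A) i j x y = crt p q m n ` {a \<in> A. int (p ^ i) dvd a - int x \<and> int (q ^ j) dvd a - int y}"
    unfolding cl_def by blast
  moreover have "inj_on (crt p q m n) {a \<in> A. int (p ^ i) dvd a - int x \<and> int (q ^ j) dvd a - int y}"
    by (rule inj_on_subset[OF crt_inj]) (use A in blast)
  ultimately show ?thesis unfolding cn_def by (simp add: card_image)
qed

text \<open>In mixed order, Fourier inversion drops all frequencies prime to \<open>p * q\<close>. A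
  frequency divisible by \<open>p\<close> does not see the change from \<open>x\<close> to
  \<open>x'\<close>, one divisible by \<open>q\<close> not that from \<open>y\<close> to
  \<open>y'\<close>; either way the four terms balance.\<close>

lemma zr_from_chars:
  assumes A: "A \<subseteq> {0..<int N}" and ij: "i \<le> m" "j \<le> n" "i > 0 \<or> j > 0"
    and z: "\<And>k. (i > 0 \<longrightarrow> \<not> int p dvd k) \<Longrightarrow> (j > 0 \<longrightarrow> \<not> int q dvd k) \<Longrightarrow> (\<Sum>a\<in>A. E (p ^ i * q ^ j) (a * k)) = 0"
  shows "zr p q (crt p q m n ` A) i j"
proof -
  have fA: "finite A" using A finite_subset by blast
  consider i' where "i = Suc i'" "j = 0" | j' where "i = 0" "j = Suc j'" | i' j' where "i = Suc i'" "j = Suc j'"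
    using ij(3) by (cases i; cases j) auto
  then show ?thesis
  proof cases
    case (1 i')
    have zz: "(\<Sum>a\<in>A. E (p ^ Suc i') (k * a)) = 0" if "\<not> int p dvd k" for k
      using z[of k] that unfolding 1 by (simp add: mult.commute)
    show ?thesis unfolding 1 zr.simps cn_crt[OF A ij(1,2), unfolded 1]
    proof (intro allI impI)
      fix x x' :: nat assume "x mod p ^ i' = x' mod p ^ i'"
      then have "int (p ^ i') dvd int x - int x'" using nat_mod_eq_int_dvd by blast
      from fourier_uniform[OF pr(1) fA zz this]
      show "card {a \<in> A. int (p ^ Suc i') dvd a - int x \<and> int (q ^ 0) dvd a - int 0} =
            card {a \<in> A. int (p ^ Suc i') dvd a - int x' \<and> int (q ^ 0) dvd a - int 0}" by simp
    qed
  next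
    case (2 j')
    have zz: "(\<Sum>a\<in>A. E (q ^ Suc j') (k * a)) = 0" if "\<not> int q dvd k" for k
      using z[of k] that unfolding 2 by (simp add: mult.commute)
    show ?thesis unfolding 2 zr.simps cn_crt[OF A ij(1,2), unfolded 2]
    proof (intro allI impI)
      fix y y' :: nat assume "y mod q ^ j' = y' mod q ^ j'"
      then have "int (q ^ j') dvd int y - int y'" using nat_mod_eq_int_dvd by blast
      from fourier_uniform[OF pr(2) fA zz this]
      show "card {a \<in> A. int (p ^ 0) dvd a - int 0 \<and> int (q ^ Suc j') dvd a - int y} =
            card {a \<in> A. int (p ^ 0) dvd a - int 0 \<and> int (q ^ Suc j') dvd a - int y'}" by simp
    qed
  next
    case (3 i' j')
    let ?M = "p ^ i * q ^ j"
    have M0: "?M > 0" using p0 by simp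
    have "\<exists>z. \<forall>a. (int (p ^ i) dvd a - int x \<and> int (q ^ j) dvd a - int y) \<longleftrightarrow> int ?M dvd a - int z" for x y
    proof -
      have "coprime (p ^ i) (q ^ j)" using primes_coprime[OF pr(1,2,3)] by simp
      then obtain w where w: "[w = x] (mod p ^ i)" "[w = y] (mod q ^ j)" using binary_chinese_remainder_nat by blast
      have d: "int (p ^ i) dvd int w - int x" "int (q ^ j) dvd int w - int y" using w[unfolded Cong.cong_def nat_mod_eq_int_dvd] .
      have "int (p ^ i) dvd a - int x \<longleftrightarrow> int (p ^ i) dvd a - int w" for a
        using d(1) by (metis diff_add_cancel dvd_add_left_iff add_diff_eq)
      moreover have "int (q ^ j) dvd a - int y \<longleftrightarrow> int (q ^ j) dvd a - int w" for a
        using d(2) by (metis diff_add_cancel dvd_add_left_iff add_diff_eq)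
      ultimately show ?thesis using pq_dvd by blast
    qed
    then obtain Z where Z: "\<And>x y a. (int (p ^ i) dvd a - int x \<and> int (q ^ j) dvd a - int y) \<longleftrightarrow> int ?M dvd a - int (Z x y)" by metis
    have Zx: "int (p ^ i) dvd int (Z x y) - int x" "int (q ^ j) dvd int (Z x y) - int y" for x y
      using Z[of "int (Z x y)" x y] by simp_all
    have cnZ: "cn p q (crt p q m n ` A) i j x y = card {a \<in> A. int ?M dvd a - int (Z x y)}" for x y
      unfolding cn_crt[OF A ij(1,2)] Z ..
    have grid: "cn p q (crt p q m n ` A) i j x y + cn p q (crt p q m n ` A) i j x' y' = cn p q (crt p q m n ` A) i j x y' + cn p q (crt p q m n ` A) i j x' y"
      if h: "x mod p ^ i' = x' mod p ^ i'" "y mod q ^ j' = y' mod q ^ j'" for x x' y y'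
    proof -
      have hx: "int (p ^ i') dvd int x - int x'" "int (q ^ j') dvd int y - int y'" using h nat_mod_eq_int_dvd by blast+
      let ?e = "\<lambda>k z. E ?M (- (int k * int z))"
      have px: "?e k (Z x y) = ?e k (Z x' y)" if k: "int p dvd int k" for k y
      proof (rule E_cong[OF M0])
        have "int (q ^ j) dvd int (Z x y) - int (Z x' y)" using dvd_diff[OF Zx(2)[of x y] Zx(2)[of x' y]] by simp
        then have 1: "int (q ^ j) dvd int k * (int (Z x y) - int (Z x' y))" by (rule dvd_mult)
        have "int (p ^ i') dvd int (p ^ i)" unfolding 3 by simp
        then have "int (p ^ i') dvd int (Z x y) - int x" "int (p ^ i') dvd int (Z x' y) - int x'" using Zx(1) dvd_trans by blast+
        then have "int (p ^ i') dvd ((int (Z x y) - int x) - (int (Z x' y) - int x')) + (int x - int x')" by (rule dvd_add[OF dvd_diff hx(1)])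
        then have "int (p ^ i') dvd int (Z x y) - int (Z x' y)" by simp
        then have "int p * int (p ^ i') dvd int k * (int (Z x y) - int (Z x' y))" using k by (intro mult_dvd_mono)
        then have "int (p ^ i) dvd int k * (int (Z x y) - int (Z x' y))" unfolding 3 by simp
        then have "int ?M dvd int k * (int (Z x y) - int (Z x' y))" using 1 pq_dvd by blast
        then have "int ?M dvd - (int k * (int (Z x y) - int (Z x' y)))" by (simp only: dvd_minus_iff)
        then show "int ?M dvd - (int k * int (Z x y)) - - (int k * int (Z x' y))" by (simp add: right_diff_distrib)
      qed
      have qx: "?e k (Z x y) = ?e k (Z x y')" if k: "int q dvd int k" for k x
      proof (rule E_cong[OF M0])
        have "int (p ^ i) dvd int (Z x y) - int (Z x y')" using dvd_diff[OF Zx(1)[of x y] Zx(1)[of x y']] by simp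
        then have 1: "int (p ^ i) dvd int k * (int (Z x y) - int (Z x y'))" by (rule dvd_mult)
        have "int (q ^ j') dvd int (q ^ j)" unfolding 3 by simp
        then have "int (q ^ j') dvd int (Z x y) - int y" "int (q ^ j') dvd int (Z x y') - int y'" using Zx(2) dvd_trans by blast+
        then have "int (q ^ j') dvd ((int (Z x y) - int y) - (int (Z x y') - int y')) + (int y - int y')" by (rule dvd_add[OF dvd_diff hx(2)])
        then have "int (q ^ j') dvd int (Z x y) - int (Z x y')" by simp
        then have "int q * int (q ^ j') dvd int k * (int (Z x y) - int (Z x y'))" using k by (intro mult_dvd_mono)
        then have "int (q ^ j) dvd int k * (int (Z x y) - int (Z x y'))" unfolding 3 by simp
        then have "int ?M dvd int k * (int (Z x y) - int (Z x y'))" using 1 pq_dvd by blast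
        then have "int ?M dvd - (int k * (int (Z x y) - int (Z x y')))" by (simp only: dvd_minus_iff)
        then show "int ?M dvd - (int k * int (Z x y)) - - (int k * int (Z x y'))" by (simp add: right_diff_distrib)
      qed
      let ?F = "\<lambda>k. \<Sum>a\<in>A. E ?M (int k * a)"
      have balance: "?F k * ?e k (Z x y) + ?F k * ?e k (Z x' y') = ?F k * ?e k (Z x y') + ?F k * ?e k (Z x' y)" for k
      proof -
        consider "int p dvd int k" | "int q dvd int k" | "\<not> int p dvd int k" "\<not> int q dvd int k" by blast
        then show ?thesis
        proof cases
          case 1 then show ?thesis using px[of k y] px[of k y'] by simp
        next
          case 2 then show ?thesis using qx[of k x] qx[of k x'] by simp
        next
          case 3 then have "?F k = 0" using z[of "int k"] by (simp add: mult.commute)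
          then show ?thesis by simp
        qed
      qed
      let ?c = "\<lambda>z. card {a \<in> A. int ?M dvd a - int z}"
      have "of_nat ?M * (of_nat (?c (Z x y) + ?c (Z x' y')) :: complex) = (\<Sum>k<?M. ?F k * ?e k (Z x y) + ?F k * ?e k (Z x' y'))"
        unfolding of_nat_add distrib_left sum.distrib using fourier_count[OF M0 fA, of "\<lambda>a. a"] by simp
      also have "\<dots> = (\<Sum>k<?M. ?F k * ?e k (Z x y') + ?F k * ?e k (Z x' y))" by (rule sum.cong[OF refl]) (rule balance)
      also have "\<dots> = of_nat ?M * of_nat (?c (Z x y') + ?c (Z x' y))"
        unfolding of_nat_add distrib_left sum.distrib using fourier_count[OF M0 fA, of "\<lambda>a. a"] by simp
      finally have "(of_nat (?c (Z x y) + ?c (Z x' y')) :: complex) = of_nat (?c (Z x y') + ?c (Z x' y))"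
        unfolding mult_cancel_left of_nat_eq_0_iff using M0 by (metis less_irrefl)
      then show ?thesis unfolding cnZ by (simp only: of_nat_eq_iff)
    qed
    show ?thesis unfolding 3 zr.simps using grid unfolding 3 by blast
  qed
qed

lemma zeta_powi: "zeta N powi k = E N k"
proof -
  have z: "zeta N = cis (2 * pi / of_nat N)" unfolding zeta_def cis_conv_exp by (simp add: mult_ac)
  have "real l * (2 * pi / real N) = 2 * pi * of_int (int l) / real N" for l by simp
  then have pos: "zeta N ^ l = E N (int l)" for l unfolding z E_def by (metis Complex.DeMoivre)
  show ?thesis
  proof (cases "k \<ge> 0")
    case True
    then show ?thesis using pos[of "nat k"] by (simp add: power_int_def)
  next
    case False
    have "E N (- int (nat (- k))) = inverse (E N (int (nat (- k))))"
      unfolding E_def by (simp add: cis_inverse)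
    then show ?thesis using False pos[of "nat (- k)"] by (simp add: power_int_def power_inverse)
  qed
qed

text \<open>Cancelling the common powers turns \<open>b - b'\<close> into a unit frequency
  \<open>d\<close> modulo \<open>p ^ i * q ^ j\<close>. With \<open>t\<close> inverse to
  \<open>d\<close>, Galois invariance under \<open>k * t\<close> moves the zero to any unit
  \<open>k\<close>.\<close>

lemma zr_of_zero:
  assumes A: "A \<subseteq> {0..<int N}" and b: "b \<in> {0..<int N}" "b' \<in> {0..<int N}" "b \<noteq> b'"
    and z: "(\<Sum>a\<in>A. E N (a * (b - b'))) = 0"
  shows "zr p q (crt p q m n ` A) (m - lv p m (fst (crt p q m n b)) (fst (crt p q m n b'))) (n - lv q n (snd (crt p q m n b)) (snd (crt p q m n b')))"
proof -
  define v where "v = lv p m (nat (b mod int (p ^ m))) (nat (b' mod int (p ^ m)))"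
  define w where "w = lv q n (nat (b mod int (q ^ n))) (nat (b' mod int (q ^ n)))"
  note V = lv_crt_factor[OF pr(1) v_def] and W = lv_crt_factor[OF pr(2) w_def]
  define i where "i = m - v"
  define j where "j = n - w"
  let ?M = "p ^ i * q ^ j"
  have M0: "?M > 0" using p0 by simp
  have "int (p ^ v * q ^ w) dvd b - b'" using pq_dvd V(1) W(1) by blast
  then obtain d where d: "b - b' = int (p ^ v * q ^ w) * d" by (elim dvdE)
  have NM: "N = (p ^ v * q ^ w) * ?M" unfolding N i_def j_def using V(3) W(3)
    by (metis (no_types, lifting) le_add_diff_inverse mult.assoc mult.left_commute power_add)
  have pd: "\<not> int p dvd d" if "i > 0"
  proof
    assume "int p dvd d"
    then obtain c where c: "d = int p * c" by (elim dvdE)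
    have "b - b' = int (p ^ Suc v) * (int (q ^ w) * c)" unfolding d c by simp
    then have "int (p ^ Suc v) dvd b - b'" by (rule dvdI)
    then show False using V(2) that unfolding i_def by simp
  qed
  have qd: "\<not> int q dvd d" if "j > 0"
  proof
    assume "int q dvd d"
    then obtain c where c: "d = int q * c" by (elim dvdE)
    have "b - b' = int (q ^ Suc w) * (int (p ^ v) * c)" unfolding d c by simp
    then have "int (q ^ Suc w) dvd b - b'" by (rule dvdI)
    then show False using W(2) that unfolding j_def by simp
  qed
  have copk: "coprime k (int ?M)" if "i > 0 \<longrightarrow> \<not> int p dvd k" "j > 0 \<longrightarrow> \<not> int q dvd k" for k
  proof -
    have "coprime k (int (p ^ i))"
    proof (cases "i = 0")
      case False
      then have "\<not> int p dvd k" using that by simp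
      then have "coprime k (int p)" using pr(1) by (metis prime_imp_coprime coprime_commute prime_nat_int_transfer)
      then show ?thesis by simp
    qed simp
    moreover have "coprime k (int (q ^ j))"
    proof (cases "j = 0")
      case False
      then have "\<not> int q dvd k" using that by simp
      then have "coprime k (int q)" using pr(2) by (metis prime_imp_coprime coprime_commute prime_nat_int_transfer)
      then show ?thesis by simp
    qed simp
    ultimately show ?thesis by simp
  qed
  define F where "F = (\<lambda>k. \<Sum>a\<in>A. E ?M (a * k))"
  have fA: "finite A" using A finite_subset by blast
  have RF: "int_chars ?M F" unfolding F_def by (intro int_chars_sum fA int_chars_chi M0)
  have per: "F k = F k'" if "int ?M dvd k - k'" for k k'
    unfolding F_def
  proof (rule sum.cong[OF refl])
    fix a show "E ?M (a * k) = E ?M (a * k')"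
      by (rule E_cong[OF M0]) (use that in \<open>simp only: right_diff_distrib[symmetric] dvd_mult\<close>)
  qed
  have Fd: "F d = 0"
  proof -
    have "E N (a * (b - b')) = E ?M (a * d)" for a
    proof -
      have "a * (b - b') = int (p ^ v * q ^ w) * (a * d)" unfolding d by (simp add: mult_ac)
      moreover have "p ^ v * q ^ w > 0" using p0 by simp
      ultimately show ?thesis unfolding NM using E_cancel by metis
    qed
    then show ?thesis using z unfolding F_def by simp
  qed
  have Fk: "F k = 0" if k: "coprime k (int ?M)" for k
  proof -
    have "coprime d (int ?M)" using copk pd qd by blast
    then obtain t where t: "[d * t = 1] (mod int ?M)" using cong_solve_coprime_int by blast
    then have ct: "coprime t (int ?M)"
      by (metis coprime_iff_invertible_int mult.commute)
    then have "coprime (k * t) (int ?M)" unfolding coprime_mult_left_iff using k by blast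
    from galois[OF M0 RF per Fd this] have "F (k * t * d) = 0" by blast
    moreover have "int ?M dvd k * t * d - k"
    proof -
      have "int ?M dvd d * t - 1" using t by (simp only: cong_iff_dvd_diff)
      then have "int ?M dvd k * (d * t - 1)" by (rule dvd_mult)
      then show ?thesis by (simp add: algebra_simps)
    qed
    ultimately show ?thesis using per by metis
  qed
  have "i > 0 \<or> j > 0"
  proof (rule ccontr)
    assume "\<not> (i > 0 \<or> j > 0)"
    then have "N = p ^ v * q ^ w" using NM by simp
    then have "int N dvd b - b'" using d by simp
    then have "crt p q m n b = crt p q m n b'" using crt_eq_iff by blast
    then show False using crt_inj b unfolding inj_on_def by blast
  qed
  then have "zr p q (crt p q m n ` A) i j"
    by (intro zr_from_chars[OF A]) (use copk Fk in \<open>auto simp: i_def j_def F_def\<close>)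
  then show ?thesis unfolding i_def j_def v_def w_def crt_def fst_conv snd_conv .
qed

text \<open>Orthogonal columns of a square matrix give orthogonal rows: the squared moduli of
  \<open>g\<close> over \<open>A\<close> add up to \<open>card B * card A\<close>, and the term at
  \<open>a'\<close> alone has this value.\<close>

lemma orthogonal_rows:
  assumes fin: "finite A" "finite B" and card: "card A = card B"
    and col: "\<And>b b'. b \<in> B \<Longrightarrow> b' \<in> B \<Longrightarrow> b \<noteq> b' \<Longrightarrow> (\<Sum>a\<in>A. E N (a * (b - b'))) = 0"
    and a: "a \<in> A" "a' \<in> A" "a \<noteq> a'"
  shows "(\<Sum>b\<in>B. E N (b * (a - a'))) = 0"
proof -
  define g where "g = (\<lambda>x. \<Sum>b\<in>B. E N (b * (x - a')))"
  have sq: "g x * cnj (g x) = (\<Sum>b\<in>B. \<Sum>b'\<in>B. E N (- (a' * (b - b'))) * E N (x * (b - b')))" for x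
    unfolding g_def cnj_sum sum_product
    by (intro sum.cong refl) (simp add: algebra_simps flip: E_minus E_add)
  have "(\<Sum>x\<in>A. g x * cnj (g x)) = (\<Sum>b\<in>B. \<Sum>x\<in>A. \<Sum>b'\<in>B. E N (- (a' * (b - b'))) * E N (x * (b - b')))"
    unfolding sq by (rule sum.swap)
  also have "\<dots> = (\<Sum>b\<in>B. \<Sum>b'\<in>B. \<Sum>x\<in>A. E N (- (a' * (b - b'))) * E N (x * (b - b')))"
    by (rule sum.cong[OF refl]) (rule sum.swap)
  also have "\<dots> = (\<Sum>b\<in>B. \<Sum>b'\<in>B. if b = b' then of_nat (card A) else 0)"
    unfolding sum_distrib_left[symmetric] by (intro sum.cong refl) (simp add: col)
  also have "\<dots> = of_nat (card B * card A)" using fin(2) by simp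
  finally have "(\<Sum>x\<in>A. of_real ((cmod (g x))\<^sup>2)) = (of_nat (card B * card A) :: complex)"
    unfolding complex_norm_square .
  then have "complex_of_real (\<Sum>x\<in>A. (cmod (g x))\<^sup>2) = complex_of_real (real (card B * card A))" by simp
  then have tot: "(\<Sum>x\<in>A. (cmod (g x))\<^sup>2) = real (card B * card A)" unfolding of_real_eq_iff .
  have "g a' = of_nat (card B)" unfolding g_def by simp
  then have "(cmod (g a'))\<^sup>2 = real (card B * card A)" using card by (simp add: power2_eq_square)
  then have "(\<Sum>x\<in>A - {a'}. (cmod (g x))\<^sup>2) = 0" using tot sum.remove[OF fin(1) a(2), of "\<lambda>x. (cmod (g x))\<^sup>2"] by simp
  then have "(cmod (g a))\<^sup>2 = 0" using a fin(1) by (subst (asm) sum_nonneg_eq_0_iff) auto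
  then show ?thesis unfolding g_def by simp
qed

lemma spectral_spair:
  assumes "spectral N A"
  shows "\<exists>B. spair p q m n (crt p q m n ` A) B"
proof -
  have car: "carrier (integer_mod_group N) = {0..<int N}" using p0 by (simp add: carrier_integer_mod_group)
  obtain B where B: "A \<subseteq> {0..<int N}" "A \<noteq> {}" "B \<subseteq> {0..<int N}" "card A = card B"
    "\<And>b b'. b \<in> B \<Longrightarrow> b' \<in> B \<Longrightarrow> b \<noteq> b' \<Longrightarrow> (\<Sum>a\<in>A. E N (a * (b - b'))) = 0"
    using assms unfolding spectral_def car zeta_powi by metis
  have fin: "finite A" "finite B" using B(1,3) by (auto intro: finite_subset)
  have rows: "(\<Sum>b\<in>B. E N (b * (a - a'))) = 0" if a: "a \<in> A" "a' \<in> A" "a \<noteq> a'" for a a'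
    by (rule orthogonal_rows[OF fin B(4,5) a])
  have inj: "inj_on (crt p q m n) A" "inj_on (crt p q m n) B" using crt_inj inj_on_subset B(1,3) by metis+
  have "spair p q m n (crt p q m n ` A) (crt p q m n ` B)"
    unfolding spair_def
  proof (intro conjI ballI impI)
    show "crt p q m n ` A \<subseteq> {..<p ^ m} \<times> {..<q ^ n}" "crt p q m n ` B \<subseteq> {..<p ^ m} \<times> {..<q ^ n}" by (rule image_subsetI, rule crt_box)+
    show "crt p q m n ` A \<noteq> {}" using B by simp
    show "card (crt p q m n ` A) = card (crt p q m n ` B)" using inj B(4) by (simp add: card_image)
  next
    fix z z' assume "z \<in> crt p q m n ` B" "z' \<in> crt p q m n ` B" "z \<noteq> z'"
    then obtain b b' where b: "b \<in> B" "b' \<in> B" "b \<noteq> b'" "z = crt p q m n b" "z' = crt p q m n b'" by blast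
    then have m: "b \<in> {0..<int N}" "b' \<in> {0..<int N}" using B(3) by blast+
    show "zr p q (crt p q m n ` A) (m - lv p m (fst z) (fst z')) (n - lv q n (snd z) (snd z'))"
      unfolding b(4,5) by (rule zr_of_zero[OF B(1) m b(3) B(5)[OF b(1-3)]])
  next
    fix z z' assume "z \<in> crt p q m n ` A" "z' \<in> crt p q m n ` A" "z \<noteq> z'"
    then obtain b b' where b: "b \<in> A" "b' \<in> A" "b \<noteq> b'" "z = crt p q m n b" "z' = crt p q m n b'" by blast
    then have m: "b \<in> {0..<int N}" "b' \<in> {0..<int N}" using B(1) by blast+
    show "zr p q (crt p q m n ` B) (m - lv p m (fst z) (fst z')) (n - lv q n (snd z) (snd z'))"
      unfolding b(4,5) by (rule zr_of_zero[OF B(3) m b(3) rows[OF b(1-3)]])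
  qed
  then show ?thesis by blast
qed

lemma ext_tiles:
  assumes A: "A \<subseteq> {0..<int N}" and e: "ext p q m n (crt p q m n ` A) K L"
  shows "tiles N A"
proof -
  have car: "carrier (integer_mod_group N) = {0..<int N}" using p0 by (simp add: carrier_integer_mod_group)
  let ?c = "crt p q m n"
  have KL: "K \<subseteq> {..<m}" "L \<subseteq> {..<n}" using e unfolding ext_def by auto
  obtain T where T: "T \<subseteq> {..<p ^ m}" "card T = p ^ (m - card K)" "\<And>t t'. t \<in> T \<Longrightarrow> t' \<in> T \<Longrightarrow> lv p m t t' \<notin> K"
    using tiling_complement[OF pr(1) KL(1)] by blast
  obtain U where U: "U \<subseteq> {..<q ^ n}" "card U = q ^ (n - card L)" "\<And>t t'. t \<in> U \<Longrightarrow> t' \<in> U \<Longrightarrow> lv q n t t' \<notin> L"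
    using tiling_complement[OF pr(2) KL(2)] by blast
  let ?h = "\<lambda>(z, t). ((fst z + fst t) mod p ^ m, (snd z + snd t) mod q ^ n)"
  have bij: "bij_betw ?h (?c ` A \<times> (T \<times> U)) ({..<p ^ m} \<times> {..<q ^ n})"
    by (rule ext_tile[OF e p0(1,2) T U])
  define W where "W = {t \<in> {0..<int N}. ?c t \<in> T \<times> U}"
  have ch: "?c (a + t) = ?h (?c a, ?c t)" for a t
  proof -
    have "nat ((a + t) mod int P) = (nat (a mod int P) + nat (t mod int P)) mod P" if "P > 0" for P
    proof -
      have "int ((nat (a mod int P) + nat (t mod int P)) mod P) = (a mod int P + t mod int P) mod int P"
        using that by (simp add: zmod_int)
      also have "\<dots> = (a + t) mod int P" by (simp add: mod_add_eq)
      finally show ?thesis by (metis nat_int)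
    qed
    note e = this[OF p0(4)] this[OF p0(5)]
    show ?thesis unfolding crt_def fst_conv snd_conv case_prod_conv e ..
  qed
  have eqN: "x = (a + t) mod int N \<longleftrightarrow> ?c x = ?h (?c a, ?c t)" if "x \<in> {0..<int N}" for x a t
  proof -
    have "x = (a + t) mod int N \<longleftrightarrow> x mod int N = (a + t) mod int N" using that by simp
    also have "\<dots> \<longleftrightarrow> ?c x = ?c (a + t)" unfolding crt_eq_iff by (rule mod_eq_dvd_iff)
    finally show ?thesis unfolding ch .
  qed
  have "\<exists>!z. z \<in> A \<times> W \<and> x = (fst z + snd z) mod int N" if x: "x \<in> {0..<int N}" for x
  proof -
    have "?c x \<in> ?h ` (?c ` A \<times> (T \<times> U))" using bij crt_box unfolding bij_betw_def by blast
    then obtain a s where a: "a \<in> A" "s \<in> T \<times> U" "?c x = ?h (?c a, s)" by blast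
    have "s \<in> ?c ` {0..<int N}" using a(2) T(1) U(1) crt_bij unfolding bij_betw_def by blast
    then obtain t where t: "t \<in> {0..<int N}" "s = ?c t" by blast
    have tW: "t \<in> W" using t a(2) unfolding W_def by simp
    show ?thesis
    proof (rule ex1I[of _ "(a, t)"])
      show "(a, t) \<in> A \<times> W \<and> x = (fst (a, t) + snd (a, t)) mod int N"
        using a(1) tW eqN[OF x, of a t] a(3) t(2) by simp
    next
      fix z assume z: "z \<in> A \<times> W \<and> x = (fst z + snd z) mod int N"
      obtain a' t' where z': "z = (a', t')" by (metis surj_pair)
      have m: "a' \<in> A" "t' \<in> {0..<int N}" "?c t' \<in> T \<times> U" using z z' unfolding W_def by auto
      have "?c x = ?h (?c a', ?c t')" using eqN[OF x, of a' t'] z z' by simp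
      then have "?h (?c a', ?c t') = ?h (?c a, s)" using a(3) by simp
      moreover have "(?c a', ?c t') \<in> ?c ` A \<times> (T \<times> U)" "(?c a, s) \<in> ?c ` A \<times> (T \<times> U)" using m a by auto
      ultimately have "(?c a', ?c t') = (?c a, s)" by (rule inj_onD[OF bij_betw_imp_inj_on[OF bij]])
      then have "?c a' = ?c a" "?c t' = ?c t" using t(2) by auto
      then have "a' = a" "t' = t" using crt_inj m a(1) A t(1) unfolding inj_on_def by blast+
      then show "z = (a, t)" using z' by simp
    qed
  qed
  moreover have "W \<subseteq> {0..<int N}" unfolding W_def by blast
  ultimately show ?thesis unfolding tiles_def car mult_integer_mod_group using A by blast
qed

end

theorem theorem1p4:
  fixes p q m n N :: nat and A :: "int set"
  assumes "prime p" and "prime q" and "p \<noteq> q"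
    and "m > 0" and "n > 0"
    and "N = p ^ m * q ^ n"
    and "spectral N A"
    and "(p < q \<and> (m \<le> 9 \<or> n \<le> 6)) \<or> real p powi (int m - 2) < real q ^ 4"
  shows "tiles N A"
proof -
  interpret cyclic_pq p q m n N using assms by unfold_locales
  obtain B where B: "spair p q m n (crt p q m n ` A) B" using spectral_spair[OF assms(7)] by blast
  have A: "A \<subseteq> {0..<int N}" using assms(7) p0 unfolding spectral_def by (simp add: carrier_integer_mod_group)
  have "small p q m n"
    using assms(8)
  proof
    assume h: "real p powi (int m - 2) < real q ^ 4"
    have rp: "real p > 0" using p0 by simp
    \<comment> \<open>The exponent \<open>m - 2\<close> is negative for \<open>m = 1\<close>;
      multiplication by \<open>p^2\<close> leads back to natural powers.\<close>
    have "real p ^ m = real p powi (int m)" by simp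
    also have "\<dots> = real p powi 2 * real p powi (int m - 2)" using rp by (subst power_int_add[symmetric]) auto
    also have "\<dots> \<le> real p ^ 2 * real q ^ 4" using h rp by simp
    finally have "real (p ^ m) \<le> real (p\<^sup>2 * q ^ 4)" by simp
    then have "p ^ m \<le> p\<^sup>2 * q ^ 4" by (simp only: of_nat_le_iff)
    then show ?thesis unfolding small_def by blast
  qed (auto simp: small_def)
  then have "good p q m n (crt p q m n ` A) B" using spair_good[OF B assms(1-3)] by blast
  then show ?thesis unfolding good_def using ext_tiles[OF A] by blast
qed

end
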